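(* Let $\mathcal O$ and $\mathcal O'$ be rings of integers of non-Archimedean local fields with isomorphic finite residue fields. Let $\wp$ and $\wp'$ be the maximal ideals of $\mathcal O$ and $\mathcal O'$, and put $\mathcal O_2=\mathcal O/\wp^2$ and $\mathcal O'_2=\mathcal O'/\wp'^2$. Then for every positive integer $n$ there is a canonical bijection between the set of conjugacy classes of the finite group $\mathrm{GL}_n(\mathcal O_2)$ and the set of conjugacy classes of the finite group $\mathrm{GL}_n(\mathcal O'_2)$ which preserves the cardinality of each conjugacy class.
   Context: For a ring of integers $\mathcal O$ of a non-Archimedean local field with maximal ideal $\wp$ and finite residue field, $\mathcal O_\ell=\mathcal O/\wp^\ell$ for a positive integer $\ell$, and $\mathrm{GL}_n(\mathcal O_\ell)$ is the group of invertible $n\times n$ matrices over $\mathcal O_\ell$. The fields may have different characteristics (e.g. $\mathcal O=\mathbb Z_p$ and $\mathcal O'=\mathbb F_p[[t]]$). The word "canonical" is used in the sense that, after fixing an isomorphism between the residue fields $\mathcal O/\wp$ and $\mathcal O'/\wp'$, the bijection depends on no further choices.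
   Formalization: "Canonical" is read as naturality under isomorphisms preserving chosen uniformizer classes modulo the squared maximal ideals: the bijection may depend on uniformizers as well as the residue field isomorphism, since for n=1, Z_3 and F_3[[t]] no bijection is invariant under t -> 2t. *)

theory Defs
  imports "HOL-Algebra.Algebra" "Jordan_Normal_Form.Matrix"
begin

section \<open>Rings of integers of non-Archimedean local fields\<close>

text \<open>The map \<open>\<nu>\<close> is the normalised discrete valuation.  Its value at zero, mathematically infinite,
  is never used, so zero is treated separately throughout.\<close>

definition valuation_ring :: "'a ring \<Rightarrow> ('a \<Rightarrow> int) \<Rightarrow> 'a ring" where
  "valuation_ring K \<nu> = K\<lparr>carrier := {x \<in> carrier K. x = \<zero>\<^bsub>K\<^esub> \<or> 0 \<le> \<nu> x}\<rparr>"

definition max_ideal :: "'a ring \<Rightarrow> 'a set" where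
  "max_ideal R = (THE P. maximalideal P R)"

definition residue_field :: "'a ring \<Rightarrow> 'a set ring" where
  "residue_field R = R Quot (max_ideal R)"

locale nonarch_local_field = Ring.field K for K :: "'a ring" (structure) +
  fixes \<nu> :: "'a \<Rightarrow> int"
  assumes val_mult: "\<lbrakk>x \<in> carrier K - {\<zero>}; y \<in> carrier K - {\<zero>}\<rbrakk> \<Longrightarrow> \<nu> (x \<otimes> y) = \<nu> x + \<nu> y"
    and val_add: "\<lbrakk>x \<in> carrier K - {\<zero>}; y \<in> carrier K - {\<zero>}; x \<oplus> y \<noteq> \<zero>\<rbrakk>
          \<Longrightarrow> min (\<nu> x) (\<nu> y) \<le> \<nu> (x \<oplus> y)"
    and val_surj: "\<nu> ` (carrier K - {\<zero>}) = UNIV"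
    and complete: "\<lbrakk>\<And>i :: nat. s i \<in> carrier K;
          \<And>N. \<exists>M. \<forall>i\<ge>M. \<forall>j\<ge>M. s i \<ominus> s j = \<zero> \<or> N \<le> \<nu> (s i \<ominus> s j)\<rbrakk>
          \<Longrightarrow> \<exists>l\<in>carrier K. \<forall>N. \<exists>M. \<forall>i\<ge>M. s i \<ominus> l = \<zero> \<or> N \<le> \<nu> (s i \<ominus> l)"
    and finite_residue_field: "finite (carrier (residue_field (valuation_ring K \<nu>)))"

definition local_integer_ring :: "'a ring \<Rightarrow> bool" where
  "local_integer_ring R \<longleftrightarrow> (\<exists>K \<nu>. nonarch_local_field K \<nu> \<and> R = valuation_ring K \<nu>)"

definition uniformizer :: "'a ring \<Rightarrow> 'a \<Rightarrow> bool" where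
  "uniformizer R p \<longleftrightarrow> p \<in> carrier R \<and> max_ideal R = PIdl\<^bsub>R\<^esub> p"

definition max_ideal_sq :: "'a ring \<Rightarrow> 'a set" where
  "max_ideal_sq R = max_ideal R \<cdot>\<^bsub>R\<^esub> max_ideal R"

definition length_two_quot :: "'a ring \<Rightarrow> 'a set ring" where
  "length_two_quot R = R Quot (max_ideal_sq R)"


section \<open>General linear groups over carrier-based rings\<close>

text \<open>The type of matrices is only used as a container: its own multiplication needs a type class,
  so the product is taken with respect to the operations of the ring record \<open>R\<close>.\<close>

definition mat_monoid :: "('a, 'm) ring_scheme \<Rightarrow> nat \<Rightarrow> 'a mat monoid" where
  "mat_monoid R n =
     \<lparr>carrier = {A \<in> carrier_mat n n. \<forall>i<n. \<forall>j<n. A $$ (i, j) \<in> carrier R},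
      Group.monoid.mult = (\<lambda>A B. mat n n (\<lambda>(i, j). \<Oplus>\<^bsub>R\<^esub>k\<in>{..<n}. A $$ (i, k) \<otimes>\<^bsub>R\<^esub> B $$ (k, j))),
      one = mat n n (\<lambda>(i, j). if i = j then \<one>\<^bsub>R\<^esub> else \<zero>\<^bsub>R\<^esub>)\<rparr>"

definition GL :: "nat \<Rightarrow> ('a, 'm) ring_scheme \<Rightarrow> 'a mat monoid" where
  "GL n R = units_of (mat_monoid R n)"

definition conj_classes :: "('a, 'm) monoid_scheme \<Rightarrow> 'a set set" where
  "conj_classes G = orbits G (carrier G) (\<lambda>g. \<lambda>h\<in>carrier G. g \<otimes>\<^bsub>G\<^esub> h \<otimes>\<^bsub>G\<^esub> inv\<^bsub>G\<^esub> g)"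


section \<open>Transport along ring isomorphisms\<close>

text \<open>An isomorphism \<open>\<alpha>\<close> from \<open>R\<close> to \<open>S\<close> maps the maximal ideal onto the maximal ideal.  Elements of a
  quotient of \<open>R\<close> are cosets, i.e. subsets of \<open>R\<close>, and the isomorphism induced by \<open>\<alpha>\<close> on
  \<open>R / \<pp>\<close> or \<open>R / \<pp>\<^sup>2\<close> takes a coset to its image under \<open>\<alpha>\<close>.\<close>

definition class_transport :: "('a \<Rightarrow> 'b) \<Rightarrow> 'a set mat set \<Rightarrow> 'b set mat set" where
  "class_transport \<alpha> C = map_mat ((`) \<alpha>) ` C"

text \<open>Isomorphisms that respect chosen uniformizers, as elements of \<open>\<pp> / \<pp>\<^sup>2\<close>.\<close>

definition pointed_iso :: "('a ring \<Rightarrow> 'a) \<Rightarrow> 'a ring \<Rightarrow> 'a ring \<Rightarrow> ('a \<Rightarrow> 'a) \<Rightarrow> bool" where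
  "pointed_iso \<pi> R S \<alpha> \<longleftrightarrow> \<alpha> \<in> ring_iso R S \<and>
     \<alpha> ` (max_ideal_sq R +>\<^bsub>R\<^esub> \<pi> R) = max_ideal_sq S +>\<^bsub>S\<^esub> \<pi> S"


section \<open>Existence of uniformizers\<close>

context nonarch_local_field
begin

abbreviation "V \<equiv> valuation_ring K \<nu>"

lemma V_simps:
  "carrier V = {x \<in> carrier K. x = \<zero> \<or> 0 \<le> \<nu> x}"
  "x \<oplus>\<^bsub>V\<^esub> y = x \<oplus> y" "x \<otimes>\<^bsub>V\<^esub> y = x \<otimes> y" "\<one>\<^bsub>V\<^esub> = \<one>" "\<zero>\<^bsub>V\<^esub> = \<zero>"
  by (simp_all add: valuation_ring_def)

lemma val_one: "\<nu> \<one> = 0"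
  using val_mult[of \<one> \<one>] by simp

lemma val_m_one: "\<nu> (\<ominus> \<one>) = 0"
proof -
  have nz: "\<ominus> \<one> \<noteq> \<zero>" using add.inv_eq_1_iff by force
  have "\<ominus> \<one> \<otimes> \<ominus> \<one> = \<one>" by (simp add: l_minus r_minus)
  then show ?thesis using val_mult[of "\<ominus> \<one>" "\<ominus> \<one>"] nz val_one by simp
qed

lemma val_minus: assumes "x \<in> carrier K" "x \<noteq> \<zero>" shows "\<nu> (\<ominus> x) = \<nu> x"
proof -
  have nz: "\<ominus> \<one> \<noteq> \<zero>" using add.inv_eq_1_iff by force
  have "\<ominus> x = \<ominus> \<one> \<otimes> x" using assms by (simp add: l_minus)
  then show ?thesis using val_mult[of "\<ominus> \<one>" x] assms nz val_m_one by simp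
qed

lemma val_inv: assumes "x \<in> carrier K" "x \<noteq> \<zero>"
  shows "inv x \<in> carrier K" "inv x \<noteq> \<zero>" "inv x \<otimes> x = \<one>" "\<nu> (inv x) = - \<nu> x"
proof -
  have u: "x \<in> Units K" using assms field_Units by simp
  show i: "inv x \<in> carrier K" and j: "inv x \<otimes> x = \<one>" using u by simp_all
  show k: "inv x \<noteq> \<zero>" using j assms by auto
  show "\<nu> (inv x) = - \<nu> x" using val_mult[of "inv x" x] i j k assms val_one by simp
qed

lemma V_subring: "subring (carrier V) K"
proof (rule subringI)
  fix x y assume x: "x \<in> carrier V" and y: "y \<in> carrier V"
  show "\<ominus> x \<in> carrier V" using x val_minus[of x] by (auto simp: V_simps)
  show "x \<otimes> y \<in> carrier V"
    using x y val_mult[of x y] by (cases "x = \<zero> \<or> y = \<zero>") (auto simp: V_simps)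
  show "x \<oplus> y \<in> carrier V"
    using x y val_add[of x y] by (cases "x = \<zero> \<or> y = \<zero>") (auto simp: V_simps)
qed (auto simp: V_simps val_one)

lemma V_cring: "cring V"
  using subcring_iff[of "carrier V"] subcringI'[OF V_subring] V_simps(1)
  by (auto simp: valuation_ring_def)

lemma V_uniformizer_ideal:
  assumes p: "p \<in> carrier K" "p \<noteq> \<zero>" "\<nu> p = 1"
  shows "PIdl\<^bsub>V\<^esub> p = {x \<in> carrier K. x = \<zero> \<or> 0 < \<nu> x}"
proof
  show "PIdl\<^bsub>V\<^esub> p \<subseteq> {x \<in> carrier K. x = \<zero> \<or> 0 < \<nu> x}"
  proof
    fix x assume "x \<in> PIdl\<^bsub>V\<^esub> p"
    then obtain a where a: "a \<in> carrier V" "x = a \<otimes> p"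
      unfolding cgenideal_def by (auto simp: V_simps)
    then show "x \<in> {x \<in> carrier K. x = \<zero> \<or> 0 < \<nu> x}"
      using p val_mult[of a p] by (cases "a = \<zero>") (auto simp: V_simps)
  qed
  show "{x \<in> carrier K. x = \<zero> \<or> 0 < \<nu> x} \<subseteq> PIdl\<^bsub>V\<^esub> p"
  proof
    fix x assume x: "x \<in> {x \<in> carrier K. x = \<zero> \<or> 0 < \<nu> x}"
    have "x \<otimes> inv p \<in> carrier V"
      using x p val_inv[OF p(1,2)] val_mult[of x "inv p"]
      by (cases "x = \<zero>") (auto simp: V_simps)
    moreover have "x = (x \<otimes> inv p) \<otimes> p"
      using x p val_inv[OF p(1,2)] by (auto simp: m_assoc)
    ultimately show "x \<in> PIdl\<^bsub>V\<^esub> p"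
      unfolding cgenideal_def by (auto simp: V_simps(3))
  qed
qed

lemma ex_val_one:
  obtains p where "p \<in> carrier K" "p \<noteq> \<zero>" "\<nu> p = 1"
proof -
  have "1 \<in> \<nu> ` (carrier K - {\<zero>})" using val_surj by simp
  then obtain p where "1 = \<nu> p" "p \<in> carrier K - {\<zero>}" by (rule imageE)
  then show ?thesis using that[of p] by simp
qed

lemma V_max_ideal:
  defines "P \<equiv> {x \<in> carrier K. x = \<zero> \<or> 0 < \<nu> x}"
  shows "maximalideal P V" "max_ideal V = P"
proof -
  interpret V: cring V by (rule V_cring)
  obtain p where p: "p \<in> carrier K" "p \<noteq> \<zero>" "\<nu> p = 1"
    using ex_val_one .
  have P: "P = PIdl\<^bsub>V\<^esub> p" using V_uniformizer_ideal[OF p] by (simp add: P_def)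
  have idl: "ideal P V" using P V.cgenideal_ideal[of p] p by (simp add: V_simps)
  have "\<one> \<in> carrier V" "\<one> \<notin> P" by (simp_all add: P_def V_simps val_one)
  then have ne: "carrier V \<noteq> P" by blast
  have in_P: "I \<subseteq> P" if I: "ideal I V" "I \<noteq> carrier V" for I
  proof
    fix x assume x: "x \<in> I"
    then have xV: "x \<in> carrier V" using I(1) ideal.Icarr by fastforce
    show "x \<in> P"
    proof (rule ccontr)
      assume "x \<notin> P"
      then have x0: "x \<in> carrier K" "x \<noteq> \<zero>" "\<nu> x = 0" using xV by (auto simp: P_def V_simps)
      then have "inv x \<in> carrier V" using val_inv[of x] by (simp add: V_simps)
      then have "inv x \<otimes>\<^bsub>V\<^esub> x \<in> I" using ideal.I_l_closed[OF I(1) x] by simp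
      then have "\<one>\<^bsub>V\<^esub> \<in> I" using val_inv(3)[OF x0(1,2)] by (simp add: V_simps)
      then show False using ideal.one_imp_carrier[OF I(1)] I(2) by simp
    qed
  qed
  show mx: "maximalideal P V"
  proof (rule maximalidealI[OF idl ne])
    fix J assume "ideal J V" "P \<subseteq> J" "J \<subseteq> carrier V"
    then show "J = P \<or> J = carrier V" using in_P by auto
  qed
  show "max_ideal V = P" unfolding max_ideal_def
  proof (rule the_equality)
    show "maximalideal P V" by (rule mx)
  next
    fix Q assume Q: "maximalideal Q V"
    then have i: "ideal Q V" "Q \<noteq> carrier V"
      using maximalideal.axioms(1) maximalideal.I_notcarr by blast+
    have "P \<subseteq> carrier V" by (auto simp: P_def V_simps)
    then show "Q = P"
      using maximalideal.I_maximal[OF Q idl in_P[OF i]] ne by auto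
  qed
qed

lemma ex_uniformizer_V: "\<exists>p. uniformizer V p"
proof -
  obtain p where p: "p \<in> carrier K" "p \<noteq> \<zero>" "\<nu> p = 1"
    using ex_val_one .
  then have "uniformizer V p"
    unfolding uniformizer_def V_max_ideal(2) V_uniformizer_ideal[OF p] by (simp add: V_simps)
  then show ?thesis ..
qed

end

lemma local_integer_ring_maximalideal:
  assumes "local_integer_ring R" shows "maximalideal (max_ideal R) R"
  using assms by (auto simp: local_integer_ring_def nonarch_local_field.V_max_ideal)

lemma ex_uniformizer_choice:
  "\<exists>\<pi>. \<forall>R :: 'a ring. local_integer_ring R \<longrightarrow> uniformizer R (\<pi> R)"
proof (rule choice, rule allI)
  fix R :: "'a ring"
  show "\<exists>p. local_integer_ring R \<longrightarrow> uniformizer R p"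
    unfolding local_integer_ring_def using nonarch_local_field.ex_uniformizer_V by blast
qed

end

theory Submission
  imports Defs
begin

text \<open>
  Let \<open>A = \<O> / \<pp>\<^sup>2\<close> and \<open>k = \<O> / \<pp>\<close>.  The matrix ring \<open>E = M\<^sub>n(A)\<close> maps onto \<open>F = M\<^sub>n(k)\<close> by
  reduction \<open>\<rho>\<close>, and multiplication by the uniformizer identifies the kernel with \<open>F\<close> again, by a map
  \<open>\<iota>\<close>.  If \<open>G\<close> is a lift of \<open>g = \<rho> G\<close>, then all lifts of \<open>g\<close> are \<open>G + \<iota> x\<close> with \<open>x\<close> in \<open>F\<close>.  Suppose
  that \<open>G\<close> and \<open>H\<close> are lifts of \<open>g\<close> and \<open>h\<close> such that every \<open>u\<close> with \<open>u g = h u\<close> lifts to some \<open>T\<close> with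
  \<open>T G = H T\<close>.  Then \<open>G + \<iota> x\<close> and \<open>H + \<iota> y\<close> are conjugate if and only if there are a unit \<open>u\<close> and an
  element \<open>z\<close> of \<open>F\<close> with \<open>u g = h u\<close> and \<open>u x + z g = y u + h z\<close> (lemma \<open>conjugate_iff\<close>).  This
  condition is about \<open>k\<close> only.  So the theorem follows from a notion of good lift, invariant under
  isomorphisms, such that good lifts exist and intertwiners lift between good lifts: the map
  \<open>G + \<iota> x \<mapsto> G' + \<iota>' (\<theta> x)\<close>, for chosen good lifts \<open>G\<close> of \<open>g\<close> and \<open>G'\<close> of \<open>\<theta> g\<close>, is a bijection of the
  unit groups that preserves and reflects conjugacy.  The induced map on classes does not depend on the
  chosen good lifts, and this is also why it is compatible with isomorphisms.

  Good lifts are found through the Jordan decomposition.  For a large power \<open>q\<close> of the characteristic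
  of \<open>k\<close>, the semisimple part of \<open>g\<close> is \<open>g\<^sup>q\<close> and the nilpotent part is \<open>g - g\<^sup>q\<close>.  Two commuting
  elements of \<open>E\<close> with the same reduction have the same \<open>q\<close>-th power (\<open>pow_eq_of_same_rho\<close>), so
  \<open>S = G\<^sup>q\<^sup>q\<close> is a canonical lift of the semisimple part.  The lift \<open>G\<close> is called good when the kernel
  of each power of \<open>N = G - S\<close> reduces onto the kernel of the corresponding power of the nilpotent part
  of \<open>g\<close>.

  Lifting an intertwiner \<open>t\<close> of nilpotent parts means solving a Sylvester equation \<open>m x - x n = y\<close> in
  \<open>F\<close>.  It is solvable when the elements \<open>\<Sum>i<j. m\<^sup>j\<^sup>-\<^sup>1\<^sup>-\<^sup>i y n\<^sup>i\<close> map the kernel of \<open>n\<^sup>j\<close> into the image of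
  \<open>m\<^sup>j\<close> for all \<open>j\<close> (\<open>sylvester_nilpotent\<close>), and the lifted kernels provide this condition.  A lift that
  intertwines the nilpotent parts is then corrected to intertwine the semisimple parts as well, by an
  averaging argument that uses \<open>S\<^sup>q = S\<close> and \<open>q = 0\<close> in \<open>k\<close> (\<open>good_intertwiner_lifts\<close>).  The existence
  of good lifts (\<open>good_lift_exists\<close>) follows by enlarging step by step the range of powers whose kernels
  lift.

  All this takes place in the rings \<open>E\<close> and \<open>F\<close>, without vectors or canonical forms.  Besides the
  exponent \<open>q\<close>, which exists because \<open>F\<close> is finite of prime characteristic, the property of \<open>F\<close> that
  carries the argument is von Neumann regularity: each \<open>a\<close> has some \<open>b\<close> with \<open>a b a = a\<close>.
\<close>

section \<open>The Sylvester equation in a von Neumann regular ring\<close>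

definition von_neumann_regular :: "('a, 'm) ring_scheme \<Rightarrow> bool" where
  "von_neumann_regular R \<longleftrightarrow>
     (\<forall>a\<in>carrier R. \<exists>b\<in>carrier R. a \<otimes>\<^bsub>R\<^esub> b \<otimes>\<^bsub>R\<^esub> a = a)"

text \<open>The value at \<open>j\<close> is \<open>\<Sum>i<j. m\<^sup>j\<^sup>-\<^sup>1\<^sup>-\<^sup>i y n\<^sup>i\<close>.  If \<open>t\<close> fails to intertwine \<open>n\<close> and \<open>m\<close> by
\<open>m t - t n = y\<close>, then this is the failure \<open>m\<^sup>j t - t n\<^sup>j\<close> for the \<open>j\<close>-th powers.  With \<open>t = 1\<close> it
is the first-order change of \<open>n\<^sup>j\<close> under the perturbation of \<open>n\<close> by \<open>y\<close>.\<close>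

fun intertwining_defect ::
    "('a, 'm) ring_scheme \<Rightarrow> 'a \<Rightarrow> 'a \<Rightarrow> 'a \<Rightarrow> nat \<Rightarrow> 'a" where
  "intertwining_defect R m n y 0 = \<zero>\<^bsub>R\<^esub>"
| "intertwining_defect R m n y (Suc j) =
     m \<otimes>\<^bsub>R\<^esub> intertwining_defect R m n y j \<oplus>\<^bsub>R\<^esub> y \<otimes>\<^bsub>R\<^esub> n [^]\<^bsub>R\<^esub> j"

context ring
begin

lemma defect_closed [simp]:
  assumes "m \<in> carrier R" "n \<in> carrier R" "y \<in> carrier R"
  shows "intertwining_defect R m n y j \<in> carrier R"
  by (induction j) (use assms in auto)

lemma mult_left_cong:
  assumes "x \<otimes> y = z \<otimes> w"
    and "x \<in> carrier R" "y \<in> carrier R" "z \<in> carrier R" "w \<in> carrier R" "v \<in> carrier R"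
  shows "x \<otimes> (y \<otimes> v) = z \<otimes> (w \<otimes> v)"
  using assms by (metis m_assoc)

lemma defect_Suc_right:
  assumes "m \<in> carrier R" "n \<in> carrier R" "y \<in> carrier R"
  shows "intertwining_defect R m n y (Suc j) =
    intertwining_defect R m n y j \<otimes> n \<oplus> m [^] j \<otimes> y"
proof (induction j)
  case 0
  then show ?case using assms by simp
next
  case (Suc j)
  let ?W = "intertwining_defect R m n y"
  have "?W (Suc (Suc j)) = m \<otimes> (?W j \<otimes> n \<oplus> m [^] j \<otimes> y) \<oplus> y \<otimes> n [^] (Suc j)"
    using Suc by simp
  also have "\<dots> = (m \<otimes> ?W j \<oplus> y \<otimes> n [^] j) \<otimes> n \<oplus> m \<otimes> m [^] j \<otimes> y"
    using assms by (simp add: l_distr r_distr m_assoc a_ac)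
  also have "m \<otimes> m [^] j = m [^] Suc j"
    using assms by (simp flip: nat_pow_Suc2)
  finally show ?case by simp
qed

text \<open>The descending induction step for the equation \<open>m x - x n = y\<close>.  Think of \<open>x\<close> as prescribed on the
image of \<open>n\<^sup>j\<^sup>+\<^sup>1\<close> only; there it solves the equation (\<open>eqx\<close>), and \<open>eqz\<close> is the congruence modulo
the image of \<open>m\<^sup>j\<^sup>+\<^sup>1\<close> that every global solution satisfies, because \<open>x n\<^sup>j = m\<^sup>j x - y\<^sub>j\<close> for the
defect \<open>y\<^sub>j\<close>.  To extend \<open>x\<close> to the larger image of \<open>n\<^sup>j\<close>, put \<open>x (n\<^sup>j u) = m\<^sup>j z u - y\<^sub>j u\<close> on a
complement of the image of \<open>n\<^sup>j\<^sup>+\<^sup>1\<close>: the congruence gives the equation at the new vectors.  Inner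
inverses \<open>c\<close> and \<open>d\<close> of \<open>n\<^sup>j\<^sup>+\<^sup>1\<close> and \<open>n\<^sup>j\<close> supply the projection \<open>f\<close> onto the smaller image and a
section of \<open>n\<^sup>j\<close>, and the hypothesis \<open>ker\<close> makes the choice of preimages irrelevant modulo the image
of \<open>m\<^sup>j\<close>.\<close>

lemma sylvester_step:
  assumes reg: "von_neumann_regular R"
    and car: "m \<in> carrier R" "n \<in> carrier R" "y \<in> carrier R" "x \<in> carrier R" "z \<in> carrier R"
    and ker: "\<And>w. w \<in> carrier R \<Longrightarrow> n [^] j \<otimes> w = \<zero> \<Longrightarrow>
        \<exists>u\<in>carrier R. intertwining_defect R m n y j \<otimes> w = m [^] j \<otimes> u"
    and eqx: "m \<otimes> x \<otimes> n [^] Suc j = x \<otimes> n \<otimes> n [^] Suc j \<oplus> y \<otimes> n [^] Suc j"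
    and eqz: "x \<otimes> n [^] Suc j \<oplus> intertwining_defect R m n y (Suc j) = m [^] Suc j \<otimes> z"
  shows "\<exists>x'\<in>carrier R. \<exists>z'\<in>carrier R.
     m \<otimes> x' \<otimes> n [^] j = x' \<otimes> n \<otimes> n [^] j \<oplus> y \<otimes> n [^] j \<and>
     x' \<otimes> n [^] j \<oplus> intertwining_defect R m n y j = m [^] j \<otimes> z'"
proof -
  define a b D where "a = n [^] j" and "b = m [^] j" and "D = intertwining_defect R m n y j"
  have abD [simp]: "a \<in> carrier R" "b \<in> carrier R" "D \<in> carrier R"
    using car by (simp_all add: a_def b_def D_def)
  note [simp] = car
  have na: "n \<otimes> a = a \<otimes> n" and mb: "m \<otimes> b = b \<otimes> m"
    by (simp_all add: a_def b_def flip: nat_pow_Suc2)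
  have an: "n [^] Suc j = a \<otimes> n" and bm: "m [^] Suc j = m \<otimes> b"
    using mb by (simp_all add: a_def b_def)
  have D1: "intertwining_defect R m n y (Suc j) = m \<otimes> D \<oplus> y \<otimes> a"
    by (simp add: D_def a_def)
  have D2: "intertwining_defect R m n y (Suc j) = D \<otimes> n \<oplus> b \<otimes> y"
    unfolding D_def b_def by (rule defect_Suc_right) simp_all
  obtain c where c [simp]: "c \<in> carrier R" and c': "a \<otimes> n \<otimes> c \<otimes> (a \<otimes> n) = a \<otimes> n"
    using reg abD(1) car(2) unfolding von_neumann_regular_def by (meson m_closed)
  obtain d where d [simp]: "d \<in> carrier R" and d': "a \<otimes> d \<otimes> a = a"
    using reg abD(1) unfolding von_neumann_regular_def by blast
  define f where "f = a \<otimes> n \<otimes> c"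
  have f [simp]: "f \<in> carrier R" by (simp add: f_def)
  have fan: "f \<otimes> (a \<otimes> n) = a \<otimes> n" using c' by (simp add: f_def)
  \<comment> \<open>The element \<open>r\<close> picks preimages under \<open>n\<^sup>j\<close> of the components in the complement.\<close>
  define r where "r = d \<otimes> (a \<ominus> f \<otimes> a)"
  have r [simp]: "r \<in> carrier R" by (simp add: r_def)
  have "a \<otimes> r = a \<otimes> d \<otimes> a \<ominus> (a \<otimes> d \<otimes> a) \<otimes> (n \<otimes> c \<otimes> a)"
    by (simp add: r_def f_def minus_eq r_distr r_minus m_assoc)
  then have ar: "a \<otimes> r = a \<ominus> f \<otimes> a"
    unfolding d' by (simp add: f_def m_assoc)
  then have asplit: "f \<otimes> a \<oplus> a \<otimes> r = a" by (simp add: minus_eq r_neg a_lcomm)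
  define x' where "x' = x \<otimes> f \<oplus> (b \<otimes> z \<ominus> D) \<otimes> (d \<otimes> (\<one> \<ominus> f))"
  have x' [simp]: "x' \<in> carrier R" by (simp add: x'_def)
  have "(\<one> \<ominus> f) \<otimes> (a \<otimes> n) = \<zero>"
    using fan by (simp add: minus_eq l_distr l_minus r_neg)
  then have x'an: "x' \<otimes> (a \<otimes> n) = x \<otimes> (a \<otimes> n)"
    using fan by (simp add: x'_def l_distr m_assoc)
  have "(\<one> \<ominus> f) \<otimes> a = a \<ominus> f \<otimes> a" by (simp add: minus_eq l_distr l_minus)
  then have x'a: "x' \<otimes> a = x \<otimes> (f \<otimes> a) \<oplus> (b \<otimes> z \<ominus> D) \<otimes> r"
    by (simp add: x'_def l_distr m_assoc r_def)
  have fa: "f \<otimes> a = a \<otimes> n \<otimes> (c \<otimes> a)" by (simp add: f_def m_assoc)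
  have e1: "m \<otimes> (x \<otimes> (a \<otimes> n)) = x \<otimes> n \<otimes> (a \<otimes> n) \<oplus> y \<otimes> (a \<otimes> n)"
    using eqx unfolding an by (simp add: m_assoc)
  have e2: "m \<otimes> (b \<otimes> z) = x \<otimes> (a \<otimes> n) \<oplus> (m \<otimes> D \<oplus> y \<otimes> a)"
    using eqz unfolding an bm D1 by (simp add: m_assoc)
  have e3: "m \<otimes> (x \<otimes> (f \<otimes> a)) = x \<otimes> n \<otimes> (f \<otimes> a) \<oplus> y \<otimes> (f \<otimes> a)"
  proof -
    have "m \<otimes> (x \<otimes> (f \<otimes> a)) = m \<otimes> (x \<otimes> (a \<otimes> n)) \<otimes> (c \<otimes> a)"
      by (simp add: fa m_assoc)
    then show ?thesis by (simp add: e1 fa l_distr m_assoc)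
  qed
  have e4: "m \<otimes> ((b \<otimes> z \<ominus> D) \<otimes> r) = x \<otimes> n \<otimes> (a \<otimes> r) \<oplus> y \<otimes> (a \<otimes> r)"
  proof -
    have "m \<otimes> ((b \<otimes> z \<ominus> D) \<otimes> r) = (m \<otimes> (b \<otimes> z) \<ominus> m \<otimes> D) \<otimes> r"
      by (simp add: minus_eq r_distr l_distr r_minus l_minus m_assoc)
    also have "m \<otimes> (b \<otimes> z) \<ominus> m \<otimes> D = x \<otimes> (a \<otimes> n) \<oplus> y \<otimes> a"
    proof -
      have "m \<otimes> (b \<otimes> z) \<ominus> m \<otimes> D = x \<otimes> (a \<otimes> n) \<oplus> y \<otimes> a \<oplus> (m \<otimes> D \<ominus> m \<otimes> D)"
        unfolding e2 by (simp add: minus_eq a_ac)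
      then show ?thesis by (simp add: minus_eq r_neg)
    qed
    finally show ?thesis using na by (simp add: l_distr m_assoc) (simp flip: m_assoc)
  qed
  have "m \<otimes> (x' \<otimes> a) = x \<otimes> n \<otimes> (f \<otimes> a \<oplus> a \<otimes> r) \<oplus> y \<otimes> (f \<otimes> a \<oplus> a \<otimes> r)"
    using e3 e4 by (simp add: x'a r_distr a_ac)
  then have "m \<otimes> (x' \<otimes> a) = x \<otimes> (a \<otimes> n) \<oplus> y \<otimes> a"
    unfolding asplit using na by (simp add: m_assoc)
  then have A: "m \<otimes> x' \<otimes> a = x' \<otimes> n \<otimes> a \<oplus> y \<otimes> a"
    using x'an na by (simp add: m_assoc)
  \<comment> \<open>The difference of two ways to choose preimages under \<open>n\<^sup>j\<close>; the hypothesis \<open>ker\<close> applies to it.\<close>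
  define w where "w = \<one> \<ominus> n \<otimes> (c \<otimes> a) \<ominus> r"
  have w [simp]: "w \<in> carrier R" by (simp add: w_def)
  have "a \<otimes> w = a \<ominus> f \<otimes> a \<ominus> a \<otimes> r"
    by (simp add: w_def fa minus_eq r_distr r_minus m_assoc)
  then have "a \<otimes> w = \<zero>" unfolding ar by (simp add: r_neg minus_eq)
  then obtain u where u [simp]: "u \<in> carrier R" and Dw: "D \<otimes> w = b \<otimes> u"
    using ker[OF w] by (auto simp: a_def b_def D_def)
  have xan: "x \<otimes> (a \<otimes> n) = m \<otimes> (b \<otimes> z) \<ominus> (D \<otimes> n \<oplus> b \<otimes> y)"
  proof -
    have "x \<otimes> (a \<otimes> n) \<oplus> (D \<otimes> n \<oplus> b \<otimes> y) = m \<otimes> (b \<otimes> z)"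
      using eqz unfolding an bm D2 by (simp add: m_assoc)
    then have "m \<otimes> (b \<otimes> z) \<ominus> (D \<otimes> n \<oplus> b \<otimes> y) =
      x \<otimes> (a \<otimes> n) \<oplus> (D \<otimes> n \<oplus> b \<otimes> y) \<ominus> (D \<otimes> n \<oplus> b \<otimes> y)" by simp
    also have "\<dots> = x \<otimes> (a \<otimes> n)" using car abD by (simp add: minus_eq a_assoc r_neg)
    finally show ?thesis by simp
  qed
  have "x' \<otimes> a \<oplus> D = x \<otimes> (a \<otimes> n) \<otimes> (c \<otimes> a) \<oplus> (b \<otimes> z \<ominus> D) \<otimes> r \<oplus> D"
    by (simp add: x'a fa m_assoc)
  also have "\<dots> = m \<otimes> b \<otimes> (z \<otimes> (c \<otimes> a)) \<ominus> b \<otimes> (y \<otimes> (c \<otimes> a)) \<oplus> b \<otimes> (z \<otimes> r) \<oplus> D \<otimes> w"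
    unfolding xan w_def by (simp add: minus_eq r_distr l_distr r_minus l_minus m_assoc minus_add a_ac)
  also have "\<dots> = b \<otimes> (m \<otimes> (z \<otimes> (c \<otimes> a)) \<ominus> y \<otimes> (c \<otimes> a) \<oplus> z \<otimes> r \<oplus> u)"
    unfolding Dw mb by (simp add: minus_eq r_distr r_minus m_assoc)
  finally have B: "x' \<otimes> a \<oplus> D = b \<otimes> (m \<otimes> (z \<otimes> (c \<otimes> a)) \<ominus> y \<otimes> (c \<otimes> a) \<oplus> z \<otimes> r \<oplus> u)" .
  show ?thesis
    using A B unfolding a_def b_def D_def by (intro bexI[OF _ x'] bexI[of _ "m \<otimes> (z \<otimes> (c \<otimes> a)) \<ominus> y \<otimes> (c \<otimes> a) \<oplus> z \<otimes> r \<oplus> u"] conjI) (auto simp: a_def)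
qed

text \<open>For nilpotent \<open>n\<close> the equation \<open>m x = x n + y\<close> is solvable as soon as each defect maps the kernel of
\<open>n\<^sup>j\<close> into the image of \<open>m\<^sup>j\<close>, a condition which every solution forces.  Start with \<open>x = 0\<close> on the
image of \<open>n\<^sup>l = 0\<close> and descend to the image of \<open>n\<^sup>0 = 1\<close>.  For matrices over a field, Jordan bases of
\<open>n\<close> and \<open>m\<close> lead to the same result; inner inverses take their place.\<close>

lemma sylvester_nilpotent:
  assumes reg: "von_neumann_regular R"
    and car: "m \<in> carrier R" "n \<in> carrier R" "y \<in> carrier R"
    and nil: "n [^] (l::nat) = \<zero>"
    and ker: "\<And>j w. j \<le> l \<Longrightarrow> w \<in> carrier R \<Longrightarrow> n [^] j \<otimes> w = \<zero> \<Longrightarrow>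
        \<exists>u\<in>carrier R. intertwining_defect R m n y j \<otimes> w = m [^] j \<otimes> u"
  shows "\<exists>x\<in>carrier R. m \<otimes> x = x \<otimes> n \<oplus> y"
proof -
  have "\<exists>x\<in>carrier R. \<exists>z\<in>carrier R.
     m \<otimes> x \<otimes> n [^] j = x \<otimes> n \<otimes> n [^] j \<oplus> y \<otimes> n [^] j \<and>
     x \<otimes> n [^] j \<oplus> intertwining_defect R m n y j = m [^] j \<otimes> z" if "j \<le> l" for j
    using that
  proof (induction rule: inc_induct)
    case base
    obtain u where "u \<in> carrier R" "intertwining_defect R m n y l \<otimes> \<one> = m [^] l \<otimes> u"
      using ker[of l \<one>] nil by auto
    then show ?case using car nil by (intro bexI[of _ \<zero>] bexI[of _ u]) auto
  next
    case (step j)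
    then obtain x z where "x \<in> carrier R" "z \<in> carrier R"
       "m \<otimes> x \<otimes> n [^] Suc j = x \<otimes> n \<otimes> n [^] Suc j \<oplus> y \<otimes> n [^] Suc j"
       "x \<otimes> n [^] Suc j \<oplus> intertwining_defect R m n y (Suc j) = m [^] Suc j \<otimes> z" by blast
    with step.hyps show ?case
      by (intro sylvester_step[OF reg car _ _ ker]) simp_all
  qed
  from this[of 0] obtain x where "x \<in> carrier R" "m \<otimes> x \<otimes> \<one> = x \<otimes> n \<otimes> \<one> \<oplus> y \<otimes> \<one>"
    by auto
  then show ?thesis using car by auto
qed

text \<open>Modulo the elements \<open>s' z - z s\<close>, the factors \<open>s'\<close> and \<open>s\<close> on the two sides of \<open>y\<close> may be
exchanged, so each of the \<open>j + 1\<close> summands of the defect may be replaced by \<open>y s\<^sup>j\<close>.  All the elements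
\<open>z\<close> that occur are built from \<open>y\<close>, \<open>s'\<close> and \<open>s\<close>, hence still intertwine \<open>n\<close> and \<open>m\<close>.  When
\<open>j + 1\<close> kills the ring, the defect is itself of the form \<open>s' z - z s\<close>.\<close>

lemma defect_averaging:
  assumes car: "s' \<in> carrier R" "s \<in> carrier R" "y \<in> carrier R" "m \<in> carrier R" "n \<in> carrier R"
    and comm: "m \<otimes> s' = s' \<otimes> m" "n \<otimes> s = s \<otimes> n" "m \<otimes> y = y \<otimes> n"
  shows "\<exists>z\<in>carrier R. m \<otimes> z = z \<otimes> n \<and>
    intertwining_defect R s' s y (Suc j) = [Suc j] \<cdot> (y \<otimes> s [^] j) \<oplus> (s' \<otimes> z \<ominus> z \<otimes> s)"
proof (induction j)
  case 0
  then show ?case using car by (intro bexI[of _ \<zero>]) (auto simp: minus_eq)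
next
  case (Suc j)
  note [simp] = car
  let ?W = "intertwining_defect R s' s y"
  obtain z where z [simp]: "z \<in> carrier R" and mz: "m \<otimes> z = z \<otimes> n"
    and W: "?W (Suc j) = [Suc j] \<cdot> (y \<otimes> s [^] j) \<oplus> (s' \<otimes> z \<ominus> z \<otimes> s)"
    using Suc by blast
  define v where "v = y \<otimes> s [^] j"
  have v [simp]: "v \<in> carrier R" by (simp add: v_def)
  define k where "k = [Suc j] \<cdot> v"
  have k [simp]: "k \<in> carrier R" by (simp add: k_def)
  have ns: "n \<otimes> s [^] j = s [^] j \<otimes> n"
    using pow_mult_distrib comm(2) group_commutes_pow car by metis
  have "m \<otimes> v = v \<otimes> n"
    using comm(3) ns mult_left_cong[of m y y n "s [^] j"] by (simp add: v_def m_assoc)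
  then have mk: "m \<otimes> k = k \<otimes> n"
    unfolding k_def using add_pow_rdistr[of m v "Suc j"] add_pow_ldistr[of v n "Suc j"]
    by (simp del: add.nat_pow_Suc)
  define z' where "z' = s' \<otimes> z \<oplus> k"
  have z' [simp]: "z' \<in> carrier R" by (simp add: z'_def)
  have "m \<otimes> (s' \<otimes> z) = s' \<otimes> z \<otimes> n"
    using mz mult_left_cong[OF comm(1), of z] by (simp add: m_assoc)
  then have mz': "m \<otimes> z' = z' \<otimes> n" using mk by (simp add: z'_def r_distr l_distr)
  have ks: "k \<otimes> s = [Suc j] \<cdot> (y \<otimes> s [^] Suc j)"
    unfolding k_def by (subst add_pow_ldistr) (simp_all add: v_def m_assoc)
  have "[Suc (Suc j)] \<cdot> (y \<otimes> s [^] Suc j) = k \<otimes> s \<oplus> v \<otimes> s"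
    unfolding ks by (simp add: v_def m_assoc)
  moreover have "?W (Suc (Suc j)) = s' \<otimes> (k \<oplus> (s' \<otimes> z \<ominus> z \<otimes> s)) \<oplus> v \<otimes> s"
    unfolding intertwining_defect.simps(2)[of _ _ _ _ "Suc j"] W by (simp add: v_def k_def m_assoc)
  moreover have "\<dots> = k \<otimes> s \<oplus> v \<otimes> s \<oplus> (s' \<otimes> z' \<ominus> z' \<otimes> s)"
  proof -
    have "k \<otimes> s \<oplus> v \<otimes> s \<oplus> (s' \<otimes> z' \<ominus> z' \<otimes> s) =
      v \<otimes> s \<oplus> s' \<otimes> z' \<ominus> s' \<otimes> z \<otimes> s \<oplus> (k \<otimes> s \<ominus> k \<otimes> s)"
      by (simp add: z'_def minus_eq l_distr r_distr minus_add a_ac)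
    then show ?thesis by (simp add: z'_def minus_eq l_distr r_distr r_neg r_minus m_assoc a_ac)
  qed
  ultimately show ?case using mz' by (intro bexI[OF _ z']) auto
qed

end

section \<open>Square-zero extensions\<close>

text \<open>In a finite ring of prime characteristic \<open>p\<close>, a suitable power \<open>q\<close> of \<open>p\<close> satisfies this.  For
a matrix \<open>g\<close> over a finite field, \<open>g\<^sup>q\<close> is then the semisimple part of \<open>g\<close>, and \<open>g - g\<^sup>q\<close> is the
nilpotent part.  The properties are stated without reference to \<open>p\<close>, so they pass through ring
isomorphisms.\<close>

definition frobenius_exponent :: "('a, 'm) ring_scheme \<Rightarrow> nat \<Rightarrow> bool" where
  "frobenius_exponent R q \<longleftrightarrow> 0 < q \<and>
     (\<forall>x\<in>carrier R. [q] \<cdot>\<^bsub>R\<^esub> x = \<zero>\<^bsub>R\<^esub> \<and> (x [^]\<^bsub>R\<^esub> q) [^]\<^bsub>R\<^esub> q = x [^]\<^bsub>R\<^esub> q) \<and>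
     (\<forall>x\<in>carrier R. \<forall>y\<in>carrier R. x \<otimes>\<^bsub>R\<^esub> y = y \<otimes>\<^bsub>R\<^esub> x \<longrightarrow>
        (x \<ominus>\<^bsub>R\<^esub> y) [^]\<^bsub>R\<^esub> q = x [^]\<^bsub>R\<^esub> q \<ominus>\<^bsub>R\<^esub> y [^]\<^bsub>R\<^esub> q)"

definition kernels_lift ::
    "('a, 'm) ring_scheme \<Rightarrow> ('b, 'k) ring_scheme \<Rightarrow> ('a \<Rightarrow> 'b) \<Rightarrow> nat \<Rightarrow> 'a \<Rightarrow> bool" where
  "kernels_lift E F \<rho> l N \<longleftrightarrow>
     (\<forall>j\<le>l. \<forall>w\<in>carrier F. \<rho> N [^]\<^bsub>F\<^esub> j \<otimes>\<^bsub>F\<^esub> w = \<zero>\<^bsub>F\<^esub> \<longrightarrow>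
        (\<exists>W\<in>carrier E. \<rho> W = w \<and> N [^]\<^bsub>E\<^esub> j \<otimes>\<^bsub>E\<^esub> W = \<zero>\<^bsub>E\<^esub>))"

text \<open>The element \<open>G\<^sup>q\<^sup>q\<close> lifts the semisimple part of the reduction of \<open>G\<close>; taking two \<open>q\<close>-th powers
guarantees that this lift equals its own \<open>q\<close>-th power, so it is the Teichmueller lift inside the ring
generated by \<open>G\<close>.  The condition on the remaining nilpotent part is modelled on the nilpotent Jordan
matrices with entries 0 and 1: the powers of such a matrix have kernels spanned by the same unit
vectors over every ring.\<close>

definition good_lift ::
    "('a, 'm) ring_scheme \<Rightarrow> ('b, 'k) ring_scheme \<Rightarrow> ('a \<Rightarrow> 'b) \<Rightarrow> nat \<Rightarrow> 'a \<Rightarrow> bool" where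
  "good_lift E F \<rho> q G \<longleftrightarrow> G \<in> carrier E \<and>
     kernels_lift E F \<rho> q (G \<ominus>\<^bsub>E\<^esub> G [^]\<^bsub>E\<^esub> (q * q))"

text \<open>The kernel of \<open>\<rho>\<close> is a copy of \<open>F\<close> itself, embedded by \<open>\<iota>\<close> and acted on from both sides through
\<open>\<rho>\<close>; in particular it has square zero.  For the quotients of a discrete valuation ring, \<open>\<iota>\<close> is
multiplication by the uniformizer.\<close>

locale square_zero_extension = ring_hom_ring E F \<rho>
  for E :: "('a, 'm) ring_scheme" (structure)
    and F :: "('b, 'k) ring_scheme" (structure)
    and \<rho> :: "'a \<Rightarrow> 'b" +
  fixes \<iota> :: "'b \<Rightarrow> 'a"
  assumes rho_surj: "\<rho> ` carrier E = carrier F"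
    and iota_closed [simp, intro]: "x \<in> carrier F \<Longrightarrow> \<iota> x \<in> carrier E"
    and iota_add: "\<lbrakk>x \<in> carrier F; y \<in> carrier F\<rbrakk> \<Longrightarrow> \<iota> (x \<oplus>\<^bsub>F\<^esub> y) = \<iota> x \<oplus> \<iota> y"
    and iota_inj: "inj_on \<iota> (carrier F)"
    and kernel_eq: "{x \<in> carrier E. \<rho> x = \<zero>\<^bsub>F\<^esub>} = \<iota> ` carrier F"
    and l_iota: "\<lbrakk>a \<in> carrier E; x \<in> carrier F\<rbrakk> \<Longrightarrow> a \<otimes> \<iota> x = \<iota> (\<rho> a \<otimes>\<^bsub>F\<^esub> x)"
    and r_iota: "\<lbrakk>a \<in> carrier E; x \<in> carrier F\<rbrakk> \<Longrightarrow> \<iota> x \<otimes> a = \<iota> (x \<otimes>\<^bsub>F\<^esub> \<rho> a)"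
begin

abbreviation defF where "defF \<equiv> intertwining_defect F"

lemma rho_closed [simp]: "x \<in> carrier E \<Longrightarrow> \<rho> x \<in> carrier F"
  by (rule hom_closed)

lemma rho_iota [simp]: "x \<in> carrier F \<Longrightarrow> \<rho> (\<iota> x) = \<zero>\<^bsub>F\<^esub>"
  using kernel_eq by blast

lemma iota_zero [simp]: "\<iota> \<zero>\<^bsub>F\<^esub> = \<zero>"
  using l_iota[of \<zero> "\<zero>\<^bsub>F\<^esub>"] by simp

lemma iota_eq_iff [simp]:
  "\<lbrakk>x \<in> carrier F; y \<in> carrier F\<rbrakk> \<Longrightarrow> \<iota> x = \<iota> y \<longleftrightarrow> x = y"
  using iota_inj by (auto dest: inj_onD)

lemma iota_neg: "x \<in> carrier F \<Longrightarrow> \<iota> (\<ominus>\<^bsub>F\<^esub> x) = \<ominus> \<iota> x"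
  using iota_add[of "\<ominus>\<^bsub>F\<^esub> x" x] R.minus_equality[of "\<iota> (\<ominus>\<^bsub>F\<^esub> x)" "\<iota> x"]
  by (simp add: S.l_neg)

lemma iota_minus: "\<lbrakk>x \<in> carrier F; y \<in> carrier F\<rbrakk> \<Longrightarrow> \<iota> (x \<ominus>\<^bsub>F\<^esub> y) = \<iota> x \<ominus> \<iota> y"
  by (simp add: R.minus_eq S.minus_eq iota_add iota_neg)

lemma rho_minus [simp]: "\<lbrakk>x \<in> carrier E; y \<in> carrier E\<rbrakk> \<Longrightarrow> \<rho> (x \<ominus> y) = \<rho> x \<ominus>\<^bsub>F\<^esub> \<rho> y"
  by (simp add: R.minus_eq S.minus_eq)

lemma rho_pow [simp]: "x \<in> carrier E \<Longrightarrow> \<rho> (x [^] (j::nat)) = \<rho> x [^]\<^bsub>F\<^esub> j"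
  by (rule hom_nat_pow)

lemma iota_mult_iota [simp]: "\<lbrakk>x \<in> carrier F; y \<in> carrier F\<rbrakk> \<Longrightarrow> \<iota> x \<otimes> \<iota> y = \<zero>"
  by (simp add: l_iota)

lemma lift_obtain:
  assumes "x \<in> carrier F" obtains A where "A \<in> carrier E" "\<rho> A = x"
  using assms rho_surj that by (metis imageE)

lemma same_rho_obtain:
  assumes "A \<in> carrier E" "B \<in> carrier E" "\<rho> A = \<rho> B"
  obtains c where "c \<in> carrier F" "A = B \<oplus> \<iota> c"
proof -
  have "A \<ominus> B \<in> {x \<in> carrier E. \<rho> x = \<zero>\<^bsub>F\<^esub>}"
    using assms by (simp add: S.minus_eq S.r_neg)
  then obtain c where c: "c \<in> carrier F" "A \<ominus> B = \<iota> c" unfolding kernel_eq by blast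
  have "A = B \<oplus> (A \<ominus> B)" using assms by (simp add: R.minus_eq R.a_lcomm R.r_neg)
  with c that show ?thesis by simp
qed

text \<open>A failure to commute that lies in the square-zero ideal propagates to powers by the Leibniz rule, with
no higher-order terms.\<close>

lemma defect_iota:
  assumes "M \<in> carrier E" "N \<in> carrier E" "T \<in> carrier E" "y \<in> carrier F"
    and "M \<otimes> T = T \<otimes> N \<oplus> \<iota> y"
  shows "M [^] j \<otimes> T = T \<otimes> N [^] j \<oplus> \<iota> (defF (\<rho> M) (\<rho> N) y j)"
proof (induction j)
  case 0
  then show ?case using assms by simp
next
  case (Suc j)
  let ?d = "defF (\<rho> M) (\<rho> N) y j"
  have d: "?d \<in> carrier F" using assms by simp
  note car = assms(1-4)
  have "M [^] Suc j \<otimes> T = M \<otimes> (M [^] j \<otimes> T)"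
    unfolding R.nat_pow_Suc2[OF car(1)] using car by (simp add: R.m_assoc)
  also have "\<dots> = M \<otimes> T \<otimes> N [^] j \<oplus> \<iota> (\<rho> M \<otimes>\<^bsub>F\<^esub> ?d)"
    unfolding Suc using car d by (simp add: R.r_distr R.m_assoc l_iota)
  also have "M \<otimes> T \<otimes> N [^] j = T \<otimes> N [^] Suc j \<oplus> \<iota> (y \<otimes>\<^bsub>F\<^esub> \<rho> N [^]\<^bsub>F\<^esub> j)"
    unfolding assms(5) R.nat_pow_Suc2[OF car(2)] using car by (simp add: R.l_distr R.m_assoc r_iota)
  finally show ?case using car d by (simp add: iota_add R.a_ac)
qed

text \<open>If \<open>A = B + \<iota> c\<close> commutes with \<open>B\<close>, then \<open>A\<^sup>q = B\<^sup>q + q B\<^sup>q\<^sup>-\<^sup>1 \<iota> c\<close>, and \<open>q\<close> kills the ideal.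
This is the reason why \<open>q\<close>-th powers produce canonical lifts, whatever the characteristic of \<open>E\<close> is.\<close>

lemma pow_eq_of_same_rho:
  assumes q: "frobenius_exponent F q"
    and A: "A \<in> carrier E" and B: "B \<in> carrier E" and AB: "A \<otimes> B = B \<otimes> A" "\<rho> A = \<rho> B"
  shows "A [^] q = B [^] q"
proof -
  obtain c where c: "c \<in> carrier F" "A = B \<oplus> \<iota> c" using same_rho_obtain A B AB(2) .
  have "\<iota> (c \<otimes>\<^bsub>F\<^esub> \<rho> B) = \<iota> (\<rho> B \<otimes>\<^bsub>F\<^esub> c)"
    using AB(1) c B by (simp add: R.l_distr R.r_distr l_iota r_iota)
  then have cY: "c \<otimes>\<^bsub>F\<^esub> \<rho> B = \<rho> B \<otimes>\<^bsub>F\<^esub> c" using c B by simp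
  have comm: "c \<otimes>\<^bsub>F\<^esub> \<rho> B [^]\<^bsub>F\<^esub> k = \<rho> B [^]\<^bsub>F\<^esub> k \<otimes>\<^bsub>F\<^esub> c" for k :: nat
    using S.group_commutes_pow[of "\<rho> B" c k] cY c B by simp
  obtain k where k: "q = Suc k" using q by (cases q) (auto simp: frobenius_exponent_def)
  have "defF (\<rho> A) (\<rho> B) c (Suc j) = [Suc j] \<cdot>\<^bsub>F\<^esub> (c \<otimes>\<^bsub>F\<^esub> \<rho> B [^]\<^bsub>F\<^esub> j)" for j
  proof (induction j)
    case (Suc j)
    have "\<rho> A \<otimes>\<^bsub>F\<^esub> ([Suc j] \<cdot>\<^bsub>F\<^esub> (c \<otimes>\<^bsub>F\<^esub> \<rho> B [^]\<^bsub>F\<^esub> j)) =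
        [Suc j] \<cdot>\<^bsub>F\<^esub> (c \<otimes>\<^bsub>F\<^esub> \<rho> B [^]\<^bsub>F\<^esub> Suc j)"
    proof -
      have "\<rho> B \<otimes>\<^bsub>F\<^esub> (c \<otimes>\<^bsub>F\<^esub> \<rho> B [^]\<^bsub>F\<^esub> j) = c \<otimes>\<^bsub>F\<^esub> \<rho> B [^]\<^bsub>F\<^esub> Suc j"
        unfolding S.nat_pow_Suc2[OF rho_closed[OF B]]
        by (rule S.mult_left_cong[OF cY[symmetric]]) (use c(1) B in auto)
      then show ?thesis
        unfolding AB(2) using S.add_pow_rdistr[of "\<rho> B" "c \<otimes>\<^bsub>F\<^esub> \<rho> B [^]\<^bsub>F\<^esub> j" "Suc j"] c(1) B
        by simp
    qed
    then show ?case unfolding intertwining_defect.simps(2)[of _ _ _ _ "Suc j"] Suc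
      using c B by simp
  qed (use c A B in simp)
  from this[of k] have "defF (\<rho> A) (\<rho> B) c q = \<zero>\<^bsub>F\<^esub>"
    using q c B unfolding frobenius_exponent_def k[symmetric] by (metis S.m_closed S.nat_pow_closed rho_closed)
  moreover have "A [^] q \<otimes> \<one> = \<one> \<otimes> B [^] q \<oplus> \<iota> (defF (\<rho> A) (\<rho> B) c q)"
    using A B c by (intro defect_iota) auto
  ultimately show ?thesis using A B by simp
qed

text \<open>Any lift of \<open>t\<close> intertwines \<open>N\<close> and \<open>M\<close> up to some \<open>\<iota> y\<close>, and changing the lift by \<open>\<iota> x\<close> changes
\<open>y\<close> by a Sylvester expression.  The solvability condition on the defects comes from the lifted
kernels: a vector \<open>w\<close> killed by \<open>n\<^sup>j\<close> has a lift \<open>W\<close> killed by \<open>N\<^sup>j\<close>, and \<open>t w\<close> has a lift killed by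
\<open>M\<^sup>j\<close>; comparing it with the lift of \<open>t w\<close> obtained from \<open>W\<close> shows that the defect of \<open>w\<close> is in the
image of \<open>m\<^sup>j\<close>.\<close>

lemma nilpotent_intertwiner_lifts:
  assumes reg: "von_neumann_regular F"
    and car: "M \<in> carrier E" "N \<in> carrier E" "t \<in> carrier F"
    and nil: "\<rho> N [^]\<^bsub>F\<^esub> l = \<zero>\<^bsub>F\<^esub>"
    and lift: "kernels_lift E F \<rho> l M" "kernels_lift E F \<rho> l N"
    and t: "\<rho> M \<otimes>\<^bsub>F\<^esub> t = t \<otimes>\<^bsub>F\<^esub> \<rho> N"
  shows "\<exists>T\<in>carrier E. \<rho> T = t \<and> M \<otimes> T = T \<otimes> N"
proof -
  note [simp] = car
  obtain T0 where T0 [simp]: "T0 \<in> carrier E" and rT0 [simp]: "\<rho> T0 = t" using lift_obtain car(3) .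
  obtain y where y [simp]: "y \<in> carrier F" and MT: "M \<otimes> T0 = T0 \<otimes> N \<oplus> \<iota> y"
    using same_rho_obtain[of "M \<otimes> T0" "T0 \<otimes> N"] t by auto
  have "\<exists>x\<in>carrier F. \<rho> M \<otimes>\<^bsub>F\<^esub> x = x \<otimes>\<^bsub>F\<^esub> \<rho> N \<oplus>\<^bsub>F\<^esub> y"
  proof (rule S.sylvester_nilpotent[OF reg _ _ y nil])
    fix j w assume j: "j \<le> l" and w [simp]: "w \<in> carrier F" and nw: "\<rho> N [^]\<^bsub>F\<^esub> j \<otimes>\<^bsub>F\<^esub> w = \<zero>\<^bsub>F\<^esub>"
    define d where "d = defF (\<rho> M) (\<rho> N) y j"
    have d [simp]: "d \<in> carrier F" by (simp add: d_def)
    have MTj: "M [^] j \<otimes> T0 = T0 \<otimes> N [^] j \<oplus> \<iota> d"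
      unfolding d_def by (rule defect_iota[OF _ _ _ _ MT]) auto
    have "\<rho> (M [^] j \<otimes> T0) = \<rho> (T0 \<otimes> N [^] j \<oplus> \<iota> d)" using MTj by simp
    then have mt: "\<rho> M [^]\<^bsub>F\<^esub> j \<otimes>\<^bsub>F\<^esub> t = t \<otimes>\<^bsub>F\<^esub> \<rho> N [^]\<^bsub>F\<^esub> j" by simp
    obtain W where W [simp]: "W \<in> carrier E" "\<rho> W = w" and NW: "N [^] j \<otimes> W = \<zero>"
      using lift(2) j nw w unfolding kernels_lift_def by blast
    have "\<rho> M [^]\<^bsub>F\<^esub> j \<otimes>\<^bsub>F\<^esub> (t \<otimes>\<^bsub>F\<^esub> w) = t \<otimes>\<^bsub>F\<^esub> (\<rho> N [^]\<^bsub>F\<^esub> j \<otimes>\<^bsub>F\<^esub> w)"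
      by (rule S.mult_left_cong[OF mt]) auto
    then have "\<rho> M [^]\<^bsub>F\<^esub> j \<otimes>\<^bsub>F\<^esub> (t \<otimes>\<^bsub>F\<^esub> w) = \<zero>\<^bsub>F\<^esub>" by (simp add: nw)
    then obtain V where V [simp]: "V \<in> carrier E" "\<rho> V = t \<otimes>\<^bsub>F\<^esub> w" and MV: "M [^] j \<otimes> V = \<zero>"
      using lift(1) j unfolding kernels_lift_def by (meson S.m_closed car(3) w)
    obtain c where c [simp]: "c \<in> carrier F" and TW: "T0 \<otimes> W = V \<oplus> \<iota> c"
      using same_rho_obtain[of "T0 \<otimes> W" V] by auto
    have "\<iota> (d \<otimes>\<^bsub>F\<^esub> w) = (T0 \<otimes> N [^] j \<oplus> \<iota> d) \<otimes> W"
      by (simp add: R.l_distr R.m_assoc NW r_iota)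
    also have "\<dots> = M [^] j \<otimes> (V \<oplus> \<iota> c)"
      unfolding MTj[symmetric] TW[symmetric] by (simp add: R.m_assoc)
    also have "\<dots> = \<iota> (\<rho> M [^]\<^bsub>F\<^esub> j \<otimes>\<^bsub>F\<^esub> c)"
      by (simp add: R.r_distr MV l_iota)
    finally have "d \<otimes>\<^bsub>F\<^esub> w = \<rho> M [^]\<^bsub>F\<^esub> j \<otimes>\<^bsub>F\<^esub> c" by simp
    then show "\<exists>u\<in>carrier F. d \<otimes>\<^bsub>F\<^esub> w = \<rho> M [^]\<^bsub>F\<^esub> j \<otimes>\<^bsub>F\<^esub> u" by (intro bexI[OF _ c])
  qed auto
  then obtain x where x [simp]: "x \<in> carrier F" and mx: "\<rho> M \<otimes>\<^bsub>F\<^esub> x = x \<otimes>\<^bsub>F\<^esub> \<rho> N \<oplus>\<^bsub>F\<^esub> y" by blast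
  have "M \<otimes> (T0 \<ominus> \<iota> x) = T0 \<otimes> N \<oplus> \<iota> y \<ominus> \<iota> (x \<otimes>\<^bsub>F\<^esub> \<rho> N \<oplus>\<^bsub>F\<^esub> y)"
    by (simp add: R.minus_eq R.r_distr R.r_minus l_iota MT mx)
  also have "\<dots> = T0 \<otimes> N \<ominus> \<iota> (x \<otimes>\<^bsub>F\<^esub> \<rho> N) \<oplus> (\<iota> y \<ominus> \<iota> y)"
    by (simp add: iota_add R.minus_eq R.minus_add R.a_ac)
  also have "\<dots> = (T0 \<ominus> \<iota> x) \<otimes> N"
    by (simp add: R.minus_eq R.r_neg R.l_distr R.l_minus r_iota)
  finally show ?thesis by (intro bexI[of _ "T0 \<ominus> \<iota> x"]) (auto simp: S.minus_eq)
qed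

end

section \<open>Good lifts\<close>

lemma (in ring) pow_intertwine:
  assumes "x \<in> carrier R" "y \<in> carrier R" "t \<in> carrier R" and xt: "x \<otimes> t = t \<otimes> y"
  shows "x [^] (k::nat) \<otimes> t = t \<otimes> y [^] k"
proof (induction k)
  case 0
  then show ?case using assms by simp
next
  case (Suc k)
  have "x [^] Suc k \<otimes> t = x [^] k \<otimes> (t \<otimes> y)"
    using assms(1-3) by (simp add: m_assoc xt)
  also have "\<dots> = t \<otimes> y [^] k \<otimes> y" unfolding Suc[symmetric] using assms(1-3) by (simp add: m_assoc)
  finally show ?case using assms(1-3) by (simp add: m_assoc)
qed

context ring
begin

lemma frobenius_pow_square:
  assumes "frobenius_exponent R q" "g \<in> carrier R"
  shows "g [^] (q * q) = g [^] q"
  using assms nat_pow_pow unfolding frobenius_exponent_def by auto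

lemma frobenius_torsion:
  assumes "frobenius_exponent R q" "g \<in> carrier R"
  shows "[q] \<cdot> g = \<zero>"
  using assms unfolding frobenius_exponent_def by auto

lemma frobenius_nilpotent:
  assumes q: "frobenius_exponent R q" and g: "g \<in> carrier R"
  shows "(g \<ominus> g [^] q) [^] q = \<zero>"
proof -
  have "g \<otimes> g [^] q = g [^] q \<otimes> g" using g by (simp flip: nat_pow_Suc2)
  then have "(g \<ominus> g [^] q) [^] q = g [^] q \<ominus> (g [^] q) [^] q"
    using q g unfolding frobenius_exponent_def by blast
  then show ?thesis using q g unfolding frobenius_exponent_def by (simp add: minus_eq r_neg)
qed

end

context square_zero_extension
begin

text \<open>Suppose that the kernels of the powers up to \<open>e\<close> already lift.  For \<open>w\<close> in the kernel of
\<open>n\<^sup>e\<^sup>+\<^sup>1\<close>, the vector \<open>n w\<close> has a lift killed by \<open>N\<^sup>e\<close>; hence \<open>N\<^sup>e\<^sup>+\<^sup>1\<close> sends a lift of \<open>w\<close> into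
\<open>\<iota>\<close> of the image of \<open>n\<^sup>e\<close>, say to \<open>\<iota> (n\<^sup>e b w)\<close>.  Subtracting \<open>\<iota> (n\<^sup>e b d)\<close> from \<open>N\<close>, with \<open>d\<close> an
inner inverse of \<open>n\<^sup>e\<close>, cancels this term.  All other effects of the change lie in the image of
\<open>n\<^sup>e\<^sup>+\<^sup>1\<close>, or of \<open>n\<^sup>j\<close> for the smaller powers, and can be absorbed into the lift of \<open>w\<close>.\<close>

lemma kernels_lift_Suc:
  assumes reg: "von_neumann_regular F" and N [simp]: "N \<in> carrier E" and lift: "kernels_lift E F \<rho> e N"
  shows "\<exists>N'\<in>carrier E. \<rho> N' = \<rho> N \<and> kernels_lift E F \<rho> (Suc e) N'"
proof -
  define n where "n = \<rho> N"
  have n [simp]: "n \<in> carrier F" by (simp add: n_def)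
  let ?p = "n [^]\<^bsub>F\<^esub> e" and ?p' = "n [^]\<^bsub>F\<^esub> Suc e"
  have p: "?p' = ?p \<otimes>\<^bsub>F\<^esub> n" "?p' = n \<otimes>\<^bsub>F\<^esub> ?p" by simp (rule S.nat_pow_Suc2, simp)
  have P: "N [^] Suc e = N [^] e \<otimes> N" "N [^] Suc e = N \<otimes> N [^] e" by simp (rule R.nat_pow_Suc2, simp)
  obtain c where c [simp]: "c \<in> carrier F" and c': "?p' \<otimes>\<^bsub>F\<^esub> c \<otimes>\<^bsub>F\<^esub> ?p' = ?p'"
    using reg unfolding von_neumann_regular_def by (meson S.nat_pow_closed n)
  obtain d where d [simp]: "d \<in> carrier F" and d': "?p \<otimes>\<^bsub>F\<^esub> d \<otimes>\<^bsub>F\<^esub> ?p = ?p"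
    using reg unfolding von_neumann_regular_def by (meson S.nat_pow_closed n)
  \<comment> \<open>The element \<open>u\<close> is a projection onto the kernel of \<open>n\<^sup>e\<^sup>+\<^sup>1\<close>; it represents all \<open>w\<close> at once.\<close>
  define u where "u = \<one>\<^bsub>F\<^esub> \<ominus>\<^bsub>F\<^esub> c \<otimes>\<^bsub>F\<^esub> ?p'"
  have u [simp]: "u \<in> carrier F" unfolding u_def by (intro S.minus_closed S.m_closed S.nat_pow_closed) simp_all
  have uw: "u \<otimes>\<^bsub>F\<^esub> w = w" if "w \<in> carrier F" "?p' \<otimes>\<^bsub>F\<^esub> w = \<zero>\<^bsub>F\<^esub>" for w
    using that unfolding u_def
    by (simp add: S.minus_eq S.l_distr S.l_minus S.m_assoc del: S.nat_pow_Suc)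
  have "?p' \<otimes>\<^bsub>F\<^esub> u = ?p' \<ominus>\<^bsub>F\<^esub> ?p' \<otimes>\<^bsub>F\<^esub> c \<otimes>\<^bsub>F\<^esub> ?p'"
    unfolding u_def by (simp add: S.minus_eq S.r_distr S.r_minus S.m_assoc del: S.nat_pow_Suc)
  then have "?p' \<otimes>\<^bsub>F\<^esub> u = \<zero>\<^bsub>F\<^esub>" unfolding c' by (simp add: S.minus_eq S.r_neg del: S.nat_pow_Suc)
  then have "\<rho> N [^]\<^bsub>F\<^esub> e \<otimes>\<^bsub>F\<^esub> (n \<otimes>\<^bsub>F\<^esub> u) = \<zero>\<^bsub>F\<^esub>"
    unfolding p(1) n_def[symmetric] by (simp add: S.m_assoc)
  then obtain Z where Z [simp]: "Z \<in> carrier E" "\<rho> Z = n \<otimes>\<^bsub>F\<^esub> u" and NZ: "N [^] e \<otimes> Z = \<zero>"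
    using lift unfolding kernels_lift_def by (meson S.m_closed n u order_refl)
  obtain U where U [simp]: "U \<in> carrier E" "\<rho> U = u" using lift_obtain u .
  obtain b where b [simp]: "b \<in> carrier F" and NU: "N \<otimes> U = Z \<oplus> \<iota> b"
    using same_rho_obtain[of "N \<otimes> U" Z] by (auto simp: n_def)
  have NUe: "N [^] Suc e \<otimes> U = \<iota> (?p \<otimes>\<^bsub>F\<^esub> b)"
  proof -
    have "N [^] Suc e \<otimes> U = N [^] e \<otimes> (Z \<oplus> \<iota> b)"
      unfolding P(1) NU[symmetric] by (simp add: R.m_assoc)
    then show ?thesis by (simp add: R.r_distr NZ l_iota n_def)
  qed
  define x where "x = \<ominus>\<^bsub>F\<^esub> (b \<otimes>\<^bsub>F\<^esub> d)"
  have x [simp]: "x \<in> carrier F" by (simp add: x_def)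
  define N' where "N' = N \<oplus> \<iota> (?p \<otimes>\<^bsub>F\<^esub> x)"
  have N' [simp]: "N' \<in> carrier E" "\<rho> N' = n" by (simp_all add: N'_def n_def)
  let ?D = "defF n n (?p \<otimes>\<^bsub>F\<^esub> x)"
  have N'pow: "N' [^] j = N [^] j \<oplus> \<iota> (?D j)" for j
    using defect_iota[of N' N \<one> "?p \<otimes>\<^bsub>F\<^esub> x" j] by (simp add: N'_def n_def)
  have D: "\<exists>v\<in>carrier F. ?D j = ?p \<otimes>\<^bsub>F\<^esub> v" for j
  proof (induction j)
    case 0
    then show ?case by (intro bexI[of _ "\<zero>\<^bsub>F\<^esub>"]) auto
  next
    case (Suc j)
    then obtain v where v [simp]: "v \<in> carrier F" and "?D j = ?p \<otimes>\<^bsub>F\<^esub> v" by blast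
    then have "?D (Suc j) = n \<otimes>\<^bsub>F\<^esub> ?p \<otimes>\<^bsub>F\<^esub> v \<oplus>\<^bsub>F\<^esub> ?p \<otimes>\<^bsub>F\<^esub> x \<otimes>\<^bsub>F\<^esub> n [^]\<^bsub>F\<^esub> j"
      by (simp add: S.m_assoc)
    also have "n \<otimes>\<^bsub>F\<^esub> ?p = ?p \<otimes>\<^bsub>F\<^esub> n" using p by simp
    finally show ?case
      by (intro bexI[of _ "n \<otimes>\<^bsub>F\<^esub> v \<oplus>\<^bsub>F\<^esub> x \<otimes>\<^bsub>F\<^esub> n [^]\<^bsub>F\<^esub> j"]) (simp_all add: S.r_distr S.m_assoc)
  qed
  have "kernels_lift E F \<rho> (Suc e) N'"
    unfolding kernels_lift_def
  proof (intro allI impI ballI)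
    fix j w assume j: "j \<le> Suc e" and w [simp]: "w \<in> carrier F"
      and "\<rho> N' [^]\<^bsub>F\<^esub> j \<otimes>\<^bsub>F\<^esub> w = \<zero>\<^bsub>F\<^esub>"
    then have nw: "n [^]\<^bsub>F\<^esub> j \<otimes>\<^bsub>F\<^esub> w = \<zero>\<^bsub>F\<^esub>" by simp
    have enough: "\<exists>W\<in>carrier E. \<rho> W = w \<and> N' [^] j \<otimes> W = \<zero>"
      if "W \<in> carrier E" "\<rho> W = w" "g \<in> carrier F" "N' [^] j \<otimes> W = \<iota> (n [^]\<^bsub>F\<^esub> j \<otimes>\<^bsub>F\<^esub> g)" for W g
      using that by (intro bexI[of _ "W \<ominus> \<iota> g"])
        (simp_all add: R.minus_eq S.minus_eq R.r_distr R.r_minus l_iota R.r_neg)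
    show "\<exists>W\<in>carrier E. \<rho> W = w \<and> N' [^] j \<otimes> W = \<zero>"
    proof (cases "j \<le> e")
      case True
      obtain W where W [simp]: "W \<in> carrier E" "\<rho> W = w" and NW: "N [^] j \<otimes> W = \<zero>"
        using lift True nw w unfolding kernels_lift_def n_def by blast
      obtain v where v [simp]: "v \<in> carrier F" and Dv: "?D j = ?p \<otimes>\<^bsub>F\<^esub> v" using D by blast
      have "?p = n [^]\<^bsub>F\<^esub> j \<otimes>\<^bsub>F\<^esub> n [^]\<^bsub>F\<^esub> (e - j)" using True by (simp add: S.nat_pow_mult)
      then have "N' [^] j \<otimes> W = \<iota> (n [^]\<^bsub>F\<^esub> j \<otimes>\<^bsub>F\<^esub> (n [^]\<^bsub>F\<^esub> (e - j) \<otimes>\<^bsub>F\<^esub> v \<otimes>\<^bsub>F\<^esub> w))"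
        unfolding N'pow Dv by (simp add: R.l_distr NW r_iota S.m_assoc)
      then show ?thesis by (intro enough[of W]) auto
    next
      case False
      then have je: "j = Suc e" using j by simp
      obtain v where v [simp]: "v \<in> carrier F" and Dv: "?D e = ?p \<otimes>\<^bsub>F\<^esub> v" using D by blast
      have Dj: "?D j = ?p' \<otimes>\<^bsub>F\<^esub> v \<ominus>\<^bsub>F\<^esub> ?p \<otimes>\<^bsub>F\<^esub> (b \<otimes>\<^bsub>F\<^esub> (d \<otimes>\<^bsub>F\<^esub> ?p))"
      proof -
        have "?D j = n \<otimes>\<^bsub>F\<^esub> (?p \<otimes>\<^bsub>F\<^esub> v) \<oplus>\<^bsub>F\<^esub> ?p \<otimes>\<^bsub>F\<^esub> x \<otimes>\<^bsub>F\<^esub> ?p"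
          unfolding je intertwining_defect.simps Dv ..
        then show ?thesis
          unfolding p(2) by (simp add: x_def S.minus_eq S.l_minus S.r_minus S.m_assoc)
      qed
      \<comment> \<open>Inner inverses invert \<open>n\<^sup>e\<close> only up to its kernel; \<open>w1\<close> is the resulting error.\<close>
      define w1 where "w1 = w \<ominus>\<^bsub>F\<^esub> d \<otimes>\<^bsub>F\<^esub> (?p \<otimes>\<^bsub>F\<^esub> w)"
      have w1 [simp]: "w1 \<in> carrier F" by (simp add: w1_def)
      have "?p \<otimes>\<^bsub>F\<^esub> w1 = ?p \<otimes>\<^bsub>F\<^esub> w \<ominus>\<^bsub>F\<^esub> ?p \<otimes>\<^bsub>F\<^esub> d \<otimes>\<^bsub>F\<^esub> ?p \<otimes>\<^bsub>F\<^esub> w"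
        by (simp add: w1_def S.minus_eq S.r_distr S.r_minus S.m_assoc)
      then have nw1: "?p \<otimes>\<^bsub>F\<^esub> w1 = \<zero>\<^bsub>F\<^esub>" unfolding d' by (simp add: S.minus_eq S.r_neg)
      then have uw1: "u \<otimes>\<^bsub>F\<^esub> w1 = w1"
        by (intro uw) (simp_all only: p(2), simp_all add: S.m_assoc)
      obtain W1 where W1 [simp]: "W1 \<in> carrier E" "\<rho> W1 = w1" and NW1: "N [^] e \<otimes> W1 = \<zero>"
        using lift nw1 w1 unfolding kernels_lift_def n_def by blast
      obtain g where g [simp]: "g \<in> carrier F" and UW1: "U \<otimes> W1 = W1 \<oplus> \<iota> g"
        using same_rho_obtain[of "U \<otimes> W1" W1] uw1 by auto
      have "\<iota> (?p \<otimes>\<^bsub>F\<^esub> b \<otimes>\<^bsub>F\<^esub> w1) = N [^] Suc e \<otimes> (U \<otimes> W1)"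
        using NUe by (simp add: r_iota R.m_assoc[symmetric] del: R.nat_pow_Suc)
      also have "\<dots> = N \<otimes> (N [^] e \<otimes> W1) \<oplus> \<iota> (?p' \<otimes>\<^bsub>F\<^esub> g)"
      proof -
        have "N [^] Suc e \<otimes> W1 = N \<otimes> (N [^] e \<otimes> W1)" unfolding P(2) by (simp add: R.m_assoc)
        then show ?thesis
          unfolding UW1 by (subst R.r_distr) (simp_all add: l_iota n_def del: R.nat_pow_Suc)
      qed
      also have "\<dots> = \<iota> (?p' \<otimes>\<^bsub>F\<^esub> g)" by (simp add: NW1)
      finally have pbw: "?p \<otimes>\<^bsub>F\<^esub> b \<otimes>\<^bsub>F\<^esub> w1 = ?p' \<otimes>\<^bsub>F\<^esub> g" by simp
      obtain W where W [simp]: "W \<in> carrier E" "\<rho> W = w" using lift_obtain w .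
      have uw0: "u \<otimes>\<^bsub>F\<^esub> w = w" using uw nw unfolding je by simp
      have "N' [^] j \<otimes> (U \<otimes> W) = \<iota> (?p \<otimes>\<^bsub>F\<^esub> b) \<otimes> W \<oplus> \<iota> (?D j \<otimes>\<^bsub>F\<^esub> (u \<otimes>\<^bsub>F\<^esub> w))"
        unfolding N'pow NUe[symmetric] je
        by (simp add: R.l_distr R.m_assoc r_iota del: R.nat_pow_Suc intertwining_defect.simps)
      also have "\<dots> = \<iota> (?p \<otimes>\<^bsub>F\<^esub> b \<otimes>\<^bsub>F\<^esub> w \<oplus>\<^bsub>F\<^esub> ?D j \<otimes>\<^bsub>F\<^esub> w)"
        unfolding uw0 by (simp add: r_iota iota_add)
      also have "?p \<otimes>\<^bsub>F\<^esub> b \<otimes>\<^bsub>F\<^esub> w \<oplus>\<^bsub>F\<^esub> ?D j \<otimes>\<^bsub>F\<^esub> w = ?p \<otimes>\<^bsub>F\<^esub> b \<otimes>\<^bsub>F\<^esub> w1 \<oplus>\<^bsub>F\<^esub> ?p' \<otimes>\<^bsub>F\<^esub> v \<otimes>\<^bsub>F\<^esub> w"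
        unfolding Dj w1_def
        by (simp add: S.minus_eq S.l_distr S.r_distr S.l_minus S.r_minus S.m_assoc S.a_ac del: S.nat_pow_Suc)
      also have "\<dots> = ?p' \<otimes>\<^bsub>F\<^esub> (g \<oplus>\<^bsub>F\<^esub> v \<otimes>\<^bsub>F\<^esub> w)"
        unfolding pbw by (simp add: S.r_distr S.m_assoc del: S.nat_pow_Suc)
      finally show ?thesis
        unfolding je[symmetric] by (intro enough[of "U \<otimes> W"]) (auto simp: uw0)
    qed
  qed
  then show ?thesis by (intro bexI[of _ N']) (auto simp: n_def)
qed

lemma nilpotent_good_lift:
  assumes "von_neumann_regular F" "n \<in> carrier F"
  shows "\<exists>N\<in>carrier E. \<rho> N = n \<and> kernels_lift E F \<rho> l N"
proof (induction l)
  case 0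
  obtain N where "N \<in> carrier E" "\<rho> N = n" using lift_obtain assms(2) .
  then show ?case by (intro bexI[of _ N]) (auto simp: kernels_lift_def)
next
  case (Suc l)
  then show ?case using kernels_lift_Suc[OF assms(1)] by metis
qed

text \<open>The elements \<open>G\<^sup>q\<close> and \<open>G\<^sup>q\<^sup>q\<close> commute and have the same reduction, so their \<open>q\<close>-th powers agree.\<close>

lemma semisimple_part_frobenius:
  assumes q: "frobenius_exponent F q" and G: "G \<in> carrier E"
  shows "(G [^] (q * q)) [^] q = G [^] (q * q)"
proof -
  have "(G [^] q) [^] q = (G [^] (q * q)) [^] q"
  proof (rule pow_eq_of_same_rho[OF q])
    show "G [^] q \<otimes> G [^] (q * q) = G [^] (q * q) \<otimes> G [^] q"
      using G by (simp add: R.nat_pow_mult add.commute)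
    show "\<rho> (G [^] q) = \<rho> (G [^] (q * q))"
      using G q by (simp add: S.frobenius_pow_square)
  qed (use G in auto)
  then show ?thesis using R.nat_pow_pow[OF G, of q q] by simp
qed

text \<open>An intertwiner of \<open>g\<close> and \<open>h\<close> intertwines their semisimple and nilpotent parts.  Lift it first
to an intertwiner \<open>T0\<close> of the nilpotent parts \<open>N\<close> and \<open>M\<close>.  It may fail to intertwine the semisimple
parts by some \<open>\<iota> y\<close>.  As \<open>S\<^sup>q = S\<close> and \<open>S'\<^sup>q = S'\<close>, the element \<open>y\<close> is its own \<open>q\<close>-th defect, so
averaging writes it as \<open>s' z - z s\<close>, where \<open>z\<close> still intertwines the nilpotent parts.  Then
\<open>T0 - \<iota> z\<close> intertwines both parts.\<close>

theorem good_intertwiner_lifts: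
  assumes reg: "von_neumann_regular F" and q: "frobenius_exponent F q"
    and G: "good_lift E F \<rho> q G" and H: "good_lift E F \<rho> q H"
    and t [simp]: "t \<in> carrier F" and ht: "\<rho> H \<otimes>\<^bsub>F\<^esub> t = t \<otimes>\<^bsub>F\<^esub> \<rho> G"
  shows "\<exists>T\<in>carrier E. \<rho> T = t \<and> H \<otimes> T = T \<otimes> G"
proof -
  have [simp]: "G \<in> carrier E" "H \<in> carrier E" using G H by (auto simp: good_lift_def)
  define S S' where "S = G [^] (q * q)" and "S' = H [^] (q * q)"
  have S [simp]: "S \<in> carrier E" "S' \<in> carrier E" by (simp_all add: S_def S'_def)
  have Sq: "S [^] q = S" "S' [^] q = S'"
    unfolding S_def S'_def by (rule semisimple_part_frobenius[OF q]; simp)+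
  define N M where "N = G \<ominus> S" and "M = H \<ominus> S'"
  have N [simp]: "N \<in> carrier E" "M \<in> carrier E" by (simp_all add: N_def M_def)
  have kl: "kernels_lift E F \<rho> q N" "kernels_lift E F \<rho> q M"
    using G H by (auto simp: good_lift_def N_def M_def S_def S'_def)
  have GSN: "G = S \<oplus> N" "H = S' \<oplus> M"
    by (simp_all add: N_def M_def R.minus_eq R.a_lcomm R.r_neg)
  have SN: "S \<otimes> N = N \<otimes> S" "S' \<otimes> M = M \<otimes> S'"
    using R.pow_intertwine[of G G G "q * q"] R.pow_intertwine[of H H H "q * q"]
    by (simp_all add: N_def M_def S_def S'_def R.minus_eq R.r_distr R.l_distr R.r_minus R.l_minus)
  have st: "\<rho> S' \<otimes>\<^bsub>F\<^esub> t = t \<otimes>\<^bsub>F\<^esub> \<rho> S"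
    using S.pow_intertwine[OF _ _ t ht] by (simp add: S_def S'_def)
  have mt: "\<rho> M \<otimes>\<^bsub>F\<^esub> t = t \<otimes>\<^bsub>F\<^esub> \<rho> N"
    using st ht by (simp add: M_def N_def S.minus_eq S.l_distr S.r_distr S.l_minus S.r_minus)
  have nil: "\<rho> N [^]\<^bsub>F\<^esub> q = \<zero>\<^bsub>F\<^esub>"
    using S.frobenius_nilpotent[OF q, of "\<rho> G"] S.frobenius_pow_square[OF q, of "\<rho> G"]
    by (simp add: N_def S_def)
  obtain T0 where T0 [simp]: "T0 \<in> carrier E" "\<rho> T0 = t" and MT: "M \<otimes> T0 = T0 \<otimes> N"
    using nilpotent_intertwiner_lifts[OF reg N(2,1) t nil kl(2,1) mt] by blast
  obtain y where y [simp]: "y \<in> carrier F" and ST: "S' \<otimes> T0 = T0 \<otimes> S \<oplus> \<iota> y"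
    using same_rho_obtain[of "S' \<otimes> T0" "T0 \<otimes> S"] st by auto
  have my: "\<rho> M \<otimes>\<^bsub>F\<^esub> y = y \<otimes>\<^bsub>F\<^esub> \<rho> N"
  proof -
    have "T0 \<otimes> S \<otimes> N \<oplus> \<iota> (y \<otimes>\<^bsub>F\<^esub> \<rho> N) = S' \<otimes> T0 \<otimes> N"
      unfolding ST by (simp add: R.l_distr r_iota)
    also have "\<dots> = S' \<otimes> (M \<otimes> T0)" unfolding MT by (simp add: R.m_assoc)
    also have "\<dots> = M \<otimes> (S' \<otimes> T0)" by (rule R.mult_left_cong[OF SN(2)]) auto
    also have "\<dots> = M \<otimes> T0 \<otimes> S \<oplus> \<iota> (\<rho> M \<otimes>\<^bsub>F\<^esub> y)"
      unfolding ST by (simp add: R.r_distr R.m_assoc l_iota)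
    also have "M \<otimes> T0 \<otimes> S = T0 \<otimes> S \<otimes> N"
      unfolding MT using SN(1) by (simp add: R.m_assoc)
    finally show ?thesis by simp
  qed
  have "S' [^] q \<otimes> T0 = T0 \<otimes> S [^] q \<oplus> \<iota> (defF (\<rho> S') (\<rho> S) y q)"
    by (rule defect_iota[OF _ _ _ _ ST]) auto
  then have yq: "y = defF (\<rho> S') (\<rho> S) y q" unfolding Sq ST by simp
  obtain k where k: "q = Suc k" using q by (cases q) (auto simp: frobenius_exponent_def)
  have comm: "\<rho> M \<otimes>\<^bsub>F\<^esub> \<rho> S' = \<rho> S' \<otimes>\<^bsub>F\<^esub> \<rho> M" "\<rho> N \<otimes>\<^bsub>F\<^esub> \<rho> S = \<rho> S \<otimes>\<^bsub>F\<^esub> \<rho> N"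
    using SN by (simp_all flip: hom_mult)
  obtain z where z [simp]: "z \<in> carrier F" and mz: "\<rho> M \<otimes>\<^bsub>F\<^esub> z = z \<otimes>\<^bsub>F\<^esub> \<rho> N"
    and yz: "y = [q] \<cdot>\<^bsub>F\<^esub> (y \<otimes>\<^bsub>F\<^esub> \<rho> S [^]\<^bsub>F\<^esub> k) \<oplus>\<^bsub>F\<^esub> (\<rho> S' \<otimes>\<^bsub>F\<^esub> z \<ominus>\<^bsub>F\<^esub> z \<otimes>\<^bsub>F\<^esub> \<rho> S)"
    using S.defect_averaging[OF _ _ y _ _ comm my, of k] unfolding k[symmetric] yq[symmetric] by auto
  have y': "y = \<rho> S' \<otimes>\<^bsub>F\<^esub> z \<ominus>\<^bsub>F\<^esub> z \<otimes>\<^bsub>F\<^esub> \<rho> S"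
    using yz S.frobenius_torsion[OF q, of "y \<otimes>\<^bsub>F\<^esub> \<rho> S [^]\<^bsub>F\<^esub> k"] by simp
  define T where "T = T0 \<ominus> \<iota> z"
  have T [simp]: "T \<in> carrier E" "\<rho> T = t" by (simp_all add: T_def S.minus_eq)
  have "S' \<otimes> T = T0 \<otimes> S \<oplus> (\<iota> (\<rho> S' \<otimes>\<^bsub>F\<^esub> z) \<ominus> \<iota> (z \<otimes>\<^bsub>F\<^esub> \<rho> S)) \<ominus> \<iota> (\<rho> S' \<otimes>\<^bsub>F\<^esub> z)"
    using ST y' by (simp add: T_def R.minus_eq R.r_distr R.r_minus l_iota iota_minus)
  also have "\<dots> = T0 \<otimes> S \<ominus> \<iota> (z \<otimes>\<^bsub>F\<^esub> \<rho> S) \<oplus> (\<iota> (\<rho> S' \<otimes>\<^bsub>F\<^esub> z) \<ominus> \<iota> (\<rho> S' \<otimes>\<^bsub>F\<^esub> z))"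
    by (simp add: R.minus_eq R.a_ac)
  also have "\<dots> = T \<otimes> S"
    by (simp add: T_def R.minus_eq R.l_distr R.l_minus r_iota R.r_neg)
  finally have ST': "S' \<otimes> T = T \<otimes> S" .
  have MT': "M \<otimes> T = T \<otimes> N"
    by (simp add: T_def R.minus_eq R.l_distr R.l_minus R.r_distr R.r_minus l_iota r_iota MT mz)
  have "H \<otimes> T = T \<otimes> G"
    unfolding GSN by (simp add: R.l_distr R.r_distr ST' MT')
  then show ?thesis by (intro bexI[of _ T]) auto
qed

text \<open>Choose a lift \<open>N\<close> of the nilpotent part \<open>n\<close> whose kernels lift.  The semisimple part \<open>s\<close> intertwines
\<open>n\<close> with itself, so it has a lift \<open>S0\<close> commuting with \<open>N\<close>, and \<open>S = S0\<^sup>q\<close> is equal to its own \<open>q\<close>-th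
power.  The sum \<open>G = S + N\<close> is good, because \<open>G\<^sup>q\<close> and \<open>S\<close> commute and have the same reduction, which
gives \<open>G\<^sup>q\<^sup>q = S\<^sup>q = S\<close>.\<close>

theorem good_lift_exists:
  assumes reg: "von_neumann_regular F" and q: "frobenius_exponent F q" and g [simp]: "g \<in> carrier F"
  shows "\<exists>G. good_lift E F \<rho> q G \<and> \<rho> G = g"
proof -
  define s n where "s = g [^]\<^bsub>F\<^esub> q" and "n = g \<ominus>\<^bsub>F\<^esub> s"
  have sn [simp]: "s \<in> carrier F" "n \<in> carrier F" by (simp_all add: s_def n_def)
  have sq: "s [^]\<^bsub>F\<^esub> q = s" using q by (simp add: s_def frobenius_exponent_def)
  have "g \<otimes>\<^bsub>F\<^esub> s = s \<otimes>\<^bsub>F\<^esub> g" by (simp add: s_def flip: S.nat_pow_Suc2)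
  then have ns: "n \<otimes>\<^bsub>F\<^esub> s = s \<otimes>\<^bsub>F\<^esub> n"
    by (simp add: n_def S.minus_eq S.l_distr S.r_distr S.l_minus S.r_minus)
  obtain N where N [simp]: "N \<in> carrier E" "\<rho> N = n" and kl: "kernels_lift E F \<rho> q N"
    using nilpotent_good_lift[OF reg sn(2)] by blast
  have nil: "\<rho> N [^]\<^bsub>F\<^esub> q = \<zero>\<^bsub>F\<^esub>"
    using S.frobenius_nilpotent[OF q g] by (simp add: n_def s_def)
  obtain S0 where S0 [simp]: "S0 \<in> carrier E" "\<rho> S0 = s" and NS0: "N \<otimes> S0 = S0 \<otimes> N"
    using nilpotent_intertwiner_lifts[OF reg N(1,1) sn(1) nil kl kl] ns by auto
  define S where "S = S0 [^] q"
  have S [simp]: "S \<in> carrier E" "\<rho> S = s" by (simp_all add: S_def sq)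
  have Sq: "S0 [^] q = S [^] q"
    by (rule pow_eq_of_same_rho[OF q]) (simp_all add: S_def sq flip: R.nat_pow_Suc2)
  have NS: "S \<otimes> N = N \<otimes> S" unfolding S_def by (rule R.pow_intertwine) (simp_all add: NS0)
  define G where "G = S \<oplus> N"
  have G [simp]: "G \<in> carrier E" by (simp add: G_def)
  have rG: "\<rho> G = g" by (simp add: G_def n_def S.minus_eq S.a_lcomm S.r_neg)
  have GS: "G \<otimes> S = S \<otimes> G" using NS by (simp add: G_def R.l_distr R.r_distr)
  have "(G [^] q) [^] q = S [^] q"
    by (rule pow_eq_of_same_rho[OF q]) (use R.pow_intertwine[of G G S q] GS rG in \<open>simp_all add: s_def\<close>)
  then have "G [^] (q * q) = S" using Sq by (simp add: R.nat_pow_pow flip: S_def)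
  then have "G \<ominus> G [^] (q * q) = N" by (simp add: G_def R.minus_eq R.a_ac R.r_neg)
  then have "good_lift E F \<rho> q G" using kl by (simp add: good_lift_def)
  then show ?thesis using rG by blast
qed

lemma Units_lift:
  assumes T: "T \<in> carrier E" and u: "\<rho> T \<in> Units F"
  shows "T \<in> Units E"
proof -
  have inv: "\<one> \<oplus> \<iota> c \<in> Units E" if c: "c \<in> carrier F" for c
  proof -
    have "(\<one> \<oplus> \<iota> c) \<otimes> (\<one> \<ominus> \<iota> c) = \<one>" "(\<one> \<ominus> \<iota> c) \<otimes> (\<one> \<oplus> \<iota> c) = \<one>"
      using c by (simp_all add: R.minus_eq R.l_distr R.r_distr R.l_minus R.r_minus R.a_assoc R.l_neg R.r_neg)
    then show ?thesis using c unfolding Units_def by force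
  qed
  have "inv\<^bsub>F\<^esub> \<rho> T \<in> carrier F" using u by simp
  then obtain V where V: "V \<in> carrier E" "\<rho> V = inv\<^bsub>F\<^esub> \<rho> T" by (rule lift_obtain)
  obtain c where c: "c \<in> carrier F" "T \<otimes> V = \<one> \<oplus> \<iota> c"
    using same_rho_obtain[of "T \<otimes> V" \<one>] T V u by auto
  obtain d where d: "d \<in> carrier F" "V \<otimes> T = \<one> \<oplus> \<iota> d"
    using same_rho_obtain[of "V \<otimes> T" \<one>] T V u by auto
  let ?a = "inv (T \<otimes> V)" and ?b = "inv (V \<otimes> T)"
  have "T \<otimes> V \<in> Units E" "V \<otimes> T \<in> Units E" using inv c d by simp_all
  then have *: "?a \<in> carrier E" "?b \<in> carrier E" "T \<otimes> V \<otimes> ?a = \<one>" "?b \<otimes> (V \<otimes> T) = \<one>" by simp_all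
  then have r: "T \<otimes> (V \<otimes> ?a) = \<one>" and l: "(?b \<otimes> V) \<otimes> T = \<one>" using T V by (simp_all add: R.m_assoc)
  have "?b \<otimes> V = V \<otimes> ?a" using R.inv_unique[OF l r] T V * by simp
  then show ?thesis unfolding Units_def using r l T V * by auto
qed

lemma rho_Units: "v \<in> Units E \<Longrightarrow> \<rho> v \<in> Units F"
  unfolding Units_def by (auto simp flip: hom_mult) (metis hom_closed hom_mult hom_one)

text \<open>A conjugating unit reduces to an intertwiner \<open>u\<close> of \<open>g\<close> and \<open>h\<close>, and \<open>u\<close> lifts to an intertwiner
\<open>T\<close> of the good lifts.  The conjugating unit is then \<open>T + \<iota> z\<close>, and the terms of its defining equation
outside the ideal cancel.  What is left is an equation in \<open>F\<close>, in which the extension \<open>E\<close> no longer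
appears.\<close>

lemma conjugate_iff:
  assumes reg: "von_neumann_regular F" and q: "frobenius_exponent F q"
    and G: "good_lift E F \<rho> q G" and H: "good_lift E F \<rho> q H"
    and x [simp]: "x \<in> carrier F" and y [simp]: "y \<in> carrier F"
  shows "(\<exists>v\<in>Units E. v \<otimes> (G \<oplus> \<iota> x) = (H \<oplus> \<iota> y) \<otimes> v) \<longleftrightarrow>
    (\<exists>u\<in>Units F. \<exists>z\<in>carrier F. u \<otimes>\<^bsub>F\<^esub> \<rho> G = \<rho> H \<otimes>\<^bsub>F\<^esub> u \<and>
       u \<otimes>\<^bsub>F\<^esub> x \<oplus>\<^bsub>F\<^esub> z \<otimes>\<^bsub>F\<^esub> \<rho> G = y \<otimes>\<^bsub>F\<^esub> u \<oplus>\<^bsub>F\<^esub> \<rho> H \<otimes>\<^bsub>F\<^esub> z)" (is "?L \<longleftrightarrow> ?R")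
proof -
  have [simp]: "G \<in> carrier E" "H \<in> carrier E" using G H by (auto simp: good_lift_def)
  have expand: "(T \<oplus> \<iota> z) \<otimes> (G \<oplus> \<iota> x) = (H \<oplus> \<iota> y) \<otimes> (T \<oplus> \<iota> z) \<longleftrightarrow>
       \<rho> T \<otimes>\<^bsub>F\<^esub> x \<oplus>\<^bsub>F\<^esub> z \<otimes>\<^bsub>F\<^esub> \<rho> G = y \<otimes>\<^bsub>F\<^esub> \<rho> T \<oplus>\<^bsub>F\<^esub> \<rho> H \<otimes>\<^bsub>F\<^esub> z"
    if [simp]: "T \<in> carrier E" "z \<in> carrier F" and HT: "H \<otimes> T = T \<otimes> G" for T z
  proof -
    have "(T \<oplus> \<iota> z) \<otimes> (G \<oplus> \<iota> x) = T \<otimes> G \<oplus> \<iota> (\<rho> T \<otimes>\<^bsub>F\<^esub> x \<oplus>\<^bsub>F\<^esub> z \<otimes>\<^bsub>F\<^esub> \<rho> G)"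
      by (simp add: R.l_distr R.r_distr l_iota r_iota iota_add R.a_ac)
    moreover have "(H \<oplus> \<iota> y) \<otimes> (T \<oplus> \<iota> z) = T \<otimes> G \<oplus> \<iota> (y \<otimes>\<^bsub>F\<^esub> \<rho> T \<oplus>\<^bsub>F\<^esub> \<rho> H \<otimes>\<^bsub>F\<^esub> z)"
      by (simp add: R.l_distr R.r_distr l_iota r_iota iota_add R.a_ac HT)
    ultimately show ?thesis by simp
  qed
  have T: "\<exists>T\<in>carrier E. \<rho> T = u \<and> H \<otimes> T = T \<otimes> G"
    if "u \<in> carrier F" "u \<otimes>\<^bsub>F\<^esub> \<rho> G = \<rho> H \<otimes>\<^bsub>F\<^esub> u" for u
    using good_intertwiner_lifts[OF reg q G H that(1)] that(2) by simp
  show ?thesis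
  proof
    assume ?L
    then obtain v where v: "v \<in> Units E" "v \<otimes> (G \<oplus> \<iota> x) = (H \<oplus> \<iota> y) \<otimes> v" by blast
    then have [simp]: "v \<in> carrier E" by (simp only: R.Units_closed)
    have "\<rho> (v \<otimes> (G \<oplus> \<iota> x)) = \<rho> ((H \<oplus> \<iota> y) \<otimes> v)" using v(2) by simp
    then have ug: "\<rho> v \<otimes>\<^bsub>F\<^esub> \<rho> G = \<rho> H \<otimes>\<^bsub>F\<^esub> \<rho> v" by simp
    then obtain T where T': "T \<in> carrier E" "\<rho> T = \<rho> v" "H \<otimes> T = T \<otimes> G" using T[of "\<rho> v"] by auto
    obtain z where z: "z \<in> carrier F" "v = T \<oplus> \<iota> z"
      using same_rho_obtain[of v T] T' by auto
    show ?R using expand[OF T'(1) z(1) T'(3)] v(2) z T'(2) rho_Units[OF v(1)] ug by metis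
  next
    assume ?R
    then obtain u z where u: "u \<in> Units F" "u \<otimes>\<^bsub>F\<^esub> \<rho> G = \<rho> H \<otimes>\<^bsub>F\<^esub> u" and z: "z \<in> carrier F"
       "u \<otimes>\<^bsub>F\<^esub> x \<oplus>\<^bsub>F\<^esub> z \<otimes>\<^bsub>F\<^esub> \<rho> G = y \<otimes>\<^bsub>F\<^esub> u \<oplus>\<^bsub>F\<^esub> \<rho> H \<otimes>\<^bsub>F\<^esub> z" by blast
    obtain T where T': "T \<in> carrier E" "\<rho> T = u" "H \<otimes> T = T \<otimes> G" using T[of u] u by auto
    have "T \<oplus> \<iota> z \<in> Units E" using T' z u by (intro Units_lift) auto
    then show ?L using expand[OF T'(1) z(1) T'(3)] T'(2) z(2) by blast
  qed
qed

end

section \<open>Ring isomorphisms\<close>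

lemma ring_iso_hom:
  assumes "ring R" "ring S" "h \<in> ring_iso R S"
  shows "ring_hom_ring R S h"
  using assms by (auto simp: ring_iso_def intro: ring_hom_ringI2)

lemma ring_iso_bij: "h \<in> ring_iso R S \<Longrightarrow> bij_betw h (carrier R) (carrier S)"
  by (simp add: ring_iso_def)

lemma (in ring_hom_ring) hom_a_minus:
  "x \<in> carrier R \<Longrightarrow> y \<in> carrier R \<Longrightarrow> h (x \<ominus> y) = h x \<ominus>\<^bsub>S\<^esub> h y"
  by (simp add: R.minus_eq S.minus_eq)

lemma (in ring_hom_ring) hom_add_pow:
  "x \<in> carrier R \<Longrightarrow> h ([(k::nat)] \<cdot> x) = [k] \<cdot>\<^bsub>S\<^esub> h x"
  by (induction k) simp_all

lemma (in ring_hom_ring) hom_Units: "v \<in> Units R \<Longrightarrow> h v \<in> Units S"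
  unfolding Units_def by (auto simp flip: hom_mult) (metis hom_closed hom_mult hom_one)

lemma ring_iso_Units_iff:
  assumes R: "ring R" "ring S" and h: "h \<in> ring_iso R S" and u: "u \<in> carrier R"
  shows "h u \<in> Units S \<longleftrightarrow> u \<in> Units R"
proof
  interpret ring_hom_ring R S h using R h by (rule ring_iso_hom)
  have S: "carrier S = h ` carrier R" and inj: "inj_on h (carrier R)"
    using ring_iso_bij[OF h] by (simp_all add: bij_betw_def)
  assume "h u \<in> Units S"
  then obtain v where v: "v \<in> carrier R" "h v \<otimes>\<^bsub>S\<^esub> h u = \<one>\<^bsub>S\<^esub>" "h u \<otimes>\<^bsub>S\<^esub> h v = \<one>\<^bsub>S\<^esub>"
    unfolding Units_def S by blast
  then have "h (v \<otimes>\<^bsub>R\<^esub> u) = h \<one>\<^bsub>R\<^esub>" "h (u \<otimes>\<^bsub>R\<^esub> v) = h \<one>\<^bsub>R\<^esub>" using u by simp_all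
  then have "v \<otimes>\<^bsub>R\<^esub> u = \<one>\<^bsub>R\<^esub>" "u \<otimes>\<^bsub>R\<^esub> v = \<one>\<^bsub>R\<^esub>" 
    using u v(1) inj_on_eq_iff[OF inj, of "v \<otimes>\<^bsub>R\<^esub> u" "\<one>\<^bsub>R\<^esub>"]
      inj_on_eq_iff[OF inj, of "u \<otimes>\<^bsub>R\<^esub> v" "\<one>\<^bsub>R\<^esub>"] by auto
  then show "u \<in> Units R" using u v(1) unfolding Units_def by blast
next
  interpret ring_hom_ring R S h using R h by (rule ring_iso_hom)
  assume "u \<in> Units R" then show "h u \<in> Units S" by (rule hom_Units)
qed

lemma von_neumann_regular_iso:
  assumes "ring R" "ring S" "h \<in> ring_iso R S" "von_neumann_regular R"
  shows "von_neumann_regular S"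
proof -
  interpret ring_hom_ring R S h using assms(1-3) by (rule ring_iso_hom)
  have S: "carrier S = h ` carrier R" using ring_iso_bij[OF assms(3)] by (simp add: bij_betw_def)
  show ?thesis unfolding von_neumann_regular_def S
    using assms(4) unfolding von_neumann_regular_def by (simp flip: hom_mult) metis
qed

lemma frobenius_exponent_iso:
  fixes R (structure)
  assumes "ring R" "ring S" "h \<in> ring_iso R S" "frobenius_exponent R q"
  shows "frobenius_exponent S q"
proof -
  interpret ring_hom_ring R S h using assms(1-3) by (rule ring_iso_hom)
  have S: "carrier S = h ` carrier R" and inj: "inj_on h (carrier R)"
    using ring_iso_bij[OF assms(3)] by (simp_all add: bij_betw_def)
  have "h x \<otimes>\<^bsub>S\<^esub> h y = h y \<otimes>\<^bsub>S\<^esub> h x \<longleftrightarrow> x \<otimes> y = y \<otimes> x" if "x \<in> carrier R" "y \<in> carrier R" for x y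
    using that inj_on_eq_iff[OF inj, of "x \<otimes> y" "y \<otimes> x"] by simp
  moreover have "[q] \<cdot>\<^bsub>S\<^esub> h x = \<zero>\<^bsub>S\<^esub>" "(h x [^]\<^bsub>S\<^esub> q) [^]\<^bsub>S\<^esub> q = h x [^]\<^bsub>S\<^esub> q" if "x \<in> carrier R" for x
    using that assms(4) hom_zero unfolding frobenius_exponent_def
    by (metis hom_add_pow, metis hom_nat_pow R.nat_pow_closed)
  moreover have "(h x \<ominus>\<^bsub>S\<^esub> h y) [^]\<^bsub>S\<^esub> q = h x [^]\<^bsub>S\<^esub> q \<ominus>\<^bsub>S\<^esub> h y [^]\<^bsub>S\<^esub> q"
    if "x \<in> carrier R" "y \<in> carrier R" "x \<otimes> y = y \<otimes> x" for x y
  proof -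
    have "(x \<ominus> y) [^] q = x [^] q \<ominus> y [^] q"
      using that assms(4) unfolding frobenius_exponent_def by blast
    then have "h ((x \<ominus> y) [^] q) = h (x [^] q \<ominus> y [^] q)" by simp
    then show ?thesis using that by (simp add: hom_nat_pow hom_a_minus)
  qed
  moreover have "0 < q" using assms(4) by (simp add: frobenius_exponent_def)
  ultimately show ?thesis unfolding frobenius_exponent_def S by blast
qed

section \<open>Transfer of conjugacy classes\<close>

definition unit_class :: "('a, 'm) monoid_scheme \<Rightarrow> 'a \<Rightarrow> 'a set" where
  "unit_class R x = {y \<in> Units R. \<exists>v\<in>Units R. v \<otimes>\<^bsub>R\<^esub> x = y \<otimes>\<^bsub>R\<^esub> v}"

context monoid
begin

lemma unit_class_refl: "x \<in> Units G \<Longrightarrow> x \<in> unit_class G x"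
  unfolding unit_class_def by (auto intro: bexI[of _ \<one>])

lemma unit_class_sym:
  assumes "x \<in> Units G" "y \<in> unit_class G x" shows "x \<in> unit_class G y"
proof -
  obtain v where v: "v \<in> Units G" "v \<otimes> x = y \<otimes> v" and y: "y \<in> Units G"
    using assms(2) by (auto simp: unit_class_def)
  note [simp] = Units_closed[OF v(1)] Units_closed[OF y] Units_closed[OF assms(1)]
  have "inv v \<otimes> y = inv v \<otimes> (y \<otimes> v) \<otimes> inv v" using v(1) y by (simp add: m_assoc)
  also have "\<dots> = x \<otimes> inv v" unfolding v(2)[symmetric] using v(1) assms(1) by (simp flip: m_assoc)
  finally show ?thesis using v(1) assms(1) unfolding unit_class_def by blast
qed

lemma unit_class_trans:
  assumes "x \<in> Units G" "y \<in> unit_class G x" "z \<in> unit_class G y" shows "z \<in> unit_class G x"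
proof -
  obtain v where v: "v \<in> Units G" "v \<otimes> x = y \<otimes> v" and y: "y \<in> Units G"
    using assms(2) by (auto simp: unit_class_def)
  obtain u where u: "u \<in> Units G" "u \<otimes> y = z \<otimes> u" and z: "z \<in> Units G"
    using assms(3) by (auto simp: unit_class_def)
  note [simp] = Units_closed[OF v(1)] Units_closed[OF y] Units_closed[OF assms(1)]
    Units_closed[OF u(1)] Units_closed[OF z]
  have "u \<otimes> v \<otimes> x = u \<otimes> y \<otimes> v" by (simp add: m_assoc v(2))
  also have "\<dots> = z \<otimes> (u \<otimes> v)" by (simp add: m_assoc u(2))
  finally show ?thesis using u v z unfolding unit_class_def by auto
qed

lemma unit_class_eq_iff:
  assumes "x \<in> Units G" "y \<in> Units G"
  shows "unit_class G x = unit_class G y \<longleftrightarrow> y \<in> unit_class G x"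
proof
  assume "unit_class G x = unit_class G y"
  then show "y \<in> unit_class G x" using unit_class_refl assms by simp
next
  assume y: "y \<in> unit_class G x"
  then have "x \<in> unit_class G y" using unit_class_sym assms by blast
  then show "unit_class G x = unit_class G y" using unit_class_trans assms y by blast
qed

text \<open>Multiplying the conjugation equation \<open>v x v\<^sup>-\<^sup>1 = y\<close> by \<open>v\<close> avoids inverses in all later arguments.\<close>

lemma conj_classes_units: "conj_classes (units_of G) = unit_class G ` Units G"
proof -
  have "orbit (units_of G) (\<lambda>g. \<lambda>h\<in>carrier (units_of G). g \<otimes>\<^bsub>units_of G\<^esub> h \<otimes>\<^bsub>units_of G\<^esub> inv\<^bsub>units_of G\<^esub> g) x
    = unit_class G x" if x: "x \<in> Units G" for x
  proof -
    have conj: "v \<otimes> x \<otimes> inv v = y \<longleftrightarrow> v \<otimes> x = y \<otimes> v" if "v \<in> Units G" "y \<in> Units G" for v y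
    proof -
      note [simp] = Units_closed[OF that(1)] Units_closed[OF that(2)] Units_closed[OF x]
      show ?thesis
      proof
        assume "v \<otimes> x \<otimes> inv v = y"
        then have "y \<otimes> v = v \<otimes> x \<otimes> inv v \<otimes> v" by simp
        then show "v \<otimes> x = y \<otimes> v" using that x by (simp add: m_assoc)
      next
        assume "v \<otimes> x = y \<otimes> v"
        then show "v \<otimes> x \<otimes> inv v = y" using that x by (simp add: m_assoc)
      qed
    qed
    have "orbit (units_of G) (\<lambda>g. \<lambda>h\<in>carrier (units_of G). g \<otimes>\<^bsub>units_of G\<^esub> h \<otimes>\<^bsub>units_of G\<^esub> inv\<^bsub>units_of G\<^esub> g) x
      = (\<lambda>v. v \<otimes> x \<otimes> inv\<^bsub>units_of G\<^esub> v) ` Units G"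
      using x unfolding orbit_def by (auto simp: units_of_carrier units_of_mult)
    also have "\<dots> = (\<lambda>v. v \<otimes> x \<otimes> inv v) ` Units G"
      by (rule image_cong) (simp_all add: units_of_inv)
    also have "\<dots> = unit_class G x"
    proof
      show "(\<lambda>v. v \<otimes> x \<otimes> inv v) ` Units G \<subseteq> unit_class G x"
      proof
        fix y assume "y \<in> (\<lambda>v. v \<otimes> x \<otimes> inv v) ` Units G"
        then obtain v where v: "v \<in> Units G" "v \<otimes> x \<otimes> inv v = y" by blast
        moreover have "y \<in> Units G" using v x by auto
        ultimately show "y \<in> unit_class G x" using conj unfolding unit_class_def by blast
      qed
      show "unit_class G x \<subseteq> (\<lambda>v. v \<otimes> x \<otimes> inv v) ` Units G"
        unfolding unit_class_def using conj by blast
    qed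
    finally show ?thesis .
  qed
  then show ?thesis unfolding conj_classes_def orbits_def by (auto simp: units_of_carrier)
qed

end

text \<open>All decompositions of elements of \<open>C\<close> and all good lifts on the other side are allowed.  Thus the
definition makes no choice, which is what makes the result compatible with isomorphisms.\<close>

definition transfer_set ::
  "('a, 'm) ring_scheme \<Rightarrow> ('b, 'k) ring_scheme \<Rightarrow> ('a \<Rightarrow> 'b) \<Rightarrow> ('b \<Rightarrow> 'a) \<Rightarrow>
   ('c, 'n) ring_scheme \<Rightarrow> ('d, 'l) ring_scheme \<Rightarrow> ('c \<Rightarrow> 'd) \<Rightarrow> ('d \<Rightarrow> 'c) \<Rightarrow>
   nat \<Rightarrow> ('b \<Rightarrow> 'd) \<Rightarrow> 'a set \<Rightarrow> 'c set" where
  "transfer_set E F \<rho> \<iota> E' F' \<rho>' \<iota>' q \<theta> C =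
    {H \<oplus>\<^bsub>E'\<^esub> \<iota>' (\<theta> x) | G H x. good_lift E F \<rho> q G \<and> good_lift E' F' \<rho>' q H \<and>
       \<theta> (\<rho> G) = \<rho>' H \<and> x \<in> carrier F \<and> G \<oplus>\<^bsub>E\<^esub> \<iota> x \<in> C}"

locale matched_extensions =
  L: square_zero_extension E F \<rho> \<iota> + M: square_zero_extension E' F' \<rho>' \<iota>'
  for E :: "('a, 'm) ring_scheme" and F :: "('b, 'k) ring_scheme" and \<rho> \<iota>
    and E' :: "('c, 'n) ring_scheme" and F' :: "('d, 'l) ring_scheme" and \<rho>' \<iota>' +
  fixes q :: nat and \<theta> :: "'b \<Rightarrow> 'd"
  assumes theta: "\<theta> \<in> ring_iso F F'"
    and reg: "von_neumann_regular F"
    and exponent: "frobenius_exponent F q"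
begin

sublocale T: ring_hom_ring F F' \<theta>
  by (rule ring_iso_hom[OF L.S.ring_axioms M.S.ring_axioms theta])

lemma reg': "von_neumann_regular F'"
  by (rule von_neumann_regular_iso[OF L.S.ring_axioms M.S.ring_axioms theta reg])

lemma exponent': "frobenius_exponent F' q"
  by (rule frobenius_exponent_iso[OF L.S.ring_axioms M.S.ring_axioms theta exponent])

lemma theta_eq_iff: "x \<in> carrier F \<Longrightarrow> y \<in> carrier F \<Longrightarrow> \<theta> x = \<theta> y \<longleftrightarrow> x = y"
  using ring_iso_bij[OF theta] by (auto simp: bij_betw_def dest: inj_onD)

lemma theta_obtain:
  assumes "y \<in> carrier F'" obtains x where "x \<in> carrier F" "y = \<theta> x"
  using assms ring_iso_bij[OF theta] that unfolding bij_betw_def by (metis imageE)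

lemma theta_Units_iff: "u \<in> carrier F \<Longrightarrow> \<theta> u \<in> Units F' \<longleftrightarrow> u \<in> Units F"
  by (rule ring_iso_Units_iff[OF L.S.ring_axioms M.S.ring_axioms theta])

text \<open>Both conjugacy relations amount to the same system of equations, over \<open>F\<close> and over \<open>F'\<close>, and
\<open>\<theta>\<close> carries one system to the other.\<close>

lemma conjugate_transfer_iff:
  assumes G: "good_lift E F \<rho> q G" and H: "good_lift E F \<rho> q H"
    and G': "good_lift E' F' \<rho>' q G'" and H': "good_lift E' F' \<rho>' q H'"
    and eq: "\<theta> (\<rho> G) = \<rho>' G'" "\<theta> (\<rho> H) = \<rho>' H'"
    and x [simp]: "x \<in> carrier F" and y [simp]: "y \<in> carrier F"
  shows "(\<exists>v\<in>Units E'. v \<otimes>\<^bsub>E'\<^esub> (G' \<oplus>\<^bsub>E'\<^esub> \<iota>' (\<theta> x)) = (H' \<oplus>\<^bsub>E'\<^esub> \<iota>' (\<theta> y)) \<otimes>\<^bsub>E'\<^esub> v) \<longleftrightarrow>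
    (\<exists>v\<in>Units E. v \<otimes>\<^bsub>E\<^esub> (G \<oplus>\<^bsub>E\<^esub> \<iota> x) = (H \<oplus>\<^bsub>E\<^esub> \<iota> y) \<otimes>\<^bsub>E\<^esub> v)"
proof -
  have [simp]: "\<rho> G \<in> carrier F" "\<rho> H \<in> carrier F" using G H by (auto simp: good_lift_def)
  let ?P = "\<lambda>u z. u \<otimes>\<^bsub>F\<^esub> \<rho> G = \<rho> H \<otimes>\<^bsub>F\<^esub> u \<and>
       u \<otimes>\<^bsub>F\<^esub> x \<oplus>\<^bsub>F\<^esub> z \<otimes>\<^bsub>F\<^esub> \<rho> G = y \<otimes>\<^bsub>F\<^esub> u \<oplus>\<^bsub>F\<^esub> \<rho> H \<otimes>\<^bsub>F\<^esub> z"
  let ?P' = "\<lambda>u z. u \<otimes>\<^bsub>F'\<^esub> \<rho>' G' = \<rho>' H' \<otimes>\<^bsub>F'\<^esub> u \<and>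
       u \<otimes>\<^bsub>F'\<^esub> \<theta> x \<oplus>\<^bsub>F'\<^esub> z \<otimes>\<^bsub>F'\<^esub> \<rho>' G' = \<theta> y \<otimes>\<^bsub>F'\<^esub> u \<oplus>\<^bsub>F'\<^esub> \<rho>' H' \<otimes>\<^bsub>F'\<^esub> z"
  have P: "?P' (\<theta> u) (\<theta> z) \<longleftrightarrow> ?P u z" if [simp]: "u \<in> carrier F" "z \<in> carrier F" for u z
  proof -
    have "?P' (\<theta> u) (\<theta> z) \<longleftrightarrow> \<theta> (u \<otimes>\<^bsub>F\<^esub> \<rho> G) = \<theta> (\<rho> H \<otimes>\<^bsub>F\<^esub> u) \<and>
       \<theta> (u \<otimes>\<^bsub>F\<^esub> x \<oplus>\<^bsub>F\<^esub> z \<otimes>\<^bsub>F\<^esub> \<rho> G) = \<theta> (y \<otimes>\<^bsub>F\<^esub> u \<oplus>\<^bsub>F\<^esub> \<rho> H \<otimes>\<^bsub>F\<^esub> z)"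
      unfolding eq[symmetric] by simp
    then show ?thesis by (simp only: theta_eq_iff L.S.m_closed L.S.a_closed that x y \<open>\<rho> G \<in> carrier F\<close> \<open>\<rho> H \<in> carrier F\<close>)
  qed
  have "(\<exists>u\<in>Units F'. \<exists>z\<in>carrier F'. ?P' u z) \<longleftrightarrow> (\<exists>u\<in>Units F. \<exists>z\<in>carrier F. ?P u z)"
  proof
    assume "\<exists>u\<in>Units F'. \<exists>z\<in>carrier F'. ?P' u z"
    then obtain u' z' where u': "u' \<in> Units F'" "z' \<in> carrier F'" "?P' u' z'" by blast
    obtain u where u: "u \<in> carrier F" "u' = \<theta> u" using theta_obtain M.S.Units_closed[OF u'(1)] .
    obtain z where z: "z \<in> carrier F" "z' = \<theta> z" using theta_obtain u'(2) .
    have "u \<in> Units F" using theta_Units_iff u u'(1) by simp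
    then show "\<exists>u\<in>Units F. \<exists>z\<in>carrier F. ?P u z" using P[OF u(1) z(1)] u' u z by blast
  next
    assume "\<exists>u\<in>Units F. \<exists>z\<in>carrier F. ?P u z"
    then obtain u z where u: "u \<in> Units F" "z \<in> carrier F" "?P u z" by blast
    then show "\<exists>u\<in>Units F'. \<exists>z\<in>carrier F'. ?P' u z"
      using P[OF L.S.Units_closed[OF u(1)] u(2)] T.hom_Units[OF u(1)] T.hom_closed[OF u(2)] by blast
  qed
  then show ?thesis
    using L.conjugate_iff[OF reg exponent G H x y]
      M.conjugate_iff[OF reg' exponent' G' H' T.hom_closed[OF x] T.hom_closed[OF y]] by simp
qed

abbreviation "transfer \<equiv> transfer_set E F \<rho> \<iota> E' F' \<rho>' \<iota>' q \<theta>"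

text \<open>Fix good lifts \<open>t\<close> and \<open>t'\<close> on both sides; then \<open>t g + \<iota> c \<mapsto> t' (\<theta> g) + \<iota>' (\<theta> c)\<close> is a bijection,
and it preserves and reflects conjugacy.  A decomposition of the same element with other good lifts
leads to a conjugate of the same image, since an element is conjugate to itself; therefore the choice
of \<open>t\<close> and \<open>t'\<close> does not affect the image of a whole class.\<close>

lemma transfer_by_bijection:
  obtains \<psi> where "bij_betw \<psi> (Units E) (Units E')"
    and "\<And>x y. x \<in> Units E \<Longrightarrow> y \<in> Units E \<Longrightarrow> \<psi> y \<in> unit_class E' (\<psi> x) \<longleftrightarrow> y \<in> unit_class E x"
    and "\<And>x. x \<in> Units E \<Longrightarrow> transfer (unit_class E x) = \<psi> ` unit_class E x"
proof -
  obtain t where t: "\<And>g. g \<in> carrier F \<Longrightarrow> good_lift E F \<rho> q (t g) \<and> \<rho> (t g) = g"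
    using L.good_lift_exists[OF reg exponent] by metis
  obtain t' where t': "\<And>g. g \<in> carrier F' \<Longrightarrow> good_lift E' F' \<rho>' q (t' g) \<and> \<rho>' (t' g) = g"
    using M.good_lift_exists[OF reg' exponent'] by metis
  have tc [simp]: "t g \<in> carrier E" "\<rho> (t g) = g" if "g \<in> carrier F" for g
    using t[OF that] by (auto simp: good_lift_def)
  have tc' [simp]: "t' g \<in> carrier E'" "\<rho>' (t' g) = g" if "g \<in> carrier F'" for g
    using t'[OF that] by (auto simp: good_lift_def)
  have "\<forall>x\<in>carrier E. \<exists>c\<in>carrier F. x = t (\<rho> x) \<oplus>\<^bsub>E\<^esub> \<iota> c"
  proof
    fix x assume x: "x \<in> carrier E"
    obtain c where "c \<in> carrier F" "x = t (\<rho> x) \<oplus>\<^bsub>E\<^esub> \<iota> c"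
      using L.same_rho_obtain[of x "t (\<rho> x)"] x by auto
    then show "\<exists>c\<in>carrier F. x = t (\<rho> x) \<oplus>\<^bsub>E\<^esub> \<iota> c" by blast
  qed
  then obtain \<kappa> where \<kappa>: "\<And>x. x \<in> carrier E \<Longrightarrow> \<kappa> x \<in> carrier F" 
      "\<And>x. x \<in> carrier E \<Longrightarrow> x = t (\<rho> x) \<oplus>\<^bsub>E\<^esub> \<iota> (\<kappa> x)"
    by metis
  define \<psi> where "\<psi> x = t' (\<theta> (\<rho> x)) \<oplus>\<^bsub>E'\<^esub> \<iota>' (\<theta> (\<kappa> x))" for x
  have \<psi> [simp]: "\<psi> x \<in> carrier E'" "\<rho>' (\<psi> x) = \<theta> (\<rho> x)" if "x \<in> carrier E" for x
    using that \<kappa>(1) by (simp_all add: \<psi>_def)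
  have unitE: "x \<in> Units E \<longleftrightarrow> \<rho> x \<in> Units F" if "x \<in> carrier E" for x
    using that L.Units_lift L.rho_Units by blast
  have unitE': "x \<in> Units E' \<longleftrightarrow> \<rho>' x \<in> Units F'" if "x \<in> carrier E'" for x
    using that M.Units_lift M.rho_Units by blast
  have \<psi>_units: "\<psi> x \<in> Units E' \<longleftrightarrow> x \<in> Units E" if "x \<in> carrier E" for x
    using that by (simp add: unitE unitE' theta_Units_iff)
  have inj: "x = y" if "x \<in> carrier E" "y \<in> carrier E" "\<psi> x = \<psi> y" for x y
  proof -
    have "\<theta> (\<rho> x) = \<theta> (\<rho> y)" using that \<psi>(2) by metis
    then have r: "\<rho> x = \<rho> y" using that by (simp add: theta_eq_iff)
    then have "\<theta> (\<kappa> x) = \<theta> (\<kappa> y)" using that(3) \<kappa>(1) that(1,2) unfolding \<psi>_def by simp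
    then have "\<kappa> x = \<kappa> y" using that \<kappa>(1) by (simp add: theta_eq_iff)
    then show "x = y" using \<kappa>(2)[OF that(1)] \<kappa>(2)[OF that(2)] r by simp
  qed
  have surj: "\<exists>x\<in>carrier E. \<psi> x = y" if y: "y \<in> carrier E'" for y
  proof -
    obtain g where g: "g \<in> carrier F" "\<rho>' y = \<theta> g" using theta_obtain[OF M.rho_closed[OF y]] .
    obtain c where c: "c \<in> carrier F'" "y = t' (\<rho>' y) \<oplus>\<^bsub>E'\<^esub> \<iota>' c"
      using M.same_rho_obtain[of y "t' (\<rho>' y)"] y by auto
    obtain b where b: "b \<in> carrier F" "c = \<theta> b" using theta_obtain c(1) .
    define x where "x = t g \<oplus>\<^bsub>E\<^esub> \<iota> b"
    have x: "x \<in> carrier E" "\<rho> x = g" using g b by (simp_all add: x_def)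
    have "t g \<oplus>\<^bsub>E\<^esub> \<iota> (\<kappa> x) = t g \<oplus>\<^bsub>E\<^esub> \<iota> b" using \<kappa>(2)[OF x(1)] x(2) by (simp add: x_def)
    then have "\<kappa> x = b" using g b \<kappa>(1)[OF x(1)] by simp
    then have "\<psi> x = y" using x g b c by (simp add: \<psi>_def)
    then show ?thesis using x by blast
  qed
  have bij: "bij_betw \<psi> (Units E) (Units E')"
    unfolding bij_betw_def
  proof
    show "inj_on \<psi> (Units E)" using inj L.R.Units_closed by (intro inj_onI) blast
    show "\<psi> ` Units E = Units E'"
    proof
      show "\<psi> ` Units E \<subseteq> Units E'" using \<psi>_units L.R.Units_closed by blast
      show "Units E' \<subseteq> \<psi> ` Units E"
      proof
        fix y assume y: "y \<in> Units E'"
        then obtain x where "x \<in> carrier E" "\<psi> x = y" using surj M.R.Units_closed by blast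
        then show "y \<in> \<psi> ` Units E" using \<psi>_units y by blast
      qed
    qed
  qed
  have good: "good_lift E F \<rho> q (t (\<rho> x)) \<and> good_lift E' F' \<rho>' q (t' (\<theta> (\<rho> x))) \<and>
      \<theta> (\<rho> (t (\<rho> x))) = \<rho>' (t' (\<theta> (\<rho> x)))" if "x \<in> carrier E" for x
    using that t t' by simp
  have conj: "\<psi> y \<in> unit_class E' (\<psi> x) \<longleftrightarrow> y \<in> unit_class E x" if "x \<in> Units E" "y \<in> Units E" for x y
  proof -
    have c: "x \<in> carrier E" "y \<in> carrier E" using that L.R.Units_closed by blast+
    have "(\<exists>v\<in>Units E'. v \<otimes>\<^bsub>E'\<^esub> \<psi> x = \<psi> y \<otimes>\<^bsub>E'\<^esub> v) \<longleftrightarrow> (\<exists>v\<in>Units E. v \<otimes>\<^bsub>E\<^esub> x = y \<otimes>\<^bsub>E\<^esub> v)"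
      using conjugate_transfer_iff[of "t (\<rho> x)" "t (\<rho> y)" "t' (\<theta> (\<rho> x))" "t' (\<theta> (\<rho> y))" "\<kappa> x" "\<kappa> y"]
        good[OF c(1)] good[OF c(2)] \<kappa>(1)[OF c(1)] \<kappa>(1)[OF c(2)]
      unfolding \<psi>_def \<kappa>(2)[OF c(1), symmetric] \<kappa>(2)[OF c(2), symmetric] by blast
    then show ?thesis unfolding unit_class_def using that \<psi>_units c by auto
  qed
  have "transfer (unit_class E x) = \<psi> ` unit_class E x" if x: "x \<in> Units E" for x
  proof
    show "\<psi> ` unit_class E x \<subseteq> transfer (unit_class E x)"
    proof
      fix z assume "z \<in> \<psi> ` unit_class E x"
      then obtain y where y: "y \<in> unit_class E x" "z = \<psi> y" by blast
      then have c: "y \<in> carrier E" unfolding unit_class_def using L.R.Units_closed by blast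
      show "z \<in> transfer (unit_class E x)"
        unfolding transfer_set_def y(2) \<psi>_def mem_Collect_eq
        by (rule exI[of _ "t (\<rho> y)"], rule exI[of _ "t' (\<theta> (\<rho> y))"], rule exI[of _ "\<kappa> y"])
          (use good[OF c] \<kappa>(1)[OF c] \<kappa>(2)[OF c] y(1) in simp)
    qed
    show "transfer (unit_class E x) \<subseteq> \<psi> ` unit_class E x"
    proof
      fix z assume "z \<in> transfer (unit_class E x)"
      then obtain G H a where G: "good_lift E F \<rho> q G" and H: "good_lift E' F' \<rho>' q H"
        and eq: "\<theta> (\<rho> G) = \<rho>' H" and a: "a \<in> carrier F" and Ga: "G \<oplus>\<^bsub>E\<^esub> \<iota> a \<in> unit_class E x"
        and z: "z = H \<oplus>\<^bsub>E'\<^esub> \<iota>' (\<theta> a)" unfolding transfer_set_def by blast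
      define y where "y = G \<oplus>\<^bsub>E\<^esub> \<iota> a"
      have yu: "y \<in> Units E" using Ga by (simp add: y_def unit_class_def)
      then have c: "y \<in> carrier E" by (simp only: L.R.Units_closed)
      have GH: "G \<in> carrier E" "H \<in> carrier E'" using G H by (auto simp: good_lift_def)
      have zc: "z \<in> carrier E'" using GH a by (simp add: z)
      have "\<rho>' z = \<theta> (\<rho> y)" using GH a eq by (simp add: z y_def)
      then have zu: "z \<in> Units E'" using unitE[OF c] unitE'[OF zc] yu L.R.Units_closed
        by (simp add: T.hom_Units)
      have "\<exists>v\<in>Units E. v \<otimes>\<^bsub>E\<^esub> y = y \<otimes>\<^bsub>E\<^esub> v" using c by (intro bexI[of _ "\<one>\<^bsub>E\<^esub>"]) auto
      then have "\<exists>v\<in>Units E'. v \<otimes>\<^bsub>E'\<^esub> \<psi> y = z \<otimes>\<^bsub>E'\<^esub> v"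
        using conjugate_transfer_iff[of "t (\<rho> y)" G "t' (\<theta> (\<rho> y))" H "\<kappa> y" a]
          good[OF c] G H eq a \<kappa>(1)[OF c]
        unfolding \<psi>_def \<kappa>(2)[OF c, symmetric] z y_def[symmetric] by blast
      then have zy: "z \<in> unit_class E' (\<psi> y)" using zu unfolding unit_class_def by blast
      obtain w where w: "w \<in> Units E" "z = \<psi> w" using zu bij unfolding bij_betw_def by blast
      have "w \<in> unit_class E y" using conj[OF yu w(1)] zy w(2) by simp
      then have "w \<in> unit_class E x"
        using L.R.unit_class_trans[OF x] Ga unfolding y_def by blast
      then show "z \<in> \<psi> ` unit_class E x" using w(2) by blast
    qed
  qed
  then show ?thesis using that[OF bij conj] by blast
qed

theorem transfer_bij_betw:
  "bij_betw transfer (conj_classes (units_of E)) (conj_classes (units_of E'))"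
  "\<And>C. C \<in> conj_classes (units_of E) \<Longrightarrow> card (transfer C) = card C"
proof -
  obtain \<psi> where \<psi>: "bij_betw \<psi> (Units E) (Units E')"
    and conj: "\<And>x y. x \<in> Units E \<Longrightarrow> y \<in> Units E \<Longrightarrow> \<psi> y \<in> unit_class E' (\<psi> x) \<longleftrightarrow> y \<in> unit_class E x"
    and tr: "\<And>x. x \<in> Units E \<Longrightarrow> transfer (unit_class E x) = \<psi> ` unit_class E x"
    using transfer_by_bijection by blast
  have \<psi>': "inj_on \<psi> (Units E)" "\<psi> ` Units E = Units E'" using \<psi> by (auto simp: bij_betw_def)
  have sub: "unit_class R x \<subseteq> Units R" for R :: "('e, 'f) monoid_scheme" and x by (auto simp: unit_class_def)
  have img: "transfer (unit_class E x) = unit_class E' (\<psi> x)" if x: "x \<in> Units E" for x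
  proof -
    have "\<psi> ` unit_class E x = unit_class E' (\<psi> x)"
    proof
      show "\<psi> ` unit_class E x \<subseteq> unit_class E' (\<psi> x)" using conj[OF x] sub[of E x] by blast
      show "unit_class E' (\<psi> x) \<subseteq> \<psi> ` unit_class E x"
      proof
        fix z assume z: "z \<in> unit_class E' (\<psi> x)"
        then obtain y where "y \<in> Units E" "z = \<psi> y" 
          using sub[of E' "\<psi> x"] unfolding \<psi>'(2)[symmetric] by blast
        then show "z \<in> \<psi> ` unit_class E x" using conj[OF x] z by blast
      qed
    qed
    then show ?thesis using tr[OF x] by simp
  qed
  show "bij_betw transfer (conj_classes (units_of E)) (conj_classes (units_of E'))"
    unfolding L.R.conj_classes_units M.R.conj_classes_units
  proof (rule bij_betw_imageI)
    show "inj_on transfer (unit_class E ` Units E)"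
    proof (rule inj_onI, elim imageE)
      fix C D x y assume C: "C = unit_class E x" "x \<in> Units E" and D: "D = unit_class E y" "y \<in> Units E"
        and "transfer C = transfer D"
      then have "unit_class E' (\<psi> x) = unit_class E' (\<psi> y)" using img by simp
      moreover have "\<psi> x \<in> Units E'" "\<psi> y \<in> Units E'" using \<psi>'(2) C D by auto
      ultimately have "\<psi> y \<in> unit_class E' (\<psi> x)" using M.R.unit_class_eq_iff by blast
      then show "C = D" using conj C D L.R.unit_class_eq_iff by blast
    qed
    have "transfer ` unit_class E ` Units E = (\<lambda>x. unit_class E' (\<psi> x)) ` Units E"
      unfolding image_image using img by (rule image_cong[OF refl])
    also have "\<dots> = unit_class E' ` Units E'" unfolding \<psi>'(2)[symmetric] image_image ..
    finally show "transfer ` unit_class E ` Units E = unit_class E' ` Units E'" .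
  qed
  fix C assume "C \<in> conj_classes (units_of E)"
  then obtain x where x: "x \<in> Units E" "C = unit_class E x" unfolding L.R.conj_classes_units by blast
  then show "card (transfer C) = card C"
    using tr[OF x(1)] card_image[OF inj_on_subset[OF \<psi>'(1) sub[of E x]]] by simp
qed

end

section \<open>Naturality of the transfer\<close>

definition extension_iso ::
  "('a, 'm) ring_scheme \<Rightarrow> ('b, 'k) ring_scheme \<Rightarrow> ('a \<Rightarrow> 'b) \<Rightarrow> ('b \<Rightarrow> 'a) \<Rightarrow>
   ('c, 'n) ring_scheme \<Rightarrow> ('d, 'l) ring_scheme \<Rightarrow> ('c \<Rightarrow> 'd) \<Rightarrow> ('d \<Rightarrow> 'c) \<Rightarrow>
   ('a \<Rightarrow> 'c) \<Rightarrow> ('b \<Rightarrow> 'd) \<Rightarrow> bool" where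
  "extension_iso E F \<rho> \<iota> E' F' \<rho>' \<iota>' a b \<longleftrightarrow>
     a \<in> ring_iso E E' \<and> b \<in> ring_iso F F' \<and>
     (\<forall>x\<in>carrier E. \<rho>' (a x) = b (\<rho> x)) \<and> (\<forall>x\<in>carrier F. a (\<iota> x) = \<iota>' (b x))"

lemma good_lift_iso:
  assumes "square_zero_extension E F \<rho> \<iota>" "square_zero_extension E' F' \<rho>' \<iota>'"
    and iso: "extension_iso E F \<rho> \<iota> E' F' \<rho>' \<iota>' a b" and G: "G \<in> carrier E"
  shows "good_lift E' F' \<rho>' q (a G) \<longleftrightarrow> good_lift E F \<rho> q G"
proof -
  interpret L: square_zero_extension E F \<rho> \<iota> by fact
  interpret M: square_zero_extension E' F' \<rho>' \<iota>' by fact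
  have a: "a \<in> ring_iso E E'" and b: "b \<in> ring_iso F F'"
    and ab: "\<And>x. x \<in> carrier E \<Longrightarrow> \<rho>' (a x) = b (\<rho> x)"
    using iso by (auto simp: extension_iso_def)
  interpret a: ring_hom_ring E E' a by (rule ring_iso_hom[OF L.R.ring_axioms M.R.ring_axioms a])
  interpret b: ring_hom_ring F F' b by (rule ring_iso_hom[OF L.S.ring_axioms M.S.ring_axioms b])
  have Eq: "carrier E' = a ` carrier E" "carrier F' = b ` carrier F"
    and inj: "inj_on a (carrier E)" "inj_on b (carrier F)"
    using ring_iso_bij[OF a] ring_iso_bij[OF b] by (auto simp: bij_betw_def)
  have a0: "a x = \<zero>\<^bsub>E'\<^esub> \<longleftrightarrow> x = \<zero>\<^bsub>E\<^esub>" if "x \<in> carrier E" for x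
    using inj_on_eq_iff[OF inj(1) that L.R.zero_closed] by simp
  have b0: "b x = \<zero>\<^bsub>F'\<^esub> \<longleftrightarrow> x = \<zero>\<^bsub>F\<^esub>" if "x \<in> carrier F" for x
    using inj_on_eq_iff[OF inj(2) that L.S.zero_closed] by simp
  have bb: "b x = b y \<longleftrightarrow> x = y" if "x \<in> carrier F" "y \<in> carrier F" for x y
    using inj_on_eq_iff[OF inj(2) that] .
  define N where "N = G \<ominus>\<^bsub>E\<^esub> G [^]\<^bsub>E\<^esub> (q * q)"
  have N [simp]: "N \<in> carrier E" using G by (simp add: N_def)
  have aN: "a G \<ominus>\<^bsub>E'\<^esub> a G [^]\<^bsub>E'\<^esub> (q * q) = a N"
    using G by (simp add: N_def a.hom_a_minus a.hom_nat_pow)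
  have 1: "\<rho>' (a N) [^]\<^bsub>F'\<^esub> j \<otimes>\<^bsub>F'\<^esub> b w = \<zero>\<^bsub>F'\<^esub> \<longleftrightarrow> \<rho> N [^]\<^bsub>F\<^esub> j \<otimes>\<^bsub>F\<^esub> w = \<zero>\<^bsub>F\<^esub>"
    if "w \<in> carrier F" for j :: nat and w
    using b0[of "\<rho> N [^]\<^bsub>F\<^esub> j \<otimes>\<^bsub>F\<^esub> w"] that by (simp add: ab b.hom_nat_pow)
  have 2: "\<rho>' (a W) = b w \<and> a N [^]\<^bsub>E'\<^esub> j \<otimes>\<^bsub>E'\<^esub> a W = \<zero>\<^bsub>E'\<^esub> \<longleftrightarrow>
      \<rho> W = w \<and> N [^]\<^bsub>E\<^esub> j \<otimes>\<^bsub>E\<^esub> W = \<zero>\<^bsub>E\<^esub>"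
    if "w \<in> carrier F" "W \<in> carrier E" for j :: nat and w W
    using a0[of "N [^]\<^bsub>E\<^esub> j \<otimes>\<^bsub>E\<^esub> W"] that by (simp add: ab bb a.hom_nat_pow)
  have "kernels_lift E' F' \<rho>' q (a N) \<longleftrightarrow> kernels_lift E F \<rho> q N"
    unfolding kernels_lift_def Eq ball_simps bex_simps by (simp add: 1 2 cong: ball_cong bex_cong)
  then show ?thesis unfolding good_lift_def aN using G by (simp add: N_def)
qed

text \<open>Isomorphisms of extensions map good lifts to good lifts and decompositions to decompositions, in both
directions, so they commute with a construction that uses nothing else.\<close>

theorem transfer_set_natural:
  assumes ext: "square_zero_extension E F \<rho> \<iota>" "square_zero_extension E' F' \<rho>' \<iota>'"
      "square_zero_extension D K \<sigma> \<kappa>" "square_zero_extension D' K' \<sigma>' \<kappa>'"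
    and a: "extension_iso E F \<rho> \<iota> D K \<sigma> \<kappa> a a0"
    and b: "extension_iso E' F' \<rho>' \<iota>' D' K' \<sigma>' \<kappa>' b b0"
    and th: "\<theta> \<in> carrier F \<rightarrow> carrier F'"
    and sq: "\<And>x. x \<in> carrier F \<Longrightarrow> \<eta> (a0 x) = b0 (\<theta> x)"
    and C: "C \<subseteq> carrier E"
  shows "transfer_set D K \<sigma> \<kappa> D' K' \<sigma>' \<kappa>' q \<eta> (a ` C) =
     b ` transfer_set E F \<rho> \<iota> E' F' \<rho>' \<iota>' q \<theta> C"
proof -
  interpret E: square_zero_extension E F \<rho> \<iota> by fact
  interpret E': square_zero_extension E' F' \<rho>' \<iota>' by fact
  interpret D: square_zero_extension D K \<sigma> \<kappa> by fact
  interpret D': square_zero_extension D' K' \<sigma>' \<kappa>' by fact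
  have a': "a \<in> ring_iso E D" "a0 \<in> ring_iso F K"
    "\<And>x. x \<in> carrier E \<Longrightarrow> \<sigma> (a x) = a0 (\<rho> x)" "\<And>x. x \<in> carrier F \<Longrightarrow> a (\<iota> x) = \<kappa> (a0 x)"
    using a by (auto simp: extension_iso_def)
  have b': "b \<in> ring_iso E' D'" "b0 \<in> ring_iso F' K'"
    "\<And>x. x \<in> carrier E' \<Longrightarrow> \<sigma>' (b x) = b0 (\<rho>' x)" "\<And>x. x \<in> carrier F' \<Longrightarrow> b (\<iota>' x) = \<kappa>' (b0 x)"
    using b by (auto simp: extension_iso_def)
  interpret a: ring_hom_ring E D a by (rule ring_iso_hom[OF E.R.ring_axioms D.R.ring_axioms a'(1)])
  interpret b: ring_hom_ring E' D' b by (rule ring_iso_hom[OF E'.R.ring_axioms D'.R.ring_axioms b'(1)])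
  have surj: "carrier D = a ` carrier E" "carrier K = a0 ` carrier F" "carrier D' = b ` carrier E'"
    and inj: "inj_on a (carrier E)" "inj_on b0 (carrier F')"
    using ring_iso_bij[OF a'(1)] ring_iso_bij[OF a'(2)] ring_iso_bij[OF b'(1)] ring_iso_bij[OF b'(2)]
    by (auto simp: bij_betw_def)
  have thc [simp]: "\<theta> x \<in> carrier F'" if "x \<in> carrier F" for x using th that by blast
  note goodc = good_lift_def[THEN iffD1, THEN conjunct1]
  show ?thesis
  proof
    show "transfer_set D K \<sigma> \<kappa> D' K' \<sigma>' \<kappa>' q \<eta> (a ` C) \<subseteq> b ` transfer_set E F \<rho> \<iota> E' F' \<rho>' \<iota>' q \<theta> C"
    proof
      fix z assume "z \<in> transfer_set D K \<sigma> \<kappa> D' K' \<sigma>' \<kappa>' q \<eta> (a ` C)"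
      then obtain G2 H2 x2 where g2: "good_lift D K \<sigma> q G2" "good_lift D' K' \<sigma>' q H2"
        and e2: "\<eta> (\<sigma> G2) = \<sigma>' H2" and x2: "x2 \<in> carrier K" and c2: "G2 \<oplus>\<^bsub>D\<^esub> \<kappa> x2 \<in> a ` C"
        and z: "z = H2 \<oplus>\<^bsub>D'\<^esub> \<kappa>' (\<eta> x2)" unfolding transfer_set_def by blast
      obtain G where G: "G \<in> carrier E" "G2 = a G" using goodc[OF g2(1)] unfolding surj by blast
      obtain H where H: "H \<in> carrier E'" "H2 = b H" using goodc[OF g2(2)] unfolding surj by blast
      obtain x where x: "x \<in> carrier F" "x2 = a0 x" using x2 unfolding surj by blast
      have g: "good_lift E F \<rho> q G" "good_lift E' F' \<rho>' q H"
        using g2 good_lift_iso[OF ext(1,3) a G(1)] good_lift_iso[OF ext(2,4) b H(1)] G H by auto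
      have "b0 (\<theta> (\<rho> G)) = b0 (\<rho>' H)" using e2 G H by (simp add: a'(3) b'(3) sq)
      then have e: "\<theta> (\<rho> G) = \<rho>' H" using inj_on_eq_iff[OF inj(2)] G H by simp
      obtain y where y: "y \<in> C" "a y = a (G \<oplus>\<^bsub>E\<^esub> \<iota> x)"
        using c2 G x by (auto simp: a'(4))
      then have "G \<oplus>\<^bsub>E\<^esub> \<iota> x \<in> C" using inj_on_eq_iff[OF inj(1), of y "G \<oplus>\<^bsub>E\<^esub> \<iota> x"] C G x by auto
      then have "H \<oplus>\<^bsub>E'\<^esub> \<iota>' (\<theta> x) \<in> transfer_set E F \<rho> \<iota> E' F' \<rho>' \<iota>' q \<theta> C"
        unfolding transfer_set_def using g e x by blast
      moreover have "z = b (H \<oplus>\<^bsub>E'\<^esub> \<iota>' (\<theta> x))" using H x by (simp add: z b'(4) sq)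
      ultimately show "z \<in> b ` transfer_set E F \<rho> \<iota> E' F' \<rho>' \<iota>' q \<theta> C" by blast
    qed
    show "b ` transfer_set E F \<rho> \<iota> E' F' \<rho>' \<iota>' q \<theta> C \<subseteq> transfer_set D K \<sigma> \<kappa> D' K' \<sigma>' \<kappa>' q \<eta> (a ` C)"
    proof
      fix z assume "z \<in> b ` transfer_set E F \<rho> \<iota> E' F' \<rho>' \<iota>' q \<theta> C"
      then obtain G H x where g: "good_lift E F \<rho> q G" "good_lift E' F' \<rho>' q H"
        and e: "\<theta> (\<rho> G) = \<rho>' H" and x: "x \<in> carrier F" and c: "G \<oplus>\<^bsub>E\<^esub> \<iota> x \<in> C"
        and z: "z = b (H \<oplus>\<^bsub>E'\<^esub> \<iota>' (\<theta> x))" unfolding transfer_set_def by blast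
      have GH: "G \<in> carrier E" "H \<in> carrier E'" using goodc[OF g(1)] goodc[OF g(2)] by auto
      have g2: "good_lift D K \<sigma> q (a G)" "good_lift D' K' \<sigma>' q (b H)"
        using g good_lift_iso[OF ext(1,3) a GH(1)] good_lift_iso[OF ext(2,4) b GH(2)] by auto
      have "\<eta> (\<sigma> (a G)) = \<sigma>' (b H)" using GH e by (simp add: a'(3) b'(3) sq)
      moreover have "z = b H \<oplus>\<^bsub>D'\<^esub> \<kappa>' (\<eta> (a0 x))" using GH x by (simp add: z b'(4) sq)
      moreover have "a G \<oplus>\<^bsub>D\<^esub> \<kappa> (a0 x) \<in> a ` C" using c GH x by (metis a'(4) a.hom_add E.iota_closed imageI)
      moreover have "a0 x \<in> carrier K" using surj(2) x by blast
      ultimately show "z \<in> transfer_set D K \<sigma> \<kappa> D' K' \<sigma>' \<kappa>' q \<eta> (a ` C)"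
        unfolding transfer_set_def using g2 by blast
    qed
  qed
qed

section \<open>Frobenius exponents of finite rings\<close>

lemma (in ring) commuting_binomial:
  assumes x [simp]: "x \<in> carrier R" and y [simp]: "y \<in> carrier R" and xy: "x \<otimes> y = y \<otimes> x"
  shows "(x \<oplus> y) [^] (m::nat) = (\<Oplus>i\<in>{..m}. [(m choose i)] \<cdot> (x [^] i \<otimes> y [^] (m - i)))"
proof (induction m)
  case 0
  then show ?case by simp
next
  case (Suc m)
  let ?t = "\<lambda>(i::nat) (j::nat). x [^] i \<otimes> y [^] j"
  have yx: "y [^] j \<otimes> x = x \<otimes> y [^] j" for j :: nat
    using group_commutes_pow[of y x j] xy by simp
  have tx: "?t i j \<otimes> x = ?t (Suc i) j" for i j by (simp add: m_assoc yx)
  have ty: "?t i j \<otimes> y = ?t i (Suc j)" for i j by (simp add: m_assoc)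
  let ?A = "\<lambda>i. [(m choose i)] \<cdot> ?t (Suc i) (m - i)"
  let ?B = "\<lambda>i. [(m choose i)] \<cdot> ?t i (Suc m - i)"
  have "(x \<oplus> y) [^] Suc m = (x \<oplus> y) [^] m \<otimes> x \<oplus> (x \<oplus> y) [^] m \<otimes> y"
    by (simp add: r_distr)
  also have "(x \<oplus> y) [^] m \<otimes> x = (\<Oplus>i\<in>{..m}. ?A i)"
    unfolding Suc by (subst finsum_ldistr) (auto simp: add_pow_ldistr tx simp del: nat_pow_Suc)
  also have "(x \<oplus> y) [^] m \<otimes> y = (\<Oplus>i\<in>{..m}. ?B i)"
    unfolding Suc
    by (subst finsum_ldistr, simp_all del: nat_pow_Suc, intro finsum_cong)
       (auto simp: add_pow_ldistr ty Suc_diff_le simp_implies_def simp del: nat_pow_Suc)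
  also have "(\<Oplus>i\<in>{..m}. ?B i) = (\<Oplus>i\<in>{..Suc m}. ?B i)"
    by (simp add: Pi_def binomial_eq_0 del: nat_pow_Suc)
  also have "\<dots> = (\<Oplus>i\<in>{..m}. ?B (Suc i)) \<oplus> ?B 0"
    by (subst finsum_Suc2) auto
  also have "(\<Oplus>i\<in>{..m}. ?A i) \<oplus> ((\<Oplus>i\<in>{..m}. ?B (Suc i)) \<oplus> ?B 0)
     = (\<Oplus>i\<in>{..m}. ?A i \<oplus> ?B (Suc i)) \<oplus> ?B 0"
    by (simp add: finsum_addf a_assoc Pi_def del: nat_pow_Suc)
  also have "(\<Oplus>i\<in>{..m}. ?A i \<oplus> ?B (Suc i)) = (\<Oplus>i\<in>{..m}. [(Suc m choose Suc i)] \<cdot> ?t (Suc i) (Suc m - Suc i))"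
    by (intro finsum_cong) (auto simp: add.nat_pow_mult simp_implies_def simp del: nat_pow_Suc)
  also have "\<dots> \<oplus> ?B 0 = (\<Oplus>i\<in>{..Suc m}. [(Suc m choose i)] \<cdot> ?t i (Suc m - i))"
    by (subst finsum_Suc2) (auto simp del: nat_pow_Suc)
  finally show ?case .
qed

lemma (in ring) freshman_prime:
  assumes p: "Factorial_Ring.prime (p::nat)" and tors: "\<And>z. z \<in> carrier R \<Longrightarrow> [p] \<cdot> z = \<zero>"
    and x [simp]: "x \<in> carrier R" and y [simp]: "y \<in> carrier R" and xy: "x \<otimes> y = y \<otimes> x"
  shows "(x \<oplus> y) [^] p = x [^] p \<oplus> y [^] p"
proof -
  let ?f = "\<lambda>i::nat. [(p choose i)] \<cdot> (x [^] i \<otimes> y [^] (p - i))"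
  have mid: "?f i = \<zero>" if "0 < i" "i < p" for i
  proof -
    have "p dvd (p choose i)" using that p by (intro dvd_choose_prime) auto
    then obtain k where k: "p choose i = k * p" by (metis dvd_def mult.commute)
    have "[k] \<cdot> ([p] \<cdot> (x [^] i \<otimes> y [^] (p - i))) = ?f i"
      unfolding k by (subst add.nat_pow_pow) (auto simp: mult.commute)
    then show ?thesis by (simp add: tors)
  qed
  obtain k where k: "p = Suc k" using p by (metis not0_implies_Suc not_prime_0)
  have "0 < k" using p k by (cases k) auto
  then obtain l where l: "k = Suc l" by (cases k) auto
  have "(\<Oplus>i\<in>{..l}. ?f (Suc i)) = (\<Oplus>i\<in>{..l}. \<zero>)"
  proof (rule finsum_cong')
    show "?f (Suc i) = \<zero>" if "i \<in> {..l}" for i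
      using that k l by (intro mid) auto
  qed auto
  then have "(\<Oplus>i\<in>{..k}. ?f i) = ?f 0" unfolding l by (subst finsum_Suc2) auto
  then have "(\<Oplus>i\<in>{..p}. ?f i) = ?f p \<oplus> ?f 0"
    unfolding k by (subst finsum_Suc) auto
  then show ?thesis using commuting_binomial[OF x y xy, of p] by simp
qed

lemma (in ring) freshman_prime_power:
  assumes p: "Factorial_Ring.prime (p::nat)" and tors: "\<And>z. z \<in> carrier R \<Longrightarrow> [p] \<cdot> z = \<zero>"
    and x [simp]: "x \<in> carrier R" and y [simp]: "y \<in> carrier R" and xy: "x \<otimes> y = y \<otimes> x"
  shows "(x \<oplus> y) [^] (p ^ k) = x [^] (p ^ k) \<oplus> y [^] (p ^ k)"
proof (induction k)
  case 0
  then show ?case by simp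
next
  case (Suc k)
  have c: "x [^] (p ^ k) \<otimes> y [^] (p ^ k) = y [^] (p ^ k) \<otimes> x [^] (p ^ k)"
    using group_commutes_pow[of y x "p ^ k"] group_commutes_pow[of x "y [^] (p ^ k)" "p ^ k"] xy
    by simp
  have pw: "z [^] (p ^ Suc k) = (z [^] (p ^ k)) [^] p" if "z \<in> carrier R" for z
    using that by (simp add: nat_pow_pow mult.commute)
  show ?case by (simp add: pw Suc freshman_prime[OF p tors _ _ c] del: power_Suc)
qed

text \<open>The iterates of a self-map of a finite set \<open>A\<close> become periodic after at most \<open>card A\<close> steps, with a
period of at most \<open>card A\<close>.  The factorial of \<open>card A\<close> is both past the beginning of the periodic part
and a multiple of the period, for every starting point.\<close>

lemma iterate_stable:
  fixes f :: "'a \<Rightarrow> 'a"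
  assumes fin: "finite A" and x: "x \<in> A" and f: "f ` A \<subseteq> A"
  shows "(f ^^ (fact (card A) + fact (card A))) x = (f ^^ (fact (card A))) x"
proof -
  define a where "a j = (f ^^ j) x" for j
  have aA: "a j \<in> A" for j unfolding a_def by (induction j) (use x f in auto)
  have "\<not> inj_on a {..card A}"
    using card_inj_on_le[of a "{..card A}" A] aA fin by auto
  then obtain i j where ij: "i < j" "j \<le> card A" "a i = a j"
    unfolding inj_on_def by (metis atMost_iff linorder_neqE_nat)
  have step: "a (l + (j - i)) = a l" if "i \<le> l" for l
  proof -
    have "a (l + (j - i)) = (f ^^ (l - i)) (a j)"
      unfolding a_def using that ij(1) by (simp flip: funpow_add[unfolded o_def fun_eq_iff, rule_format])
    also have "\<dots> = a l"
      unfolding ij(3)[symmetric] unfolding a_def using that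
      by (simp flip: funpow_add[unfolded o_def fun_eq_iff, rule_format])
    finally show ?thesis .
  qed
  have per: "a (l + m * (j - i)) = a l" if "i \<le> l" for l m
  proof (induction m)
    case (Suc m)
    have "l + Suc m * (j - i) = l + m * (j - i) + (j - i)" by simp
    then show ?case using step[of "l + m * (j - i)"] that Suc by (metis trans_le_add1)
  qed simp
  have "(j - i) dvd (fact (card A) :: nat)" using ij by (intro dvd_fact) auto
  then obtain m where m: "(fact (card A) :: nat) = m * (j - i)" by (metis dvd_def mult.commute)
  have "i \<le> fact (card A)" using ij fact_ge_self[of "card A"] by linarith
  from per[OF this, of m] show ?thesis unfolding m[symmetric] a_def .
qed

text \<open>Iterate the map \<open>z \<mapsto> z\<^sup>p\<close>, which respects differences of commuting elements.\<close>

theorem (in ring) frobenius_exponent_exists: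
  assumes fin: "finite (carrier R)" and p: "Factorial_Ring.prime (p::nat)"
    and tors: "\<And>z. z \<in> carrier R \<Longrightarrow> [p] \<cdot> z = \<zero>"
  shows "\<exists>q. frobenius_exponent R q"
proof -
  define N :: nat where "N = fact (card (carrier R))"
  have pw: "((\<lambda>z. z [^] p) ^^ k) x = x [^] (p ^ k)" if "x \<in> carrier R" for x k
    by (induction k) (use that in \<open>simp_all add: nat_pow_pow mult.commute\<close>)
  have "(x [^] (p ^ N)) [^] (p ^ N) = x [^] (p ^ N)" if x: "x \<in> carrier R" for x
    using iterate_stable[OF fin x, of "\<lambda>z. z [^] p"] x
    by (auto simp: pw nat_pow_pow power_add N_def)
  moreover have "[(p ^ N)] \<cdot> z = \<zero>" if z: "z \<in> carrier R" for z
  proof -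
    have "N = Suc (N - 1)" by (simp add: N_def)
    then obtain k where "N = Suc k" ..
    then have "[(p ^ N)] \<cdot> z = [(p ^ k)] \<cdot> ([p] \<cdot> z)" using z by (simp add: add.nat_pow_pow)
    then show ?thesis using tors z by simp
  qed
  moreover have "(x \<ominus> y) [^] (p ^ N) = x [^] (p ^ N) \<ominus> y [^] (p ^ N)"
    if [simp]: "x \<in> carrier R" "y \<in> carrier R" and xy: "x \<otimes> y = y \<otimes> x" for x y
  proof -
    have "(x \<ominus> y) \<otimes> y = y \<otimes> (x \<ominus> y)"
      using xy by (simp add: minus_eq l_distr r_distr l_minus r_minus)
    then have "(x \<ominus> y \<oplus> y) [^] (p ^ N) = (x \<ominus> y) [^] (p ^ N) \<oplus> y [^] (p ^ N)"
      by (intro freshman_prime_power[OF p tors]) auto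
    moreover have "x \<ominus> y \<oplus> y = x" by (simp add: minus_eq a_assoc l_neg)
    ultimately have "x [^] (p ^ N) \<ominus> y [^] (p ^ N) = (x \<ominus> y) [^] (p ^ N) \<oplus> y [^] (p ^ N) \<ominus> y [^] (p ^ N)"
      by simp
    also have "\<dots> = (x \<ominus> y) [^] (p ^ N)" by (simp add: minus_eq a_assoc r_neg)
    finally show ?thesis by simp
  qed
  moreover have "0 < p ^ N" using p by (simp add: prime_gt_0_nat)
  ultimately show ?thesis unfolding frobenius_exponent_def by blast
qed

lemma (in field) finite_field_prime_torsion:
  assumes fin: "finite (carrier R)"
  shows "\<exists>p::nat. Factorial_Ring.prime p \<and> (\<forall>x\<in>carrier R. [p] \<cdot> x = \<zero>)"
proof -
  define p where "p = (LEAST m::nat. 0 < m \<and> [m] \<cdot> \<one> = \<zero>)"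
  have "[order (add_monoid R)] \<cdot> \<one> = \<zero>"
    using add.pow_order_eq_1[of \<one>] by simp
  moreover have "0 < order (add_monoid R)"
    using fin by (simp add: order_def card_gt_0_iff) blast
  ultimately have "0 < p \<and> [p] \<cdot> \<one> = \<zero>" unfolding p_def by (metis (mono_tags, lifting) LeastI)
  then have p: "0 < p" "[p] \<cdot> \<one> = \<zero>" by auto
  have min: "[m] \<cdot> \<one> \<noteq> \<zero>" if "0 < m" "m < p" for m :: nat
    using that not_less_Least[of m "\<lambda>m. 0 < m \<and> [m] \<cdot> \<one> = \<zero>"] unfolding p_def by blast
  have "p \<noteq> 1" using p(2) by (metis add.nat_pow_eone one_closed one_not_zero)
  have "Factorial_Ring.prime p"
  proof (rule ccontr)
    assume "\<not> Factorial_Ring.prime p"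
    then obtain a b where ab: "p = a * b" "1 < a" "a < p"
      using p(1) \<open>p \<noteq> 1\<close> by (metis One_nat_def dvdE dvd_pos_nat linorder_neqE_nat nat_dvd_not_less
          nat_neq_iff not_less_eq prime_nat_iff less_one nat_less_le dvd_imp_le)
    then have b: "0 < b" "b < p" using p(1) by (auto intro!: Nat.gr0I)
    have "([a] \<cdot> \<one>) \<otimes> ([b] \<cdot> \<one>) = [a] \<cdot> ([b] \<cdot> \<one>)"
      using add_pow_ldistr[of \<one> "[b] \<cdot> \<one>" a] by simp
    also have "\<dots> = [p] \<cdot> \<one>" unfolding ab(1) by (simp add: add.nat_pow_pow mult.commute)
    finally have "[a] \<cdot> \<one> = \<zero> \<or> [b] \<cdot> \<one> = \<zero>" using p(2) by (intro integral) auto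
    then show False using min[of a] min[OF b] ab by auto
  qed
  moreover have "[p] \<cdot> x = \<zero>" if x: "x \<in> carrier R" for x
    using add_pow_ldistr[of \<one> x p] x p(2) by simp
  ultimately show ?thesis by blast
qed

section \<open>Matrix rings\<close>

definition mat_ring :: "('a, 'm) ring_scheme \<Rightarrow> nat \<Rightarrow> 'a mat ring" where
  "mat_ring R n =
     \<lparr>carrier = carrier (mat_monoid R n), Group.monoid.mult = Group.monoid.mult (mat_monoid R n),
      one = one (mat_monoid R n), Ring.ring.zero = mat n n (\<lambda>_. \<zero>\<^bsub>R\<^esub>),
      Ring.ring.add = (\<lambda>A B. mat n n (\<lambda>ij. A $$ ij \<oplus>\<^bsub>R\<^esub> B $$ ij))\<rparr>"

lemma GL_eq: "GL n R = units_of (mat_ring R n)"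
  unfolding GL_def units_of_def Units_def mat_ring_def by simp

lemma mat_ring_carrier:
  "A \<in> carrier (mat_ring R n) \<longleftrightarrow>
     A \<in> carrier_mat n n \<and> (\<forall>i<n. \<forall>j<n. A $$ (i, j) \<in> carrier R)"
  by (simp add: mat_ring_def mat_monoid_def)

lemma mat_ring_simps:
  "A \<otimes>\<^bsub>mat_ring R n\<^esub> B = mat n n (\<lambda>(i, j). \<Oplus>\<^bsub>R\<^esub>k\<in>{..<n}. A $$ (i, k) \<otimes>\<^bsub>R\<^esub> B $$ (k, j))"
  "A \<oplus>\<^bsub>mat_ring R n\<^esub> B = mat n n (\<lambda>ij. A $$ ij \<oplus>\<^bsub>R\<^esub> B $$ ij)"
  "\<one>\<^bsub>mat_ring R n\<^esub> = mat n n (\<lambda>(i, j). if i = j then \<one>\<^bsub>R\<^esub> else \<zero>\<^bsub>R\<^esub>)"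
  "\<zero>\<^bsub>mat_ring R n\<^esub> = mat n n (\<lambda>_. \<zero>\<^bsub>R\<^esub>)"
  by (simp_all add: mat_ring_def mat_monoid_def)

lemma mat_ring_eqI:
  assumes "A \<in> carrier (mat_ring R n)" "B \<in> carrier (mat_ring R n)"
    and "\<And>i j. i < n \<Longrightarrow> j < n \<Longrightarrow> A $$ (i, j) = B $$ (i, j)"
  shows "A = B"
  using assms by (intro eq_matI) (auto simp: mat_ring_carrier)

lemma mat_in_mat_ring:
  "(\<And>i j. i < n \<Longrightarrow> j < n \<Longrightarrow> f (i, j) \<in> carrier R) \<Longrightarrow> mat n n f \<in> carrier (mat_ring R n)"
  by (simp add: mat_ring_carrier)

lemma mat_ring_mult_entry:
  "i < n \<Longrightarrow> j < n \<Longrightarrow> (A \<otimes>\<^bsub>mat_ring R n\<^esub> B) $$ (i, j) =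
     (\<Oplus>\<^bsub>R\<^esub>k\<in>{..<n}. A $$ (i, k) \<otimes>\<^bsub>R\<^esub> B $$ (k, j))"
  by (simp add: mat_ring_simps(1))

lemma mat_ring_add_entry:
  "i < n \<Longrightarrow> j < n \<Longrightarrow> (A \<oplus>\<^bsub>mat_ring R n\<^esub> B) $$ (i, j) = A $$ (i, j) \<oplus>\<^bsub>R\<^esub> B $$ (i, j)"
  by (simp add: mat_ring_simps(2))

lemma (in ring) mat_ring_is_ring: "ring (mat_ring R n)"
proof (rule ringI)
  let ?M = "mat_ring R n"
  have entry [simp]: "A $$ (i, j) \<in> carrier R"
    if "A \<in> carrier ?M" "i < n" "j < n" for A i j
    using that by (simp add: mat_ring_carrier)
  have mult: "A \<otimes>\<^bsub>?M\<^esub> B \<in> carrier ?M"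
    if "A \<in> carrier ?M" "B \<in> carrier ?M" for A B
    unfolding mat_ring_simps using that by (intro mat_in_mat_ring) (auto intro!: finsum_closed)
  have add: "A \<oplus>\<^bsub>?M\<^esub> B \<in> carrier ?M"
    if "A \<in> carrier ?M" "B \<in> carrier ?M" for A B
    unfolding mat_ring_simps using that by (intro mat_in_mat_ring) auto
  have zero: "\<zero>\<^bsub>?M\<^esub> \<in> carrier ?M"
    and one: "\<one>\<^bsub>?M\<^esub> \<in> carrier ?M"
    unfolding mat_ring_simps by (intro mat_in_mat_ring; simp)+
  show "abelian_group (mat_ring R n)"
  proof (rule abelian_groupI)
    fix A assume A: "A \<in> carrier ?M"
    have B: "mat n n (\<lambda>ij. \<ominus> A $$ ij) \<in> carrier ?M"
      using A by (intro mat_in_mat_ring) simp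
    have "mat n n (\<lambda>ij. \<ominus> A $$ ij) \<oplus>\<^bsub>?M\<^esub> A = \<zero>\<^bsub>?M\<^esub>"
      using add[OF B A] zero A by (intro mat_ring_eqI[of _ R n]) (auto simp: mat_ring_simps l_neg)
    with B show "\<exists>B\<in>carrier ?M. B \<oplus>\<^bsub>?M\<^esub> A = \<zero>\<^bsub>?M\<^esub>" by blast
    show "\<zero>\<^bsub>?M\<^esub> \<oplus>\<^bsub>?M\<^esub> A = A"
      using add[OF zero A] A by (intro mat_ring_eqI[of _ R n]) (auto simp: mat_ring_simps)
    fix B assume B: "B \<in> carrier ?M"
    show "A \<oplus>\<^bsub>?M\<^esub> B = B \<oplus>\<^bsub>?M\<^esub> A"
      using add A B by (intro mat_ring_eqI[of _ R n]) (auto simp: mat_ring_simps a_comm)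
    fix C assume C: "C \<in> carrier ?M"
    show "A \<oplus>\<^bsub>?M\<^esub> B \<oplus>\<^bsub>?M\<^esub> C = A \<oplus>\<^bsub>?M\<^esub> (B \<oplus>\<^bsub>?M\<^esub> C)"
      using add A B C by (intro mat_ring_eqI[of _ R n]) (auto simp: mat_ring_simps a_assoc)
  qed (use add zero in auto)
  show "monoid (mat_ring R n)"
  proof (rule monoidI)
    fix A assume A: "A \<in> carrier ?M"
    show "\<one>\<^bsub>?M\<^esub> \<otimes>\<^bsub>?M\<^esub> A = A"
    proof (rule mat_ring_eqI[OF mult[OF one A] A])
      fix i j assume ij: "i < n" "j < n"
      have "(\<Oplus>k\<in>{..<n}. \<one>\<^bsub>?M\<^esub> $$ (i, k) \<otimes> A $$ (k, j)) =
          (\<Oplus>k\<in>{..<n}. if i = k then A $$ (k, j) else \<zero>)"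
        using A ij by (intro finsum_cong') (auto simp: mat_ring_simps(3))
      also have "\<dots> = A $$ (i, j)" using A ij by (intro finsum_singleton) auto
      finally show "(\<one>\<^bsub>?M\<^esub> \<otimes>\<^bsub>?M\<^esub> A) $$ (i, j) = A $$ (i, j)"
        using ij by (simp only: mat_ring_mult_entry mat_ring_add_entry)
    qed
    show "A \<otimes>\<^bsub>?M\<^esub> \<one>\<^bsub>?M\<^esub> = A"
    proof (rule mat_ring_eqI[OF mult[OF A one] A])
      fix i j assume ij: "i < n" "j < n"
      have "(\<Oplus>k\<in>{..<n}. A $$ (i, k) \<otimes> \<one>\<^bsub>?M\<^esub> $$ (k, j)) =
          (\<Oplus>k\<in>{..<n}. if j = k then A $$ (i, k) else \<zero>)"
        using A ij by (intro finsum_cong') (auto simp: mat_ring_simps(3))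
      also have "\<dots> = A $$ (i, j)" using A ij by (intro finsum_singleton) auto
      finally show "(A \<otimes>\<^bsub>?M\<^esub> \<one>\<^bsub>?M\<^esub>) $$ (i, j) = A $$ (i, j)"
        using ij by (simp only: mat_ring_mult_entry mat_ring_add_entry)
    qed
    fix B C assume B: "B \<in> carrier ?M" and C: "C \<in> carrier ?M"
    show "A \<otimes>\<^bsub>?M\<^esub> B \<otimes>\<^bsub>?M\<^esub> C = A \<otimes>\<^bsub>?M\<^esub> (B \<otimes>\<^bsub>?M\<^esub> C)"
    proof (rule mat_ring_eqI[OF mult[OF mult[OF A B] C] mult[OF A mult[OF B C]]])
      fix i j assume ij: "i < n" "j < n"
      have "(\<Oplus>k\<in>{..<n}. (A \<otimes>\<^bsub>?M\<^esub> B) $$ (i, k) \<otimes> C $$ (k, j)) =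
        (\<Oplus>k\<in>{..<n}. \<Oplus>l\<in>{..<n}. A $$ (i, l) \<otimes> (B $$ (l, k) \<otimes> C $$ (k, j)))"
        using A B C ij
        by (intro finsum_cong' refl, simp, simp add: mat_ring_mult_entry, subst finsum_ldistr)
          (auto simp: m_assoc intro!: finsum_cong')
      also have "\<dots> = (\<Oplus>l\<in>{..<n}. \<Oplus>k\<in>{..<n}. A $$ (i, l) \<otimes> (B $$ (l, k) \<otimes> C $$ (k, j)))"
        using A B C ij by (intro finsum_finsum_swap) auto
      also have "\<dots> = (\<Oplus>l\<in>{..<n}. A $$ (i, l) \<otimes> (B \<otimes>\<^bsub>?M\<^esub> C) $$ (l, j))"
        using A B C ij
        by (intro finsum_cong' refl, simp add: mult, simp add: mat_ring_mult_entry, subst finsum_rdistr) auto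
      finally show "(A \<otimes>\<^bsub>?M\<^esub> B \<otimes>\<^bsub>?M\<^esub> C) $$ (i, j) =
          (A \<otimes>\<^bsub>?M\<^esub> (B \<otimes>\<^bsub>?M\<^esub> C)) $$ (i, j)"
        using ij by (simp only: mat_ring_mult_entry mat_ring_add_entry)
    qed
  qed (use mult one in auto)
  fix A B C assume A: "A \<in> carrier ?M" and B: "B \<in> carrier ?M"
    and C: "C \<in> carrier ?M"
  show "(A \<oplus>\<^bsub>?M\<^esub> B) \<otimes>\<^bsub>?M\<^esub> C =
      A \<otimes>\<^bsub>?M\<^esub> C \<oplus>\<^bsub>?M\<^esub> B \<otimes>\<^bsub>?M\<^esub> C"
  proof (rule mat_ring_eqI[OF mult[OF add[OF A B] C] add[OF mult[OF A C] mult[OF B C]]])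
    fix i j assume ij: "i < n" "j < n"
    have "(\<Oplus>k\<in>{..<n}. (A \<oplus>\<^bsub>?M\<^esub> B) $$ (i, k) \<otimes> C $$ (k, j)) =
       (\<Oplus>k\<in>{..<n}. A $$ (i, k) \<otimes> C $$ (k, j) \<oplus> B $$ (i, k) \<otimes> C $$ (k, j))"
      using A B C ij by (intro finsum_cong') (auto simp: l_distr mat_ring_add_entry)
    also have "\<dots> = (\<Oplus>k\<in>{..<n}. A $$ (i, k) \<otimes> C $$ (k, j)) \<oplus> (\<Oplus>k\<in>{..<n}. B $$ (i, k) \<otimes> C $$ (k, j))"
      using A B C ij by (intro finsum_addf) auto
    finally show "((A \<oplus>\<^bsub>?M\<^esub> B) \<otimes>\<^bsub>?M\<^esub> C) $$ (i, j) =
        (A \<otimes>\<^bsub>?M\<^esub> C \<oplus>\<^bsub>?M\<^esub> B \<otimes>\<^bsub>?M\<^esub> C) $$ (i, j)"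
      using ij by (simp only: mat_ring_mult_entry mat_ring_add_entry)
  qed
  show "C \<otimes>\<^bsub>?M\<^esub> (A \<oplus>\<^bsub>?M\<^esub> B) =
      C \<otimes>\<^bsub>?M\<^esub> A \<oplus>\<^bsub>?M\<^esub> C \<otimes>\<^bsub>?M\<^esub> B"
  proof (rule mat_ring_eqI[OF mult[OF C add[OF A B]] add[OF mult[OF C A] mult[OF C B]]])
    fix i j assume ij: "i < n" "j < n"
    have "(\<Oplus>k\<in>{..<n}. C $$ (i, k) \<otimes> (A \<oplus>\<^bsub>?M\<^esub> B) $$ (k, j)) =
       (\<Oplus>k\<in>{..<n}. C $$ (i, k) \<otimes> A $$ (k, j) \<oplus> C $$ (i, k) \<otimes> B $$ (k, j))"
      using A B C ij by (intro finsum_cong') (auto simp: r_distr mat_ring_add_entry)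
    also have "\<dots> = (\<Oplus>k\<in>{..<n}. C $$ (i, k) \<otimes> A $$ (k, j)) \<oplus> (\<Oplus>k\<in>{..<n}. C $$ (i, k) \<otimes> B $$ (k, j))"
      using A B C ij by (intro finsum_addf) auto
    finally show "(C \<otimes>\<^bsub>?M\<^esub> (A \<oplus>\<^bsub>?M\<^esub> B)) $$ (i, j) =
        (C \<otimes>\<^bsub>?M\<^esub> A \<oplus>\<^bsub>?M\<^esub> C \<otimes>\<^bsub>?M\<^esub> B) $$ (i, j)"
      using ij by (simp only: mat_ring_mult_entry mat_ring_add_entry)
  qed
qed

lemma (in ring) mat_ring_minus_entry:
  assumes A: "A \<in> carrier (mat_ring R n)" and B: "B \<in> carrier (mat_ring R n)" and ij: "i < n" "j < n"
  shows "(A \<ominus>\<^bsub>mat_ring R n\<^esub> B) $$ (i, j) = A $$ (i, j) \<ominus> B $$ (i, j)"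
proof -
  interpret M: ring "mat_ring R n" by (rule mat_ring_is_ring)
  let ?D = "A \<ominus>\<^bsub>mat_ring R n\<^esub> B"
  have D: "?D \<in> carrier (mat_ring R n)" using A B by simp
  have c: "A $$ (i, j) \<in> carrier R" "B $$ (i, j) \<in> carrier R" "?D $$ (i, j) \<in> carrier R"
    using A B D ij by (simp_all add: mat_ring_carrier)
  have "?D \<oplus>\<^bsub>mat_ring R n\<^esub> B = A" using A B by (simp add: M.minus_eq M.a_assoc M.l_neg)
  then have "A $$ (i, j) = ?D $$ (i, j) \<oplus> B $$ (i, j)"
    using mat_ring_add_entry[OF ij, of R ?D B] by simp
  then show ?thesis using c by (simp add: minus_eq a_assoc r_neg)
qed

lemma (in ring) mat_ring_add_pow_entry:
  assumes A: "A \<in> carrier (mat_ring R n)" and ij: "i < n" "j < n"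
  shows "([(k::nat)] \<cdot>\<^bsub>mat_ring R n\<^esub> A) $$ (i, j) = [k] \<cdot> A $$ (i, j)"
proof -
  interpret M: ring "mat_ring R n" by (rule mat_ring_is_ring)
  show ?thesis by (induction k) (use ij in \<open>simp_all add: mat_ring_simps\<close>)
qed

lemma finite_mat_ring:
  assumes "finite (carrier R)" shows "finite (carrier (mat_ring R n))"
proof -
  have "carrier (mat_ring R n) \<subseteq> mat n n ` (({..<n} \<times> {..<n}) \<rightarrow>\<^sub>E carrier R)"
  proof
    fix A assume A: "A \<in> carrier (mat_ring R n)"
    have "A = mat n n (restrict (($$) A) ({..<n} \<times> {..<n}))"
      using A by (intro eq_matI) (auto simp: mat_ring_carrier)
    moreover have "restrict (($$) A) ({..<n} \<times> {..<n}) \<in> ({..<n} \<times> {..<n}) \<rightarrow>\<^sub>E carrier R"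
      using A by (auto simp: mat_ring_carrier)
    ultimately show "A \<in> mat n n ` (({..<n} \<times> {..<n}) \<rightarrow>\<^sub>E carrier R)" by blast
  qed
  then show ?thesis using assms by (meson finite_PiE finite_SigmaI finite_imageI finite_lessThan finite_subset)
qed

text \<open>Kaplansky's lemma: with \<open>b = a - a y a = a (1 - y a) = (1 - a y) a\<close>, substitute \<open>b = b z b\<close> in
\<open>a = a y a + b\<close>.\<close>

lemma (in ring) inner_inverse_of_reduced:
  assumes a: "a \<in> carrier R" and y: "y \<in> carrier R" and z: "z \<in> carrier R"
    and b: "b = a \<ominus> a \<otimes> y \<otimes> a" and bzb: "b \<otimes> z \<otimes> b = b"
  shows "\<exists>x\<in>carrier R. a \<otimes> x \<otimes> a = a"
proof -
  note [simp] = a y z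
  have bc [simp]: "b \<in> carrier R" by (simp add: b)
  let ?x = "y \<oplus> (\<one> \<ominus> y \<otimes> a) \<otimes> z \<otimes> (\<one> \<ominus> a \<otimes> y)"
  have b1: "a \<otimes> (\<one> \<ominus> y \<otimes> a) = b" "(\<one> \<ominus> a \<otimes> y) \<otimes> a = b"
    by (simp_all add: b minus_eq r_distr l_distr r_minus l_minus m_assoc)
  have "a \<otimes> ?x \<otimes> a = a \<otimes> y \<otimes> a \<oplus> (a \<otimes> (\<one> \<ominus> y \<otimes> a)) \<otimes> z \<otimes> ((\<one> \<ominus> a \<otimes> y) \<otimes> a)"
    by (simp add: r_distr l_distr m_assoc)
  also have "\<dots> = a \<otimes> y \<otimes> a \<oplus> b" unfolding b1 bzb ..
  also have "\<dots> = a" unfolding b by (simp add: minus_eq a_lcomm r_neg)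
  finally show ?thesis by (intro bexI[of _ ?x]) auto
qed

text \<open>Clearing the row of a pivot subtracts a matrix of the form \<open>A Y A\<close> from \<open>A\<close>, with \<open>Y\<close> a multiple of a
matrix unit, and creates no new nonzero rows.  By Kaplansky's lemma one can induct on the number of
nonzero rows.\<close>

lemma (in field) mat_ring_von_neumann_regular: "von_neumann_regular (mat_ring R n)"
proof -
  let ?M = "mat_ring R n"
  interpret M: ring "mat_ring R n" by (rule mat_ring_is_ring)
  have "\<exists>W\<in>carrier ?M. A \<otimes>\<^bsub>?M\<^esub> W \<otimes>\<^bsub>?M\<^esub> A = A"
    if "A \<in> carrier ?M" for A
    using that
  proof (induction "card {i. i < n \<and> (\<exists>j<n. A $$ (i, j) \<noteq> \<zero>)}" arbitrary: A rule: less_induct)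
    case less
    note A = less.prems
    have Ae [simp]: "A $$ (i, j) \<in> carrier R" if "i < n" "j < n" for i j
      using that A by (simp add: mat_ring_carrier)
    show ?case
    proof (cases "\<exists>r<n. \<exists>c<n. A $$ (r, c) \<noteq> \<zero>")
      case False
      then have "A = \<zero>\<^bsub>?M\<^esub>"
        using A M.zero_closed by (intro mat_ring_eqI[of _ R n]) (auto simp: mat_ring_simps)
      then show ?thesis by (intro bexI[of _ "\<zero>\<^bsub>?M\<^esub>"]) auto
    next
      case True
      then obtain r c where rc [simp]: "r < n" "c < n" and nz: "A $$ (r, c) \<noteq> \<zero>" by blast
      define d where "d = inv (A $$ (r, c))"
      have u: "A $$ (r, c) \<in> Units R" using nz by (simp add: field_Units)
      have d [simp]: "d \<in> carrier R" and dA: "A $$ (r, c) \<otimes> d = \<one>" using u by (simp_all add: d_def)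
      define Y where "Y = mat n n (\<lambda>(i, j). if c = i then (if r = j then d else \<zero>) else \<zero>)"
      have Y: "Y \<in> carrier ?M" unfolding Y_def by (intro mat_in_mat_ring) simp
      have AY: "(A \<otimes>\<^bsub>?M\<^esub> Y) $$ (i, j) = (if r = j then A $$ (i, c) \<otimes> d else \<zero>)"
        if ij: "i < n" "j < n" for i j
      proof -
        have "(\<Oplus>k\<in>{..<n}. A $$ (i, k) \<otimes> Y $$ (k, j)) =
           (\<Oplus>k\<in>{..<n}. if c = k then (A $$ (i, k) \<otimes> (if r = j then d else \<zero>)) else \<zero>)"
          using ij by (intro finsum_cong') (auto simp: Y_def)
        also have "\<dots> = A $$ (i, c) \<otimes> (if r = j then d else \<zero>)"
          using ij by (intro finsum_singleton) auto
        finally show ?thesis using ij by (cases "r = j") (simp_all add: mat_ring_mult_entry)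
      qed
      have AYA: "(A \<otimes>\<^bsub>?M\<^esub> Y \<otimes>\<^bsub>?M\<^esub> A) $$ (i, j) = A $$ (i, c) \<otimes> d \<otimes> A $$ (r, j)"
        if ij: "i < n" "j < n" for i j
      proof -
        have "(\<Oplus>k\<in>{..<n}. (A \<otimes>\<^bsub>?M\<^esub> Y) $$ (i, k) \<otimes> A $$ (k, j)) =
           (\<Oplus>k\<in>{..<n}. if r = k then (A $$ (i, c) \<otimes> d \<otimes> A $$ (k, j)) else \<zero>)"
          using ij by (intro finsum_cong') (auto simp: AY)
        also have "\<dots> = A $$ (i, c) \<otimes> d \<otimes> A $$ (r, j)"
          using ij by (intro finsum_singleton) auto
        finally show ?thesis using ij by (simp only: mat_ring_mult_entry)
      qed
      define B where "B = A \<ominus>\<^bsub>?M\<^esub> A \<otimes>\<^bsub>?M\<^esub> Y \<otimes>\<^bsub>?M\<^esub> A"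
      have B: "B \<in> carrier ?M" using A Y by (simp add: B_def)
      have Be: "B $$ (i, j) = A $$ (i, j) \<ominus> A $$ (i, c) \<otimes> d \<otimes> A $$ (r, j)" if "i < n" "j < n" for i j
        using that A Y unfolding B_def by (subst mat_ring_minus_entry) (simp_all add: AYA)
      have "{i. i < n \<and> (\<exists>j<n. B $$ (i, j) \<noteq> \<zero>)} \<subset> {i. i < n \<and> (\<exists>j<n. A $$ (i, j) \<noteq> \<zero>)}"
      proof
        show "{i. i < n \<and> (\<exists>j<n. B $$ (i, j) \<noteq> \<zero>)} \<subseteq> {i. i < n \<and> (\<exists>j<n. A $$ (i, j) \<noteq> \<zero>)}"
        proof (intro subsetI CollectI conjI; elim CollectE conjE exE)
          fix i j assume ij: "i < n" "j < n" and nzB: "B $$ (i, j) \<noteq> \<zero>"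
          show "\<exists>j<n. A $$ (i, j) \<noteq> \<zero>"
          proof (rule ccontr)
            assume "\<not> (\<exists>j<n. A $$ (i, j) \<noteq> \<zero>)"
            then have "A $$ (i, j) = \<zero>" "A $$ (i, c) = \<zero>" using ij by auto
            then show False using nzB ij by (simp add: Be minus_eq)
          qed
        qed
        have "B $$ (r, j) = \<zero>" if "j < n" for j
          using that by (simp add: Be dA minus_eq r_neg)
        then have "r \<notin> {i. i < n \<and> (\<exists>j<n. B $$ (i, j) \<noteq> \<zero>)}" by simp
        moreover have "r \<in> {i. i < n \<and> (\<exists>j<n. A $$ (i, j) \<noteq> \<zero>)}" using nz rc by blast
        ultimately show "{i. i < n \<and> (\<exists>j<n. B $$ (i, j) \<noteq> \<zero>)} \<noteq> {i. i < n \<and> (\<exists>j<n. A $$ (i, j) \<noteq> \<zero>)}"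
          by blast
      qed
      then have "card {i. i < n \<and> (\<exists>j<n. B $$ (i, j) \<noteq> \<zero>)} < card {i. i < n \<and> (\<exists>j<n. A $$ (i, j) \<noteq> \<zero>)}"
        by (intro psubset_card_mono) auto
      then obtain Z where Z: "Z \<in> carrier ?M" "B \<otimes>\<^bsub>?M\<^esub> Z \<otimes>\<^bsub>?M\<^esub> B = B"
        using less.hyps B by blast
      show ?thesis by (rule M.inner_inverse_of_reduced[OF A Y Z(1) B_def Z(2)])
    qed
  qed
  then show ?thesis by (simp add: von_neumann_regular_def)
qed

lemma additive_finsum:
  assumes "abelian_group R" "abelian_group S" "finite I" "g \<in> I \<rightarrow> carrier R"
    and closed: "\<And>x. x \<in> carrier R \<Longrightarrow> h x \<in> carrier S"
    and add: "\<And>x y. x \<in> carrier R \<Longrightarrow> y \<in> carrier R \<Longrightarrow> h (x \<oplus>\<^bsub>R\<^esub> y) = h x \<oplus>\<^bsub>S\<^esub> h y"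
  shows "h (finsum R g I) = finsum S (\<lambda>i. h (g i)) I"
proof -
  interpret R: abelian_group R by fact
  interpret S: abelian_group S by fact
  have "h \<zero>\<^bsub>R\<^esub> \<oplus>\<^bsub>S\<^esub> h \<zero>\<^bsub>R\<^esub> = h \<zero>\<^bsub>R\<^esub>" using add[of "\<zero>\<^bsub>R\<^esub>" "\<zero>\<^bsub>R\<^esub>"] by simp
  then have h0: "h \<zero>\<^bsub>R\<^esub> = \<zero>\<^bsub>S\<^esub>"
    using closed[of "\<zero>\<^bsub>R\<^esub>"] S.add.l_cancel_one' by (metis R.zero_closed)
  show ?thesis using assms(3,4)
  proof (induction I rule: finite_induct)
    case empty
    then show ?case by (simp add: h0)
  next
    case (insert i I)
    then have "g i \<in> carrier R" "g \<in> I \<rightarrow> carrier R" by auto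
    with insert show ?case by (simp add: add closed Pi_def)
  qed
qed

lemma map_mat_closed:
  assumes "A \<in> carrier (mat_ring R n)" "\<And>x. x \<in> carrier R \<Longrightarrow> h x \<in> carrier S"
  shows "map_mat h A \<in> carrier (mat_ring S n)"
  using assms by (auto simp: mat_ring_carrier)

lemma map_mat_entry:
  assumes "A \<in> carrier (mat_ring R n)" "i < n" "j < n"
  shows "map_mat h A $$ (i, j) = h (A $$ (i, j))"
  using assms by (auto simp: mat_ring_carrier)

lemma map_mat_add:
  assumes "ring R" "ring S" "A \<in> carrier (mat_ring R n)" "B \<in> carrier (mat_ring R n)"
    and closed: "\<And>x. x \<in> carrier R \<Longrightarrow> h x \<in> carrier S"
    and add: "\<And>x y. x \<in> carrier R \<Longrightarrow> y \<in> carrier R \<Longrightarrow> h (x \<oplus>\<^bsub>R\<^esub> y) = h x \<oplus>\<^bsub>S\<^esub> h y"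
  shows "map_mat h (A \<oplus>\<^bsub>mat_ring R n\<^esub> B) = map_mat h A \<oplus>\<^bsub>mat_ring S n\<^esub> map_mat h B"
  using assms(3,4) by (intro eq_matI) (auto simp: mat_ring_simps mat_ring_carrier add)

text \<open>The factors \<open>C\<close> and \<open>D\<close> are arbitrary subject to the entrywise condition, so that one lemma covers
both ring homomorphisms and the two module actions on a square-zero ideal.\<close>

lemma map_mat_product:
  assumes "ring R" "ring S" "ring T"
    and A: "A \<in> carrier (mat_ring R n)" and B: "B \<in> carrier (mat_ring R n)"
    and h: "\<And>x. x \<in> carrier R \<Longrightarrow> h x \<in> carrier S"
      "\<And>x y. x \<in> carrier R \<Longrightarrow> y \<in> carrier R \<Longrightarrow> h (x \<oplus>\<^bsub>R\<^esub> y) = h x \<oplus>\<^bsub>S\<^esub> h y"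
    and C: "C \<in> carrier (mat_ring S n)" and D: "D \<in> carrier (mat_ring S n)"
    and prod: "\<And>i j k. i < n \<Longrightarrow> j < n \<Longrightarrow> k < n \<Longrightarrow>
      h (A $$ (i, k) \<otimes>\<^bsub>R\<^esub> B $$ (k, j)) = C $$ (i, k) \<otimes>\<^bsub>S\<^esub> D $$ (k, j)"
  shows "map_mat h (A \<otimes>\<^bsub>mat_ring R n\<^esub> B) = C \<otimes>\<^bsub>mat_ring S n\<^esub> D"
proof -
  interpret R: ring R by fact
  interpret S: ring S by fact
  show ?thesis
  proof (intro eq_matI)
    fix i j assume "i < dim_row (C \<otimes>\<^bsub>mat_ring S n\<^esub> D)" "j < dim_col (C \<otimes>\<^bsub>mat_ring S n\<^esub> D)"
    then have ij: "i < n" "j < n" by (simp_all add: mat_ring_simps)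
    have AB: "(\<lambda>k. A $$ (i, k) \<otimes>\<^bsub>R\<^esub> B $$ (k, j)) \<in> {..<n} \<rightarrow> carrier R"
      using A B ij by (auto simp: mat_ring_carrier)
    have "h (\<Oplus>\<^bsub>R\<^esub>k\<in>{..<n}. A $$ (i, k) \<otimes>\<^bsub>R\<^esub> B $$ (k, j)) =
        (\<Oplus>\<^bsub>S\<^esub>k\<in>{..<n}. h (A $$ (i, k) \<otimes>\<^bsub>R\<^esub> B $$ (k, j)))"
      by (rule additive_finsum[OF R.is_abelian_group S.is_abelian_group _ AB h]) simp_all
    also have "\<dots> = (\<Oplus>\<^bsub>S\<^esub>k\<in>{..<n}. C $$ (i, k) \<otimes>\<^bsub>S\<^esub> D $$ (k, j))"
      using C D ij by (intro S.finsum_cong') (auto simp: prod mat_ring_carrier)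
    finally show "map_mat h (A \<otimes>\<^bsub>mat_ring R n\<^esub> B) $$ (i, j) = (C \<otimes>\<^bsub>mat_ring S n\<^esub> D) $$ (i, j)"
      using ij by (simp add: mat_ring_simps)
  qed (auto simp: mat_ring_simps)
qed

lemma map_mat_ring_hom:
  assumes R: "ring R" and S: "ring S" and h: "h \<in> Ring.ring_hom R S"
  shows "map_mat h \<in> Ring.ring_hom (mat_ring R n) (mat_ring S n)"
proof (rule ring_hom_memI)
  fix A B assume A: "A \<in> carrier (mat_ring R n)" and B: "B \<in> carrier (mat_ring R n)"
  show "map_mat h A \<in> carrier (mat_ring S n)" using A h by (auto intro: map_mat_closed ring_hom_closed)
  show "map_mat h (A \<oplus>\<^bsub>mat_ring R n\<^esub> B) = map_mat h A \<oplus>\<^bsub>mat_ring S n\<^esub> map_mat h B"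
    using h by (intro map_mat_add[OF R S A B]) (auto simp: ring_hom_closed ring_hom_add)
  show "map_mat h (A \<otimes>\<^bsub>mat_ring R n\<^esub> B) = map_mat h A \<otimes>\<^bsub>mat_ring S n\<^esub> map_mat h B"
    using h A B by (intro map_mat_product[OF R S S A B])
      (auto simp: ring_hom_closed ring_hom_add ring_hom_mult map_mat_entry[OF A] map_mat_entry[OF B]
        mat_ring_carrier)
next
  interpret ring_hom_ring R S h using R S h by (rule ring_hom_ringI2)
  show "map_mat h \<one>\<^bsub>mat_ring R n\<^esub> = \<one>\<^bsub>mat_ring S n\<^esub>"
    by (intro eq_matI) (auto simp: mat_ring_simps)
qed

lemma map_mat_image:
  assumes "h ` carrier R = B" "B = carrier S"
  shows "map_mat h ` carrier (mat_ring R n) = carrier (mat_ring S n)"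
proof
  show "map_mat h ` carrier (mat_ring R n) \<subseteq> carrier (mat_ring S n)"
    using assms by (auto intro!: map_mat_closed)
  show "carrier (mat_ring S n) \<subseteq> map_mat h ` carrier (mat_ring R n)"
  proof
    fix A assume A: "A \<in> carrier (mat_ring S n)"
    define C where "C = mat n n (\<lambda>ij. inv_into (carrier R) h (A $$ ij))"
    have e: "A $$ (i, j) \<in> h ` carrier R" if "i < n" "j < n" for i j
      using that A assms by (simp add: mat_ring_carrier)
    have "C \<in> carrier (mat_ring R n)" unfolding C_def using e
      by (intro mat_in_mat_ring) (simp add: inv_into_into)
    moreover have "map_mat h C = A"
      using A e by (intro eq_matI) (auto simp: C_def mat_ring_carrier f_inv_into_f)
    ultimately show "A \<in> map_mat h ` carrier (mat_ring R n)" by blast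
  qed
qed

lemma map_mat_inj_on:
  assumes "inj_on h (carrier R)"
  shows "inj_on (map_mat h) (carrier (mat_ring R n))"
proof (rule inj_onI)
  fix A B assume A: "A \<in> carrier (mat_ring R n)" and B: "B \<in> carrier (mat_ring R n)"
    and eq: "map_mat h A = map_mat h B"
  show "A = B"
  proof (rule mat_ring_eqI[OF A B])
    fix i j assume ij: "i < n" "j < n"
    then have "h (A $$ (i, j)) = h (B $$ (i, j))" using eq map_mat_entry[OF A] map_mat_entry[OF B] by metis
    then show "A $$ (i, j) = B $$ (i, j)"
      using assms A B ij by (auto simp: mat_ring_carrier dest: inj_onD)
  qed
qed

lemma map_mat_ring_iso:
  assumes "ring R" "ring S" "h \<in> ring_iso R S"
  shows "map_mat h \<in> ring_iso (mat_ring R n) (mat_ring S n)"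
  using assms map_mat_ring_hom[of R S h n] map_mat_image[of h R _ S n] map_mat_inj_on[of h R n]
  by (auto simp: ring_iso_def bij_betw_def)

lemma mat_square_zero_extension:
  assumes "square_zero_extension E F \<rho> \<iota>"
  shows "square_zero_extension (mat_ring E n) (mat_ring F n) (map_mat \<rho>) (map_mat \<iota>)"
proof -
  interpret square_zero_extension E F \<rho> \<iota> by fact
  have hom: "map_mat \<rho> \<in> Ring.ring_hom (mat_ring E n) (mat_ring F n)"
    by (rule map_mat_ring_hom[OF R.ring_axioms S.ring_axioms homh])
  interpret H: ring_hom_ring "mat_ring E n" "mat_ring F n" "map_mat \<rho>"
    using R.mat_ring_is_ring S.mat_ring_is_ring hom by (rule ring_hom_ringI2)
  show ?thesis
  proof unfold_locales
    show "map_mat \<rho> ` carrier (mat_ring E n) = carrier (mat_ring F n)"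
      using rho_surj by (rule map_mat_image) simp
    show "inj_on (map_mat \<iota>) (carrier (mat_ring F n))" by (rule map_mat_inj_on[OF iota_inj])
    fix W assume W: "W \<in> carrier (mat_ring F n)"
    show iX: "map_mat \<iota> W \<in> carrier (mat_ring E n)" using W by (rule map_mat_closed) simp
    fix Y assume Y: "Y \<in> carrier (mat_ring F n)"
    show "map_mat \<iota> (W \<oplus>\<^bsub>mat_ring F n\<^esub> Y) = map_mat \<iota> W \<oplus>\<^bsub>mat_ring E n\<^esub> map_mat \<iota> Y"
      using iota_add by (intro map_mat_add[OF S.ring_axioms R.ring_axioms W Y]) auto
  next
    fix A W assume A: "A \<in> carrier (mat_ring E n)" and W: "W \<in> carrier (mat_ring F n)"
    have rA: "map_mat \<rho> A \<in> carrier (mat_ring F n)" and iX: "map_mat \<iota> W \<in> carrier (mat_ring E n)"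
      using A W by (auto intro: map_mat_closed)
    have e: "A $$ (i, j) \<in> carrier E" "W $$ (i, j) \<in> carrier F" if "i < n" "j < n" for i j
      using that A W by (simp_all add: mat_ring_carrier)
    show "A \<otimes>\<^bsub>mat_ring E n\<^esub> map_mat \<iota> W = map_mat \<iota> (map_mat \<rho> A \<otimes>\<^bsub>mat_ring F n\<^esub> W)"
      by (rule map_mat_product[OF S.ring_axioms R.ring_axioms R.ring_axioms rA W _ _ A iX, symmetric])
        (auto simp: iota_add map_mat_entry[OF A] map_mat_entry[OF W] l_iota e)
    show "map_mat \<iota> W \<otimes>\<^bsub>mat_ring E n\<^esub> A = map_mat \<iota> (W \<otimes>\<^bsub>mat_ring F n\<^esub> map_mat \<rho> A)"
      by (rule map_mat_product[OF S.ring_axioms R.ring_axioms R.ring_axioms W rA _ _ iX A, symmetric])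
        (auto simp: iota_add map_mat_entry[OF A] map_mat_entry[OF W] r_iota e)
  next
    show "{W \<in> carrier (mat_ring E n). map_mat \<rho> W = \<zero>\<^bsub>mat_ring F n\<^esub>} = map_mat \<iota> ` carrier (mat_ring F n)"
      (is "?L = ?R")
    proof
      show "?R \<subseteq> ?L"
      proof
        fix W assume "W \<in> ?R"
        then obtain Y where Y: "Y \<in> carrier (mat_ring F n)" "W = map_mat \<iota> Y" by blast
        have W: "W \<in> carrier (mat_ring E n)" unfolding Y(2) using Y(1) by (rule map_mat_closed) simp
        moreover have "map_mat \<rho> W = \<zero>\<^bsub>mat_ring F n\<^esub>"
          using Y by (intro eq_matI) (auto simp: mat_ring_simps mat_ring_carrier)
        ultimately show "W \<in> ?L" by simp
      qed
      show "?L \<subseteq> ?R"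
      proof
        fix W assume "W \<in> ?L"
        then have W: "W \<in> carrier (mat_ring E n)" and rX: "map_mat \<rho> W = \<zero>\<^bsub>mat_ring F n\<^esub>" by auto
        define Y where "Y = mat n n (\<lambda>ij. inv_into (carrier F) \<iota> (W $$ ij))"
        have e: "W $$ (i, j) \<in> \<iota> ` carrier F" if "i < n" "j < n" for i j
        proof -
          have "\<rho> (W $$ (i, j)) = \<zero>\<^bsub>F\<^esub>"
            using map_mat_entry[OF W that, of \<rho>] that unfolding rX by (simp add: mat_ring_simps)
          then show ?thesis unfolding kernel_eq[symmetric] using W that by (simp add: mat_ring_carrier)
        qed
        have "Y \<in> carrier (mat_ring F n)" unfolding Y_def using e
          by (intro mat_in_mat_ring) (simp add: inv_into_into)
        moreover have "W = map_mat \<iota> Y"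
          using W e by (intro eq_matI) (auto simp: Y_def mat_ring_carrier f_inv_into_f)
        ultimately show "W \<in> ?R" by blast
      qed
    qed
  qed
qed

section \<open>Discrete valuation rings modulo the square of the maximal ideal\<close>

text \<open>The map on cosets induced by \<open>f\<close>; the union is taken over equal cosets whenever \<open>f\<close> respects
congruence, so no representative has to be chosen.\<close>

definition coset_map :: "('a, 'm) ring_scheme \<Rightarrow> 'a set \<Rightarrow> ('a \<Rightarrow> 'a) \<Rightarrow> 'a set \<Rightarrow> 'a set" where
  "coset_map R J f c = (\<Union>x\<in>c. J +>\<^bsub>R\<^esub> f x)"

lemma (in ring) coset_eq_iff:
  "ideal I R \<Longrightarrow> x \<in> carrier R \<Longrightarrow> y \<in> carrier R \<Longrightarrow> I +> x = I +> y \<longleftrightarrow> x \<ominus> y \<in> I"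
  using quotient_eq_iff_same_a_r_cos by blast

lemma (in ring) coset_mem_iff:
  assumes I: "ideal I R" and x: "x \<in> carrier R"
  shows "y \<in> I +> x \<longleftrightarrow> y \<in> carrier R \<and> y \<ominus> x \<in> I"
proof -
  interpret ideal I R by fact
  show ?thesis
  proof
    assume "y \<in> I +> x"
    then obtain i where i: "i \<in> I" "y = i \<oplus> x" unfolding a_r_coset_def' by blast
    then show "y \<in> carrier R \<and> y \<ominus> x \<in> I" using x Icarr[OF i(1)] by (simp add: minus_eq a_assoc r_neg)
  next
    assume y: "y \<in> carrier R \<and> y \<ominus> x \<in> I"
    then have "y = (y \<ominus> x) \<oplus> x" using x by (simp add: minus_eq a_assoc l_neg)
    then show "y \<in> I +> x" using y unfolding a_r_coset_def' by blast
  qed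
qed

lemma (in ring) coset_map_coset:
  assumes I: "ideal I R" and J: "ideal J R" and x: "x \<in> carrier R"
    and f: "\<And>x. x \<in> carrier R \<Longrightarrow> f x \<in> carrier R"
    and resp: "\<And>x y. x \<in> carrier R \<Longrightarrow> y \<in> carrier R \<Longrightarrow> x \<ominus> y \<in> I \<Longrightarrow> f x \<ominus> f y \<in> J"
  shows "coset_map R J f (I +> x) = J +> f x"
proof -
  have "J +> f y = J +> f x" if "y \<in> I +> x" for y
    using that x f resp by (simp add: coset_mem_iff[OF I] coset_eq_iff[OF J])
  moreover have "x \<in> I +> x"
    using x additive_subgroup.zero_closed[OF ideal.axioms(1)[OF I]] by (simp add: coset_mem_iff[OF I] minus_eq r_neg)
  ultimately show ?thesis unfolding coset_map_def by blast
qed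

lemma quot_carrier: "carrier (R Quot I) = (\<lambda>x. I +>\<^bsub>R\<^esub> x) ` carrier R"
  by (auto simp: FactRing_def A_RCOSETS_def')

text \<open>The description of the maximal ideal by units shows that isomorphisms preserve it.\<close>

locale uniformized_ring = domain R for R :: "'a ring" (structure) +
  fixes p
  assumes maximal: "maximalideal (max_ideal R) R"
    and nonunits: "max_ideal R = carrier R - Units R"
    and p_closed [simp]: "p \<in> carrier R"
    and generated: "max_ideal R = PIdl p"
    and p_nonzero: "p \<noteq> \<zero>"
    and finite_residue: "finite (carrier (residue_field R))"
begin

abbreviation "m \<equiv> max_ideal R"
abbreviation "m2 \<equiv> max_ideal_sq R"

definition reduce where "reduce = coset_map R m (\<lambda>x. x)"
definition embed where "embed = coset_map R m2 (\<lambda>x. p \<otimes> x)"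

lemma m_ideal: "ideal m R" using maximal by (rule maximalideal.axioms)

lemma m2_ideal: "ideal m2 R"
  unfolding max_ideal_sq_def by (rule ideal_prod_is_ideal[OF m_ideal m_ideal])

lemma p_in: "p \<in> m" unfolding generated using p_closed by (rule cgenideal_self)

lemma m_mem: "x \<in> m \<longleftrightarrow> (\<exists>a\<in>carrier R. x = p \<otimes> a)"
  unfolding generated cgenideal_def by (auto simp: m_comm)

text \<open>As \<open>p \<noteq> 0\<close> can be cancelled, this makes multiplication by \<open>p\<close> an isomorphism from the residue
field onto \<open>\<pp> / \<pp>\<^sup>2\<close>.\<close>

lemma m2_mem: "x \<in> m2 \<longleftrightarrow> (\<exists>y\<in>m. x = p \<otimes> y)"
proof
  assume "x \<in> m2"
  then show "\<exists>y\<in>m. x = p \<otimes> y"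
    unfolding max_ideal_sq_def
  proof (induction rule: ideal_prod.induct)
    case (prod i j)
    then obtain a where a: "a \<in> carrier R" "i = p \<otimes> a" using m_mem by blast
    have "a \<otimes> j \<in> m" using m_ideal a prod(2) by (simp add: ideal.I_l_closed)
    moreover have "i \<otimes> j = p \<otimes> (a \<otimes> j)" using a prod ideal.Icarr[OF m_ideal] by (simp add: m_assoc)
    ultimately show ?case by blast
  next
    case (sum s t)
    then obtain y z where yz: "y \<in> m" "z \<in> m" "s = p \<otimes> y" "t = p \<otimes> z" by blast
    then have "y \<oplus> z \<in> m" using m_ideal by (simp add: additive_subgroup.a_closed ideal.axioms(1))
    moreover have "s \<oplus> t = p \<otimes> (y \<oplus> z)" using yz ideal.Icarr[OF m_ideal] by (simp add: r_distr)
    ultimately show ?case by blast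
  qed
next
  assume "\<exists>y\<in>m. x = p \<otimes> y"
  then show "x \<in> m2" unfolding max_ideal_sq_def using p_in by (auto intro: ideal_prod.prod)
qed

lemma p_mult_in_m2_iff: "x \<in> carrier R \<Longrightarrow> p \<otimes> x \<in> m2 \<longleftrightarrow> x \<in> m"
  using m2_mem p_nonzero ideal.Icarr[OF m_ideal] by (auto simp: m_lcancel)

lemma m2_subset: "m2 \<subseteq> m"
  using m2_mem m_mem ideal.Icarr[OF m_ideal] by blast

lemma reduce_coset: "x \<in> carrier R \<Longrightarrow> reduce (m2 +> x) = m +> x"
  unfolding reduce_def using m2_subset by (intro coset_map_coset[OF m2_ideal m_ideal]) auto

lemma embed_coset: "x \<in> carrier R \<Longrightarrow> embed (m +> x) = m2 +> (p \<otimes> x)"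
  unfolding embed_def
proof (intro coset_map_coset[OF m_ideal m2_ideal])
  fix x y assume "x \<in> carrier R" "y \<in> carrier R" "x \<ominus> y \<in> m"
  moreover from this have "p \<otimes> x \<ominus> p \<otimes> y = p \<otimes> (x \<ominus> y)" by (simp add: minus_eq r_distr r_minus)
  ultimately show "p \<otimes> x \<ominus> p \<otimes> y \<in> m2" by (simp add: p_mult_in_m2_iff)
qed auto

lemma residue_is_field: "field (residue_field R)"
  unfolding residue_field_def by (rule maximalideal.quotient_is_field[OF maximal is_cring])

sublocale Q2: ring_hom_ring R "length_two_quot R" "(+>) m2"
  unfolding length_two_quot_def by (rule ideal.rcos_ring_hom_ring[OF m2_ideal])

sublocale Q1: ring_hom_ring R "residue_field R" "(+>) m"
  unfolding residue_field_def by (rule ideal.rcos_ring_hom_ring[OF m_ideal])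

lemma carrier_length_two: "carrier (length_two_quot R) = (\<lambda>x. m2 +> x) ` carrier R"
  unfolding length_two_quot_def by (rule quot_carrier)

lemma carrier_residue: "carrier (residue_field R) = (\<lambda>x. m +> x) ` carrier R"
  unfolding residue_field_def by (rule quot_carrier)

theorem length_two_extension:
  "square_zero_extension (length_two_quot R) (residue_field R) reduce embed"
proof -
  let ?A = "length_two_quot R" and ?k = "residue_field R"
  have hom: "reduce \<in> Ring.ring_hom ?A ?k"
  proof (rule ring_hom_memI)
    fix a b assume "a \<in> carrier ?A" "b \<in> carrier ?A"
    then obtain x y where xy [simp]: "x \<in> carrier R" "y \<in> carrier R" and ab: "a = m2 +> x" "b = m2 +> y"
      unfolding carrier_length_two by blast
    show "reduce a \<in> carrier ?k" by (simp add: ab reduce_coset)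
    have "reduce (a \<otimes>\<^bsub>?A\<^esub> b) = reduce (m2 +> (x \<otimes> y))" by (simp add: ab)
    then show "reduce (a \<otimes>\<^bsub>?A\<^esub> b) = reduce a \<otimes>\<^bsub>?k\<^esub> reduce b"
      by (simp add: ab reduce_coset del: Q2.hom_mult)
    have "reduce (a \<oplus>\<^bsub>?A\<^esub> b) = reduce (m2 +> (x \<oplus> y))" by (simp add: ab)
    then show "reduce (a \<oplus>\<^bsub>?A\<^esub> b) = reduce a \<oplus>\<^bsub>?k\<^esub> reduce b"
      by (simp add: ab reduce_coset del: Q2.hom_add)
  next
    show "reduce \<one>\<^bsub>?A\<^esub> = \<one>\<^bsub>?k\<^esub>"
      using reduce_coset[of \<one>] by simp
  qed
  interpret H: ring_hom_ring ?A ?k reduce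
    using Q2.S.ring_axioms Q1.S.ring_axioms hom by (rule ring_hom_ringI2)
  show ?thesis
  proof unfold_locales
    show "reduce ` carrier ?A = carrier ?k"
      unfolding carrier_length_two carrier_residue image_image by (rule image_cong) (simp_all add: reduce_coset)
    show "inj_on embed (carrier ?k)"
    proof (rule inj_onI)
      fix a b assume "a \<in> carrier ?k" "b \<in> carrier ?k" and eq: "embed a = embed b"
      then obtain x y where xy [simp]: "x \<in> carrier R" "y \<in> carrier R" and ab: "a = m +> x" "b = m +> y"
        unfolding carrier_residue by blast
      have "p \<otimes> x \<ominus> p \<otimes> y \<in> m2" using eq unfolding ab embed_coset[OF xy(1)] embed_coset[OF xy(2)]
        by (subst (asm) coset_eq_iff[OF m2_ideal]) auto
      moreover have "p \<otimes> x \<ominus> p \<otimes> y = p \<otimes> (x \<ominus> y)" by (simp add: minus_eq r_distr r_minus)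
      ultimately show "a = b" by (simp add: ab p_mult_in_m2_iff coset_eq_iff[OF m_ideal])
    qed
    fix a assume "a \<in> carrier ?k"
    then obtain x where x [simp]: "x \<in> carrier R" and a: "a = m +> x" unfolding carrier_residue by blast
    show "embed a \<in> carrier ?A" by (simp add: a embed_coset)
    fix b assume "b \<in> carrier ?k"
    then obtain y where y [simp]: "y \<in> carrier R" and b: "b = m +> y" unfolding carrier_residue by blast
    have "embed (a \<oplus>\<^bsub>?k\<^esub> b) = embed (m +> (x \<oplus> y))" by (simp add: a b)
    also have "\<dots> = m2 +> (p \<otimes> x \<oplus> p \<otimes> y)" by (subst embed_coset) (simp_all add: r_distr)
    finally show "embed (a \<oplus>\<^bsub>?k\<^esub> b) = embed a \<oplus>\<^bsub>?A\<^esub> embed b" by (simp add: a b embed_coset)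
  next
    fix a b assume "a \<in> carrier ?A" "b \<in> carrier ?k"
    then obtain x y where xy [simp]: "x \<in> carrier R" "y \<in> carrier R" and ab: "a = m2 +> x" "b = m +> y"
      unfolding carrier_length_two carrier_residue by blast
    have e: "embed (m +> (x \<otimes> y)) = m2 +> (x \<otimes> (p \<otimes> y))"
      by (subst embed_coset) (simp_all add: m_lcomm)
    have "reduce a \<otimes>\<^bsub>?k\<^esub> b = m +> (x \<otimes> y)" by (simp add: ab reduce_coset)
    then show "a \<otimes>\<^bsub>?A\<^esub> embed b = embed (reduce a \<otimes>\<^bsub>?k\<^esub> b)"
      using e by (simp add: ab embed_coset)
    have "b \<otimes>\<^bsub>?k\<^esub> reduce a = m +> (x \<otimes> y)" using xy by (simp add: ab reduce_coset m_comm[of x y])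
    moreover have "embed b \<otimes>\<^bsub>?A\<^esub> a = m2 +> (p \<otimes> y \<otimes> x)" by (simp add: ab embed_coset)
    moreover have "p \<otimes> y \<otimes> x = x \<otimes> (p \<otimes> y)" using xy by (simp add: m_comm)
    ultimately show "embed b \<otimes>\<^bsub>?A\<^esub> a = embed (b \<otimes>\<^bsub>?k\<^esub> reduce a)" using e by metis
  next
    show "{a \<in> carrier ?A. reduce a = \<zero>\<^bsub>?k\<^esub>} = embed ` carrier ?k"
    proof
      show "embed ` carrier ?k \<subseteq> {a \<in> carrier ?A. reduce a = \<zero>\<^bsub>?k\<^esub>}"
      proof
        fix a assume "a \<in> embed ` carrier ?k"
        then obtain y where y [simp]: "y \<in> carrier R" and a: "a = embed (m +> y)"
          unfolding carrier_residue by blast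
        have a': "a = m2 +> (p \<otimes> y)" unfolding a using y by (rule embed_coset)
        have "p \<otimes> y \<ominus> \<zero> \<in> m" using m_mem by (auto simp: minus_eq)
        then have "m +> (p \<otimes> y) = m +> \<zero>" by (subst coset_eq_iff[OF m_ideal]) auto
        then have "reduce a = \<zero>\<^bsub>?k\<^esub>"
          unfolding a' by (subst reduce_coset) (simp_all del: Q1.hom_mult)
        then show "a \<in> {a \<in> carrier ?A. reduce a = \<zero>\<^bsub>?k\<^esub>}" unfolding a' by simp
      qed
      show "{a \<in> carrier ?A. reduce a = \<zero>\<^bsub>?k\<^esub>} \<subseteq> embed ` carrier ?k"
      proof
        fix a assume a: "a \<in> {a \<in> carrier ?A. reduce a = \<zero>\<^bsub>?k\<^esub>}"
        then obtain x where x [simp]: "x \<in> carrier R" and ax: "a = m2 +> x"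
          unfolding carrier_length_two by blast
        have "m +> x = m +> \<zero>" using a by (simp add: ax reduce_coset)
        then have "x \<ominus> \<zero> \<in> m" by (subst coset_eq_iff[OF m_ideal, symmetric]) auto
        then have "x \<in> m" by (simp add: minus_eq)
        then obtain y where y: "y \<in> carrier R" "x = p \<otimes> y" using m_mem by blast
        then have "a = embed (m +> y)" by (simp add: ax embed_coset)
        then show "a \<in> embed ` carrier ?k" unfolding carrier_residue using y(1) by blast
      qed
    qed
  qed
qed

end

lemma local_integer_ring_uniformized:
  assumes R: "local_integer_ring R" and p: "uniformizer R p"
  shows "uniformized_ring R p"
proof -
  obtain K \<nu> where K: "nonarch_local_field K \<nu>" and RV: "R = valuation_ring K \<nu>"
    using R unfolding local_integer_ring_def by blast
  interpret K: nonarch_local_field K \<nu> by fact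
  interpret V: cring R unfolding RV by (rule K.V_cring)
  have carr: "carrier R = {x \<in> carrier K. x = \<zero>\<^bsub>K\<^esub> \<or> 0 \<le> \<nu> x}"
    and ops: "\<And>x y. x \<otimes>\<^bsub>R\<^esub> y = x \<otimes>\<^bsub>K\<^esub> y" "\<one>\<^bsub>R\<^esub> = \<one>\<^bsub>K\<^esub>" "\<zero>\<^bsub>R\<^esub> = \<zero>\<^bsub>K\<^esub>"
    unfolding RV by (rule K.V_simps)+
  have m: "max_ideal R = {x \<in> carrier K. x = \<zero>\<^bsub>K\<^esub> \<or> 0 < \<nu> x}"
    unfolding RV by (rule K.V_max_ideal(2))
  interpret dom: domain R
  proof
    show "\<one>\<^bsub>R\<^esub> \<noteq> \<zero>\<^bsub>R\<^esub>" by (simp add: ops)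
    fix a b assume "a \<otimes>\<^bsub>R\<^esub> b = \<zero>\<^bsub>R\<^esub>" "a \<in> carrier R" "b \<in> carrier R"
    then show "a = \<zero>\<^bsub>R\<^esub> \<or> b = \<zero>\<^bsub>R\<^esub>" using K.integral by (simp add: ops carr)
  qed
  have max: "maximalideal (max_ideal R) R" by (rule local_integer_ring_maximalideal[OF R])
  have pc: "p \<in> carrier R" and gen: "max_ideal R = PIdl\<^bsub>R\<^esub> p" using p by (auto simp: uniformizer_def)
  show ?thesis
  proof (intro uniformized_ring.intro uniformized_ring_axioms.intro)
    show "domain R" by (rule dom.domain_axioms)
    show "p \<in> carrier R" "max_ideal R = PIdl\<^bsub>R\<^esub> p" "maximalideal (max_ideal R) R" by fact+
    show "finite (carrier (residue_field R))" unfolding RV by (rule K.finite_residue_field)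
    show "p \<noteq> \<zero>\<^bsub>R\<^esub>"
    proof
      assume "p = \<zero>\<^bsub>R\<^esub>"
      then have "max_ideal R \<subseteq> {\<zero>\<^bsub>R\<^esub>}" unfolding gen cgenideal_def by auto
      moreover obtain t where "t \<in> carrier K" "t \<noteq> \<zero>\<^bsub>K\<^esub>" "\<nu> t = 1" by (rule K.ex_val_one)
      ultimately show False unfolding m ops by auto
    qed
    show "max_ideal R = carrier R - Units R"
    proof
      have "\<one>\<^bsub>R\<^esub> \<notin> max_ideal R" unfolding m ops by (simp add: K.val_one)
      then have "x \<notin> max_ideal R" if "x \<in> Units R" for x
        using that ideal.I_l_closed[OF maximalideal.axioms(1)[OF max], of x "inv\<^bsub>R\<^esub> x"] by auto
      then show "max_ideal R \<subseteq> carrier R - Units R" unfolding m carr by auto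
      show "carrier R - Units R \<subseteq> max_ideal R"
      proof
        fix x assume x: "x \<in> carrier R - Units R"
        show "x \<in> max_ideal R"
        proof (rule ccontr)
          assume "x \<notin> max_ideal R"
          then have x0: "x \<in> carrier K" "x \<noteq> \<zero>\<^bsub>K\<^esub>" "\<nu> x = 0" using x by (auto simp: m carr)
          let ?y = "inv\<^bsub>K\<^esub> x"
          have "?y \<in> carrier R" using K.val_inv[OF x0(1,2)] x0(3) by (simp add: carr)
          moreover have "?y \<otimes>\<^bsub>R\<^esub> x = \<one>\<^bsub>R\<^esub>" using K.val_inv[OF x0(1,2)] by (simp add: ops)
          ultimately have "x \<in> Units R" using x V.m_comm[of x ?y] unfolding Units_def by auto
          then show False using x by simp
        qed
      qed
    qed
  qed
qed

lemma iso_image_coset: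
  assumes "ring R" "ring S" and h: "h \<in> ring_iso R S" and I: "I \<subseteq> carrier R" and x: "x \<in> carrier R"
  shows "h ` (I +>\<^bsub>R\<^esub> x) = (h ` I) +>\<^bsub>S\<^esub> h x"
proof -
  interpret ring_hom_ring R S h using assms(1-3) by (rule ring_iso_hom)
  show ?thesis using I x unfolding a_r_coset_def' by (auto simp: subset_iff image_iff)
qed

lemma quot_iso:
  assumes R: "ring R" and S: "ring S" and h: "h \<in> ring_iso R S"
    and I: "ideal I R" and J: "ideal J S" and hI: "h ` I = J"
  shows "(`) h \<in> ring_iso (R Quot I) (S Quot J)"
proof -
  interpret h: ring_hom_ring R S h using R S h by (rule ring_iso_hom)
  interpret I: ring_hom_ring R "R Quot I" "(+>\<^bsub>R\<^esub>) I" by (rule ideal.rcos_ring_hom_ring[OF I])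
  interpret J: ring_hom_ring S "S Quot J" "(+>\<^bsub>S\<^esub>) J" by (rule ideal.rcos_ring_hom_ring[OF J])
  have img: "h ` (I +>\<^bsub>R\<^esub> x) = J +>\<^bsub>S\<^esub> h x" if "x \<in> carrier R" for x
    using iso_image_coset[OF R S h _ that, of I] ideal.Icarr[OF I] hI by auto
  have surj: "carrier S = h ` carrier R" and inj: "inj_on h (carrier R)"
    using ring_iso_bij[OF h] by (auto simp: bij_betw_def)
  have "(`) h \<in> Ring.ring_hom (R Quot I) (S Quot J)"
  proof (rule ring_hom_memI)
    fix a b assume "a \<in> carrier (R Quot I)" "b \<in> carrier (R Quot I)"
    then obtain x y where xy [simp]: "x \<in> carrier R" "y \<in> carrier R" and ab: "a = I +>\<^bsub>R\<^esub> x" "b = I +>\<^bsub>R\<^esub> y"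
      unfolding quot_carrier by blast
    show "h ` a \<in> carrier (S Quot J)" by (simp add: ab img)
    have "h ` (a \<otimes>\<^bsub>R Quot I\<^esub> b) = h ` (I +>\<^bsub>R\<^esub> (x \<otimes>\<^bsub>R\<^esub> y))" by (simp add: ab)
    then show "h ` (a \<otimes>\<^bsub>R Quot I\<^esub> b) = h ` a \<otimes>\<^bsub>S Quot J\<^esub> h ` b"
      by (simp add: ab img del: I.hom_mult)
    have "h ` (a \<oplus>\<^bsub>R Quot I\<^esub> b) = h ` (I +>\<^bsub>R\<^esub> (x \<oplus>\<^bsub>R\<^esub> y))" by (simp add: ab)
    then show "h ` (a \<oplus>\<^bsub>R Quot I\<^esub> b) = h ` a \<oplus>\<^bsub>S Quot J\<^esub> h ` b"
      by (simp add: ab img del: I.hom_add)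
  next
    show "h ` \<one>\<^bsub>R Quot I\<^esub> = \<one>\<^bsub>S Quot J\<^esub>" using img[of "\<one>\<^bsub>R\<^esub>"] by simp
  qed
  moreover have "(`) h ` carrier (R Quot I) = carrier (S Quot J)"
    unfolding quot_carrier surj image_image by (rule image_cong) (simp_all add: img)
  moreover have "inj_on ((`) h) (carrier (R Quot I))"
  proof -
    have "carrier (R Quot I) \<subseteq> Pow (carrier R)"
      unfolding quot_carrier using h.R.coset_mem_iff[OF I] by auto
    then show ?thesis using inj_on_image_Pow[OF inj] inj_on_subset by blast
  qed
  ultimately show ?thesis by (simp add: ring_iso_def bij_betw_def)
qed

lemma iso_image_ideal_prod:
  assumes R: "ring R" and S: "ring S" and h: "h \<in> ring_iso R S"
    and I: "ideal I R" and J: "ideal J R"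
  shows "h ` (I \<cdot>\<^bsub>R\<^esub> J) = (h ` I) \<cdot>\<^bsub>S\<^esub> (h ` J)"
proof -
  interpret h: ring_hom_ring R S h using R S h by (rule ring_iso_hom)
  note carr = ideal.Icarr[OF I] ideal.Icarr[OF J] ideal.Icarr[OF h.R.ideal_prod_is_ideal[OF I J]]
  show ?thesis
  proof
    show "h ` (I \<cdot>\<^bsub>R\<^esub> J) \<subseteq> (h ` I) \<cdot>\<^bsub>S\<^esub> (h ` J)"
    proof
      fix y assume "y \<in> h ` (I \<cdot>\<^bsub>R\<^esub> J)"
      then obtain x where x: "x \<in> I \<cdot>\<^bsub>R\<^esub> J" "y = h x" by blast
      from x(1) have "h x \<in> (h ` I) \<cdot>\<^bsub>S\<^esub> (h ` J)"
      proof (induction rule: ideal_prod.induct)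
        case (prod i j)
        then show ?case using carr by (auto intro: ideal_prod.prod)
      next
        case (sum s t)
        then show ?case using carr(3) by (auto intro: ideal_prod.sum)
      qed
      then show "y \<in> (h ` I) \<cdot>\<^bsub>S\<^esub> (h ` J)" by (simp add: x(2))
    qed
    show "(h ` I) \<cdot>\<^bsub>S\<^esub> (h ` J) \<subseteq> h ` (I \<cdot>\<^bsub>R\<^esub> J)"
    proof
      fix y assume "y \<in> (h ` I) \<cdot>\<^bsub>S\<^esub> (h ` J)"
      then show "y \<in> h ` (I \<cdot>\<^bsub>R\<^esub> J)"
      proof (induction rule: ideal_prod.induct)
        case (prod a b)
        then obtain i j where ij: "i \<in> I" "j \<in> J" "a = h i" "b = h j" by blast
        then have "a \<otimes>\<^bsub>S\<^esub> b = h (i \<otimes>\<^bsub>R\<^esub> j)" using carr by simp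
        then show ?case using ij ideal_prod.prod by (metis imageI)
      next
        case (sum a b)
        then obtain s t where st: "s \<in> I \<cdot>\<^bsub>R\<^esub> J" "t \<in> I \<cdot>\<^bsub>R\<^esub> J" "a = h s" "b = h t" by blast
        then have "a \<oplus>\<^bsub>S\<^esub> b = h (s \<oplus>\<^bsub>R\<^esub> t)" using carr(3) by simp
        then show ?case using st ideal_prod.sum by (metis imageI)
      qed
    qed
  qed
qed

text \<open>Only here does it matter that the isomorphism respects the chosen uniformizers: modulo \<open>\<pp>\<^sup>2\<close> it maps
one to the other, so it commutes with multiplication by them.\<close>

lemma pointed_iso_extension_iso:
  assumes R: "uniformized_ring R (\<pi> R)" and S: "uniformized_ring S (\<pi> S)" and iso: "pointed_iso \<pi> R S \<alpha>"
  shows "extension_iso (length_two_quot R) (residue_field R)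
      (uniformized_ring.reduce R) (uniformized_ring.embed R (\<pi> R))
      (length_two_quot S) (residue_field S)
      (uniformized_ring.reduce S) (uniformized_ring.embed S (\<pi> S)) ((`) \<alpha>) ((`) \<alpha>)"
proof -
  interpret R: uniformized_ring R "\<pi> R" by fact
  interpret S: uniformized_ring S "\<pi> S" by fact
  have \<alpha>: "\<alpha> \<in> ring_iso R S"
    and pt: "\<alpha> ` (max_ideal_sq R +>\<^bsub>R\<^esub> \<pi> R) = max_ideal_sq S +>\<^bsub>S\<^esub> \<pi> S"
    using iso by (auto simp: pointed_iso_def)
  interpret h: ring_hom_ring R S \<alpha> by (rule ring_iso_hom[OF R.ring_axioms S.ring_axioms \<alpha>])
  have surj: "carrier S = \<alpha> ` carrier R" using ring_iso_bij[OF \<alpha>] by (auto simp: bij_betw_def)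
  have m: "\<alpha> ` R.m = S.m"
    unfolding R.nonunits S.nonunits surj
    using ring_iso_Units_iff[OF R.ring_axioms S.ring_axioms \<alpha>] by auto
  have m2: "\<alpha> ` R.m2 = S.m2"
    unfolding max_ideal_sq_def m[symmetric]
    by (rule iso_image_ideal_prod[OF R.ring_axioms S.ring_axioms \<alpha> R.m_ideal R.m_ideal])
  have c1: "\<alpha> ` (R.m +>\<^bsub>R\<^esub> x) = S.m +>\<^bsub>S\<^esub> \<alpha> x" if "x \<in> carrier R" for x
    using iso_image_coset[OF R.ring_axioms S.ring_axioms \<alpha> _ that, of R.m] ideal.Icarr[OF R.m_ideal] m by auto
  have c2: "\<alpha> ` (R.m2 +>\<^bsub>R\<^esub> x) = S.m2 +>\<^bsub>S\<^esub> \<alpha> x" if "x \<in> carrier R" for x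
    using iso_image_coset[OF R.ring_axioms S.ring_axioms \<alpha> _ that, of R.m2] ideal.Icarr[OF R.m2_ideal] m2 by auto
  have p: "S.m2 +>\<^bsub>S\<^esub> \<alpha> (\<pi> R) = S.m2 +>\<^bsub>S\<^esub> \<pi> S" using pt c2[OF R.p_closed] by simp
  show ?thesis
    unfolding extension_iso_def
  proof (intro conjI ballI)
    show "(`) \<alpha> \<in> ring_iso (length_two_quot R) (length_two_quot S)"
      unfolding length_two_quot_def by (rule quot_iso[OF R.ring_axioms S.ring_axioms \<alpha> R.m2_ideal S.m2_ideal m2])
    show "(`) \<alpha> \<in> ring_iso (residue_field R) (residue_field S)"
      unfolding residue_field_def by (rule quot_iso[OF R.ring_axioms S.ring_axioms \<alpha> R.m_ideal S.m_ideal m])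
    fix a assume "a \<in> carrier (length_two_quot R)"
    then obtain x where x: "x \<in> carrier R" "a = R.m2 +>\<^bsub>R\<^esub> x" unfolding R.carrier_length_two by blast
    then show "S.reduce (\<alpha> ` a) = \<alpha> ` R.reduce a"
      by (simp add: c1 c2 R.reduce_coset S.reduce_coset)
  next
    fix a assume "a \<in> carrier (residue_field R)"
    then obtain x where x: "x \<in> carrier R" "a = R.m +>\<^bsub>R\<^esub> x" unfolding R.carrier_residue by blast
    have "\<alpha> ` R.embed a = S.m2 +>\<^bsub>S\<^esub> (\<alpha> (\<pi> R) \<otimes>\<^bsub>S\<^esub> \<alpha> x)"
      unfolding x(2) R.embed_coset[OF x(1)] using x(1) by (subst c2) auto
    also have "\<dots> = (S.m2 +>\<^bsub>S\<^esub> \<alpha> (\<pi> R)) \<otimes>\<^bsub>length_two_quot S\<^esub> (S.m2 +>\<^bsub>S\<^esub> \<alpha> x)"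
      using x by (subst S.Q2.hom_mult) auto
    also have "\<dots> = S.m2 +>\<^bsub>S\<^esub> (\<pi> S \<otimes>\<^bsub>S\<^esub> \<alpha> x)"
      unfolding p using x by (subst S.Q2.hom_mult) auto
    also have "\<dots> = S.embed (\<alpha> ` a)" using x by (simp add: c1 S.embed_coset)
    finally show "\<alpha> ` R.embed a = S.embed (\<alpha> ` a)" .
  qed
qed

lemma mat_extension_iso:
  assumes "square_zero_extension E F \<rho> \<iota>" "square_zero_extension E' F' \<rho>' \<iota>'"
    and "extension_iso E F \<rho> \<iota> E' F' \<rho>' \<iota>' a b"
  shows "extension_iso (mat_ring E n) (mat_ring F n) (map_mat \<rho>) (map_mat \<iota>)
     (mat_ring E' n) (mat_ring F' n) (map_mat \<rho>') (map_mat \<iota>') (map_mat a) (map_mat b)"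
proof -
  interpret L: square_zero_extension E F \<rho> \<iota> by fact
  interpret M: square_zero_extension E' F' \<rho>' \<iota>' by fact
  have "a \<in> ring_iso E E'" "b \<in> ring_iso F F'"
    and ab: "\<And>x. x \<in> carrier E \<Longrightarrow> \<rho>' (a x) = b (\<rho> x)" "\<And>x. x \<in> carrier F \<Longrightarrow> a (\<iota> x) = \<iota>' (b x)"
    using assms(3) by (auto simp: extension_iso_def)
  then have "map_mat a \<in> ring_iso (mat_ring E n) (mat_ring E' n)" "map_mat b \<in> ring_iso (mat_ring F n) (mat_ring F' n)"
    using map_mat_ring_iso L.R.ring_axioms L.S.ring_axioms M.R.ring_axioms M.S.ring_axioms by blast+
  moreover have "map_mat \<rho>' (map_mat a A) = map_mat b (map_mat \<rho> A)" if "A \<in> carrier (mat_ring E n)" for A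
    using that by (intro eq_matI) (auto simp: mat_ring_carrier ab)
  moreover have "map_mat a (map_mat \<iota> A) = map_mat \<iota>' (map_mat b A)" if "A \<in> carrier (mat_ring F n)" for A
    using that by (intro eq_matI) (auto simp: mat_ring_carrier ab)
  ultimately show ?thesis by (simp add: extension_iso_def)
qed

section \<open>The canonical bijection of conjugacy classes\<close>

text \<open>The exponent is chosen by a property that isomorphic rings share, hence it is the same for isomorphic
residue fields.\<close>

definition class_bijection ::
  "nat \<Rightarrow> ('a ring \<Rightarrow> 'a) \<Rightarrow> ('b ring \<Rightarrow> 'b) \<Rightarrow> 'a ring \<Rightarrow> 'b ring \<Rightarrow> ('a set \<Rightarrow> 'b set) \<Rightarrow>
     'a set mat set \<Rightarrow> 'b set mat set" where
  "class_bijection n \<pi> \<pi>' R S \<theta> =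
     transfer_set (mat_ring (length_two_quot R) n) (mat_ring (residue_field R) n)
       (map_mat (uniformized_ring.reduce R)) (map_mat (uniformized_ring.embed R (\<pi> R)))
       (mat_ring (length_two_quot S) n) (mat_ring (residue_field S) n)
       (map_mat (uniformized_ring.reduce S)) (map_mat (uniformized_ring.embed S (\<pi>' S)))
       (SOME q. frobenius_exponent (mat_ring (residue_field R) n) q) (map_mat \<theta>)"

lemma (in uniformized_ring) residue_matrix_exponent:
  "frobenius_exponent (mat_ring (residue_field R) n) (SOME q. frobenius_exponent (mat_ring (residue_field R) n) q)"
proof -
  interpret k: field "residue_field R" by (rule residue_is_field)
  interpret M: ring "mat_ring (residue_field R) n" by (rule Q1.S.mat_ring_is_ring)
  obtain l where l: "Factorial_Ring.prime l" "\<And>x. x \<in> carrier (residue_field R) \<Longrightarrow> [(l::nat)] \<cdot>\<^bsub>residue_field R\<^esub> x = \<zero>\<^bsub>residue_field R\<^esub>"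
    using k.finite_field_prime_torsion[OF finite_residue] by blast
  have "[l] \<cdot>\<^bsub>mat_ring (residue_field R) n\<^esub> A = \<zero>\<^bsub>mat_ring (residue_field R) n\<^esub>"
    if A: "A \<in> carrier (mat_ring (residue_field R) n)" for A
  proof (rule mat_ring_eqI[OF _ M.zero_closed])
    show "[l] \<cdot>\<^bsub>mat_ring (residue_field R) n\<^esub> A \<in> carrier (mat_ring (residue_field R) n)" using A by simp
    fix i j assume ij: "i < n" "j < n"
    then have "A $$ (i, j) \<in> carrier (residue_field R)" using A by (simp add: mat_ring_carrier)
    then show "([l] \<cdot>\<^bsub>mat_ring (residue_field R) n\<^esub> A) $$ (i, j) = \<zero>\<^bsub>mat_ring (residue_field R) n\<^esub> $$ (i, j)"
      using l(2) ij Q1.S.mat_ring_add_pow_entry[OF A ij] by (simp add: mat_ring_simps(4))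
  qed
  then have "\<exists>q. frobenius_exponent (mat_ring (residue_field R) n) q"
    by (intro M.frobenius_exponent_exists[OF finite_mat_ring[OF finite_residue] l(1)]) auto
  then show ?thesis by (rule someI_ex)
qed

lemma class_bijection_bij:
  assumes R: "uniformized_ring R (\<pi> R)" and S: "uniformized_ring S (\<pi>' S)"
    and \<theta>: "\<theta> \<in> ring_iso (residue_field R) (residue_field S)"
  shows "bij_betw (class_bijection n \<pi> \<pi>' R S \<theta>)
      (conj_classes (GL n (length_two_quot R))) (conj_classes (GL n (length_two_quot S)))"
    and "\<And>C. C \<in> conj_classes (GL n (length_two_quot R)) \<Longrightarrow>
      card (class_bijection n \<pi> \<pi>' R S \<theta> C) = card C"
proof -
  interpret R: uniformized_ring R "\<pi> R" by fact
  interpret S: uniformized_ring S "\<pi>' S" by fact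
  interpret kR: field "residue_field R" by (rule R.residue_is_field)
  interpret L: square_zero_extension "mat_ring (length_two_quot R) n" "mat_ring (residue_field R) n"
    "map_mat R.reduce" "map_mat R.embed"
    by (rule mat_square_zero_extension[OF R.length_two_extension])
  interpret M: square_zero_extension "mat_ring (length_two_quot S) n" "mat_ring (residue_field S) n"
    "map_mat S.reduce" "map_mat S.embed"
    by (rule mat_square_zero_extension[OF S.length_two_extension])
  interpret matched_extensions "mat_ring (length_two_quot R) n" "mat_ring (residue_field R) n"
    "map_mat R.reduce" "map_mat R.embed"
    "mat_ring (length_two_quot S) n" "mat_ring (residue_field S) n"
    "map_mat S.reduce" "map_mat S.embed"
    "SOME q. frobenius_exponent (mat_ring (residue_field R) n) q" "map_mat \<theta>"
    by unfold_locales (rule map_mat_ring_iso[OF R.Q1.S.ring_axioms S.Q1.S.ring_axioms \<theta>]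
        kR.mat_ring_von_neumann_regular R.residue_matrix_exponent)+
  show "bij_betw (class_bijection n \<pi> \<pi>' R S \<theta>)
      (conj_classes (GL n (length_two_quot R))) (conj_classes (GL n (length_two_quot S)))"
    unfolding GL_eq class_bijection_def by (rule transfer_bij_betw(1))
  show "card (class_bijection n \<pi> \<pi>' R S \<theta> C) = card C"
    if "C \<in> conj_classes (GL n (length_two_quot R))" for C
    using that unfolding GL_eq class_bijection_def by (rule transfer_bij_betw(2))
qed

lemma class_bijection_natural:
  assumes R: "uniformized_ring R (\<pi> R)" and S: "uniformized_ring S (\<pi>' S)"
    and R': "uniformized_ring R' (\<pi> R')" and S': "uniformized_ring S' (\<pi>' S')"
    and \<theta>: "\<theta> \<in> ring_iso (residue_field R) (residue_field S)"
    and \<alpha>: "pointed_iso \<pi> R R' \<alpha>" and \<beta>: "pointed_iso \<pi>' S S' \<beta>"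
    and sq: "\<And>x. x \<in> carrier (residue_field R) \<Longrightarrow> \<eta> (\<alpha> ` x) = \<beta> ` (\<theta> x)"
    and C: "C \<in> conj_classes (GL n (length_two_quot R))"
  shows "class_bijection n \<pi> \<pi>' R' S' \<eta> (class_transport \<alpha> C) =
     class_transport \<beta> (class_bijection n \<pi> \<pi>' R S \<theta> C)"
proof -
  interpret R: uniformized_ring R "\<pi> R" by fact
  interpret S: uniformized_ring S "\<pi>' S" by fact
  interpret R': uniformized_ring R' "\<pi> R'" by fact
  interpret S': uniformized_ring S' "\<pi>' S'" by fact
  note ext = R.length_two_extension S.length_two_extension R'.length_two_extension S'.length_two_extension
  note mext = ext[THEN mat_square_zero_extension, of n]
  note a = mat_extension_iso[OF ext(1,3) pointed_iso_extension_iso[of R \<pi> R', OF R R' \<alpha>], of n]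
  note b = mat_extension_iso[OF ext(2,4) pointed_iso_extension_iso[of S \<pi>' S', OF S S' \<beta>], of n]
  interpret L: square_zero_extension "mat_ring (length_two_quot R) n" "mat_ring (residue_field R) n"
    "map_mat R.reduce" "map_mat R.embed" by (rule mext(1))
  interpret L': square_zero_extension "mat_ring (length_two_quot R') n" "mat_ring (residue_field R') n"
    "map_mat R'.reduce" "map_mat R'.embed" by (rule mext(3))
  have iso: "map_mat ((`) \<alpha>) \<in> ring_iso (mat_ring (residue_field R) n) (mat_ring (residue_field R') n)"
    using a by (simp add: extension_iso_def)
  have q: "frobenius_exponent (mat_ring (residue_field R) n) = frobenius_exponent (mat_ring (residue_field R') n)"
    using frobenius_exponent_iso[OF L.S.ring_axioms L'.S.ring_axioms iso]
      frobenius_exponent_iso[OF L'.S.ring_axioms L.S.ring_axioms ring_iso_set_sym[OF L.S.ring_axioms iso]]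
    by blast
  have th: "map_mat \<theta> \<in> carrier (mat_ring (residue_field R) n) \<rightarrow> carrier (mat_ring (residue_field S) n)"
    using \<theta> by (auto intro!: map_mat_closed simp: ring_iso_def ring_hom_closed)
  have sq': "map_mat \<eta> (map_mat ((`) \<alpha>) A) = map_mat ((`) \<beta>) (map_mat \<theta> A)"
    if "A \<in> carrier (mat_ring (residue_field R) n)" for A
    using that sq by (intro eq_matI) (auto simp: mat_ring_carrier)
  have Csub: "C \<subseteq> carrier (mat_ring (length_two_quot R) n)"
    using C L.R.Units_closed unfolding GL_eq L.R.conj_classes_units by (auto simp: unit_class_def)
  show ?thesis
    unfolding class_bijection_def class_transport_def q
    by (rule transfer_set_natural[OF mext a b th sq' Csub])
qed

theorem theorem1p1:
  fixes n :: nat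
    and \<pi> :: "'a ring \<Rightarrow> 'a"
    and \<pi>' :: "'b ring \<Rightarrow> 'b"
  assumes "n \<ge> 1"
    and "\<And>\<O>. local_integer_ring \<O> \<Longrightarrow> uniformizer \<O> (\<pi> \<O>)"
    and "\<And>\<O>'. local_integer_ring \<O>' \<Longrightarrow> uniformizer \<O>' (\<pi>' \<O>')"
  shows "\<exists>\<Phi> :: 'a ring \<Rightarrow> 'b ring \<Rightarrow> ('a set \<Rightarrow> 'b set) \<Rightarrow> 'a set mat set \<Rightarrow> 'b set mat set.
    (\<forall>\<O> \<O>' \<theta>.
       local_integer_ring \<O> \<longrightarrow> local_integer_ring \<O>' \<longrightarrow>
       \<theta> \<in> ring_iso (residue_field \<O>) (residue_field \<O>') \<longrightarrow>
         bij_betw (\<Phi> \<O> \<O>' \<theta>)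
           (conj_classes (GL n (length_two_quot \<O>))) (conj_classes (GL n (length_two_quot \<O>'))) \<and>
         (\<forall>C \<in> conj_classes (GL n (length_two_quot \<O>)). card (\<Phi> \<O> \<O>' \<theta> C) = card C)) \<and>
    (\<forall>\<O> \<O>' \<theta> \<R> \<R>' \<eta> \<alpha> \<beta>.
       local_integer_ring \<O> \<longrightarrow> local_integer_ring \<O>' \<longrightarrow>
       \<theta> \<in> ring_iso (residue_field \<O>) (residue_field \<O>') \<longrightarrow>
       local_integer_ring \<R> \<longrightarrow> local_integer_ring \<R>' \<longrightarrow>
       \<eta> \<in> ring_iso (residue_field \<R>) (residue_field \<R>') \<longrightarrow>
       pointed_iso \<pi> \<O> \<R> \<alpha> \<longrightarrow> pointed_iso \<pi>' \<O>' \<R>' \<beta> \<longrightarrow>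
       (\<forall>x \<in> carrier (residue_field \<O>). \<eta> (\<alpha> ` x) = \<beta> ` (\<theta> x)) \<longrightarrow>
         (\<forall>C \<in> conj_classes (GL n (length_two_quot \<O>)).
            \<Phi> \<R> \<R>' \<eta> (class_transport \<alpha> C) = class_transport \<beta> (\<Phi> \<O> \<O>' \<theta> C)))"
proof -
  have u: "uniformized_ring \<O> (\<pi> \<O>)" if "local_integer_ring \<O>" for \<O>
    by (rule local_integer_ring_uniformized[OF that assms(2)[OF that]])
  have u': "uniformized_ring \<O>' (\<pi>' \<O>')" if "local_integer_ring \<O>'" for \<O>'
    by (rule local_integer_ring_uniformized[OF that assms(3)[OF that]])
  show ?thesis
  proof (intro exI[of _ "class_bijection n \<pi> \<pi>'"] conjI allI impI)
    fix \<O> :: "'a ring" and \<O>' :: "'b ring" and \<theta>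
    assume O: "local_integer_ring \<O>" and O': "local_integer_ring \<O>'"
      and \<theta>: "\<theta> \<in> ring_iso (residue_field \<O>) (residue_field \<O>')"
    note bij = class_bijection_bij[where \<pi> = \<pi> and \<pi>' = \<pi>', OF u[OF O] u'[OF O'] \<theta>]
    show "bij_betw (class_bijection n \<pi> \<pi>' \<O> \<O>' \<theta>)
           (conj_classes (GL n (length_two_quot \<O>))) (conj_classes (GL n (length_two_quot \<O>')))"
      by (rule bij(1))
    show "\<forall>C \<in> conj_classes (GL n (length_two_quot \<O>)).
        card (class_bijection n \<pi> \<pi>' \<O> \<O>' \<theta> C) = card C"
      by (intro ballI bij(2))
  next
    fix \<O> \<R> :: "'a ring" and \<O>' \<R>' :: "'b ring" and \<theta> \<eta> \<alpha> \<beta>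
    assume O: "local_integer_ring \<O>" "local_integer_ring \<O>'"
      and R: "local_integer_ring \<R>" "local_integer_ring \<R>'"
      and \<theta>: "\<theta> \<in> ring_iso (residue_field \<O>) (residue_field \<O>')"
      and iso: "pointed_iso \<pi> \<O> \<R> \<alpha>" "pointed_iso \<pi>' \<O>' \<R>' \<beta>"
      and sq: "\<forall>x \<in> carrier (residue_field \<O>). \<eta> (\<alpha> ` x) = \<beta> ` (\<theta> x)"
    show "\<forall>C \<in> conj_classes (GL n (length_two_quot \<O>)).
        class_bijection n \<pi> \<pi>' \<R> \<R>' \<eta> (class_transport \<alpha> C) =
        class_transport \<beta> (class_bijection n \<pi> \<pi>' \<O> \<O>' \<theta> C)"
      by (intro ballI class_bijection_natural[where \<pi> = \<pi> and \<pi>' = \<pi>',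
          OF u[OF O(1)] u'[OF O(2)] u[OF R(1)] u'[OF R(2)] \<theta> iso]) (rule bspec[OF sq])
  qed
qed

end
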